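(* For every $0<\delta<1$ there exists a constant $C_\delta$ (depending only on $\delta$) such that for all $\epsilon\in\mathbb{R}$ with $|\epsilon|>\delta$ and $|\epsilon-1|>\delta$, and all Schwartz functions $f$ on $\mathbb{R}$, $$\left\|\mathcal{C}^{even}_{\epsilon}f\right\|_{L^2(\mathbb{R})}\le C_\delta\|f\|_{L^2(\mathbb{R})}\qquad\text{and}\qquad \left\|\mathcal{C}^{odd}_{\epsilon}f\right\|_{L^2(\mathbb{R})}\le C_\delta\|f\|_{L^2(\mathbb{R})}.$$
   Context: For $\epsilon\in\mathbb{R}$ and a Schwartz function $f$ on $\mathbb{R}$, define $$\mathcal{C}^{even}_{\epsilon}f(x):=\sup_{A\in\mathbb{R}}\left|\int_{\mathbb{R}}e^{iA|y|^{\epsilon}}f(x-y)\frac{dy}{y}\right|,\qquad \mathcal{C}^{odd}_{\epsilon}f(x):=\sup_{A\in\mathbb{R}}\left|\int_{\mathbb{R}}e^{iA\,\mathrm{sgn}(y)|y|^{\epsilon}}f(x-y)\frac{dy}{y}\right|.$$ The integrals are understood in the principal value sense at $y=0$, i.e. as $\lim_{r\to0^+}\int_{|y|>r}$. *)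

theory Defs
  imports "HOL-Analysis.Analysis"
begin

definition nth_deriv :: "nat \<Rightarrow> (real \<Rightarrow> complex) \<Rightarrow> real \<Rightarrow> complex" where
  "nth_deriv n = ((\<lambda>g x. vector_derivative g (at x)) ^^ n)"

text \<open>The first conjunct makes every iterated derivative a genuine one (\<^const>\<open>vector_derivative\<close>
  is total).\<close>

definition schwartz :: "(real \<Rightarrow> complex) \<Rightarrow> bool" where
  "schwartz f \<longleftrightarrow>
     (\<forall>n x. nth_deriv n f differentiable (at x)) \<and>
     (\<forall>m n. bounded (range (\<lambda>x. x ^ m *\<^sub>R nth_deriv n f x)))"

text \<open>For the integrands below, with \<open>f\<close> Schwartz, each truncated integral converges absolutely and,
  for every exponent \<open>\<epsilon> \<noteq> 0\<close>, the limit exists. For \<open>\<epsilon> < 0\<close> and the odd phase it is only a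
  conditionally convergent one, as the phase oscillates at the origin.\<close>

definition pv_integral :: "(real \<Rightarrow> complex) \<Rightarrow> complex" where
  "pv_integral h = Lim (at_right 0) (\<lambda>r. LINT y:{y. \<bar>y\<bar> > r}|lborel. h y)"

text \<open>The suprema are taken in \<^typ>\<open>ennreal\<close>, so they are meaningful without a boundedness proof.\<close>

definition carleson_even :: "real \<Rightarrow> (real \<Rightarrow> complex) \<Rightarrow> real \<Rightarrow> ennreal" where
  "carleson_even \<epsilon> f x =
     (SUP A::real. ennreal (norm (pv_integral (\<lambda>y.
        exp (\<i> * complex_of_real (A * \<bar>y\<bar> powr \<epsilon>)) * f (x - y) / complex_of_real y))))"

definition carleson_odd :: "real \<Rightarrow> (real \<Rightarrow> complex) \<Rightarrow> real \<Rightarrow> ennreal" where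
  "carleson_odd \<epsilon> f x =
     (SUP A::real. ennreal (norm (pv_integral (\<lambda>y.
        exp (\<i> * complex_of_real (A * sgn y * \<bar>y\<bar> powr \<epsilon>)) * f (x - y) / complex_of_real y))))"

definition ennreal_sqrt :: "ennreal \<Rightarrow> ennreal" where
  "ennreal_sqrt t = (if t = \<infinity> then \<infinity> else ennreal (sqrt (enn2real t)))"

text \<open>The \<open>L\<^sup>2\<close> norm on the line of a function given by its modulus; it may be infinite.\<close>

definition L2_norm :: "(real \<Rightarrow> ennreal) \<Rightarrow> ennreal" where
  "L2_norm g = ennreal_sqrt (\<integral>\<^sup>+ x. (g x)\<^sup>2 \<partial>lborel)"

end

theory Submission
  imports Defs
begin

text \<open>For fixed sign of \<open>A\<close> the kernels \<open>exp (i A |y|\<^sup>\<epsilon>) / y\<close> are the dilates, by \<open>r = |A|\<^sup>-\<^sup>1\<^sup>/\<^sup>\<epsilon>\<close>, of one kernel,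
  so the Carleson operator is a maximal operator over dilations. Cut the line into the annuli on which
  \<open>|A| |y|\<^sup>\<epsilon>\<close> lies between consecutive powers of 2. Where \<open>|A| |y|\<^sup>\<epsilon>\<close> is small the phase factor is replaced by 1;
  the error is controlled by the maximal Poisson integral and what remains are truncated Hilbert transforms, that is,
  conjugate Poisson integrals up to Poisson integrals. Where \<open>|A| |y|\<^sup>\<epsilon> \<approx> 2\<^sup>n\<close>, linearise the supremum by a
  measurable choice of \<open>r\<close> and call \<open>T\<close> the resulting operator: the kernel of \<open>T T\<^sup>*\<close> is an oscillatory integral
  whose phase has at most one critical point, and it is dominated by \<open>2\<^sup>-\<^sup>n\<^sup>/\<^sup>4\<close> times Poisson kernels
  with a constant depending only on \<open>\<delta>\<close>, whence a summable bound.

  The same method handles the two classical maximal functions: the \<open>T T\<^sup>*\<close> kernel of the linearised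
  Poisson operator is bounded by Poisson kernels, so the norm of that operator satisfies \<open>\<parallel>T\<parallel>\<^sup>2 \<le> C \<parallel>T\<parallel>\<close>, and the
  \<open>T T\<^sup>*\<close> kernel of the conjugate Poisson operator is the same one.\<close>

section \<open>The \<open>T T\<^sup>*\<close> method\<close>

text \<open>The exponent 1/4 is a balance. Let N = 2^n and \<tau>^4 N = 1. Points at distance |d| <
  \<tau> r are treated trivially and cost \<tau> times a Poisson kernel of the shorter scale \<tau>
  r. At larger distance, integration by parts with a cutoff \<sigma> costs, up to constants, 1/(N
  \<sigma> r) + \<sigma>/r + \<sigma>/|d|, and \<sigma> = \<tau>^2 makes each term at most a
  multiple of \<tau>/r. The stationary point degenerates only through the factor (\<epsilon> - 1) d
  in the derivative of g, which is where \<epsilon> near 1 is excluded; \<epsilon> near 0 is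
  excluded because the annuli have ratio 2^(1/|\<epsilon>|). Poisson kernels recur because their
  correlation splits into kernels of a single scale each, and one quadratic form controls these for
  every measurable choice of scales. The linearisation is made for finitely many scales on a bounded
  interval, where all norms are finite, with constants independent of both; countably many scales
  follow by monotone convergence, real ones by continuity or comparison.\<close>

lemma borel_measurable_cnj [measurable (raw)]:
  assumes [measurable]: "f \<in> borel_measurable M"
  shows "(\<lambda>x. cnj (f x)) \<in> borel_measurable M"
  by (rule borel_measurable_continuous_on[OF continuous_on_cnj[OF continuous_on_id] assms])

lemma Fubini_swap:
  fixes F :: "real \<Rightarrow> real \<Rightarrow> complex"
  assumes [measurable]: "(\<lambda>(x, y). F x y) \<in> borel_measurable (lborel \<Otimes>\<^sub>M lborel)"
    and fin: "(\<integral>\<^sup>+x. \<integral>\<^sup>+y. ennreal (norm (F x y)) \<partial>lborel \<partial>lborel) < \<infinity>"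
  shows "(LINT x|lborel. LINT y|lborel. F x y) = (LINT y|lborel. LINT x|lborel. F x y)"
proof -
  have "integrable (lborel \<Otimes>\<^sub>M lborel) (\<lambda>(x, y). F x y)"
  proof (rule integrableI_bounded)
    have "(\<integral>\<^sup>+ p. ennreal (norm (case p of (x, y) \<Rightarrow> F x y)) \<partial>(lborel \<Otimes>\<^sub>M lborel))
       = (\<integral>\<^sup>+x. \<integral>\<^sup>+y. ennreal (norm (F x y)) \<partial>lborel \<partial>lborel)"
      by (subst lborel.nn_integral_fst[symmetric]) auto
    with fin show "(\<integral>\<^sup>+ p. ennreal (norm (case p of (x, y) \<Rightarrow> F x y)) \<partial>(lborel \<Otimes>\<^sub>M lborel)) < \<infinity>"
      by simp
  qed measurable
  from lborel_pair.Fubini_integral[OF this] show ?thesis by simp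
qed

lemma Cauchy_Schwarz_norm:
  fixes a b :: "'a \<Rightarrow> 'b::{real_normed_field, second_countable_topology}"
  assumes [measurable]: "a \<in> borel_measurable M" "b \<in> borel_measurable M"
  shows "(\<integral>\<^sup>+x. ennreal (norm (a x * b x)) \<partial>M)\<^sup>2
    \<le> (\<integral>\<^sup>+x. ennreal ((norm (a x))\<^sup>2) \<partial>M) * (\<integral>\<^sup>+x. ennreal ((norm (b x))\<^sup>2) \<partial>M)"
  using Cauchy_Schwarz_nn_integral[of "\<lambda>x. ennreal (norm (a x))" M "\<lambda>x. ennreal (norm (b x))"]
  by (simp add: norm_mult ennreal_mult ennreal_power)

lemma ennreal_power2_le_iff: "a\<^sup>2 \<le> b\<^sup>2 \<longleftrightarrow> a \<le> (b :: ennreal)"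
proof
  assume *: "a\<^sup>2 \<le> b\<^sup>2"
  show "a \<le> b"
  proof (rule ccontr)
    assume "\<not> a \<le> b"
    then have "b < a" by simp
    have "b * b < a * a"
    proof (cases "b = 0")
      case False
      then have "b * b < a * b"
        using \<open>b < a\<close> by (intro ennreal_mult_strict_right_mono)
          (auto simp: zero_less_iff_neq_zero intro: less_le_trans[OF _ top_greatest])
      also have "\<dots> \<le> a * a" using \<open>b < a\<close> by (intro mult_left_mono) auto
      finally show ?thesis .
    qed (use \<open>b < a\<close> in \<open>auto simp: zero_less_iff_neq_zero\<close>)
    with * show False by (simp add: power2_eq_square)
  qed
qed (simp add: power_mono)

text \<open>Cancels one factor \<open>G\<close>, which is legitimate only for finite
  \<open>G\<close>. This is why \<open>TTstar\<close> restricts the operator to a set of finite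
  measure.\<close>

lemma ennreal_le_of_square_le:
  fixes G :: ennreal
  assumes "G < \<infinity>" "G\<^sup>2 \<le> c * G"
  shows "G \<le> c"
proof (cases "G = 0")
  case False
  have "G * G \<le> G * c" using assms(2) by (simp add: power2_eq_square mult.commute)
  then show ?thesis
    using False assms(1) by (metis ennreal_mult_le_mult_iff infinity_ennreal_def less_irrefl)
qed simp

lemma norm_integral_le_nn_integral:
  fixes f :: "'a \<Rightarrow> 'b::{banach, second_countable_topology}"
  shows "ennreal (norm (integral\<^sup>L M f)) \<le> (\<integral>\<^sup>+x. ennreal (norm (f x)) \<partial>M)"
  by (cases "integrable M f") (auto simp: integral_norm_bound_ennreal not_integrable_integral_eq)

text \<open>Put g = T f and let \<open>G\<close> be its squared norm. Duality and Cauchy-Schwarz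
  bound \<open>G\<close>^2 by the squared norm of f times that of T^* g. The latter is the pairing
  of T T^* g with g, at most \<open>N * G\<close> by the hypothesis for u = |g|, and one factor
  \<open>G\<close> cancels. Since only absolute values enter, nonnegative u suffice in that
  hypothesis. \<open>E\<close> and \<open>B\<close> make the norms finite and the exchanges of
  integrals absolutely convergent.\<close>

lemma TTstar:
  fixes k :: "real \<Rightarrow> real \<Rightarrow> complex" and f :: "real \<Rightarrow> complex"
  assumes k [measurable]: "(\<lambda>(x, z). k x z) \<in> borel_measurable (lborel \<Otimes>\<^sub>M lborel)"
    and E: "E \<in> sets lborel" "emeasure lborel E < \<infinity>"
    and kE: "\<And>x z. x \<notin> E \<Longrightarrow> k x z = 0"
    and kB: "\<And>x. (\<integral>\<^sup>+z. ennreal ((norm (k x z))\<^sup>2) \<partial>lborel) \<le> ennreal B"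
    and N: "\<And>u :: real \<Rightarrow> real. u \<in> borel_measurable lborel \<Longrightarrow> (\<And>x. 0 \<le> u x) \<Longrightarrow>
        (\<integral>\<^sup>+x. ennreal ((u x)\<^sup>2) \<partial>lborel) < \<infinity> \<Longrightarrow> (\<And>x. x \<notin> E \<Longrightarrow> u x = 0) \<Longrightarrow>
        (\<integral>\<^sup>+x. \<integral>\<^sup>+x'. ennreal (norm (LINT z|lborel. k x z * cnj (k x' z)) * u x * u x') \<partial>lborel \<partial>lborel)
        \<le> N * (\<integral>\<^sup>+x. ennreal ((u x)\<^sup>2) \<partial>lborel)"
    and f [measurable]: "f \<in> borel_measurable lborel"
    and f2: "(\<integral>\<^sup>+x. ennreal ((norm (f x))\<^sup>2) \<partial>lborel) < \<infinity>"
  shows "(\<integral>\<^sup>+x. ennreal ((norm (LINT z|lborel. k x z * f z))\<^sup>2) \<partial>lborel)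
    \<le> N * (\<integral>\<^sup>+x. ennreal ((norm (f x))\<^sup>2) \<partial>lborel)"
proof -
  note [measurable] = E(1)
  define \<phi> where "\<phi> = (\<integral>\<^sup>+x. ennreal ((norm (f x))\<^sup>2) \<partial>lborel)"
  define g where "g x = (LINT z|lborel. k x z * f z)" for x
  define G where "G = (\<integral>\<^sup>+x. ennreal ((norm (g x))\<^sup>2) \<partial>lborel)"
  \<comment> \<open>The conjugate of T^* g. Its majorant \<open>hh\<close> has the absolute values
    inside; the square integrability of \<open>hh\<close> yields the finiteness of \<open>H\<close>
    and the exchange of integrals that computes \<open>H\<close>.\<close>
  define h where "h z = (LINT x|lborel. cnj (g x) * k x z)" for z
  define hh where "hh z = (\<integral>\<^sup>+x. ennreal (norm (g x) * norm (k x z)) \<partial>lborel)" for z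
  define H where "H = (\<integral>\<^sup>+x. ennreal ((norm (h x))\<^sup>2) \<partial>lborel)"
  have [measurable (raw)]: "(\<lambda>p. k (a p) (b p)) \<in> borel_measurable M"
    if [measurable]: "a \<in> borel_measurable M" "b \<in> borel_measurable M" for a b and M :: "'x measure"
    using measurable_compose[OF measurable_Pair[of a M lborel b lborel] k] that by simp
  have kx [measurable]: "k x \<in> borel_measurable lborel" for x
    using measurable_Pair2[OF k, of x] by simp
  have kz [measurable]: "(\<lambda>x. k x z) \<in> borel_measurable lborel" for z
    using measurable_Pair1[OF k, of z] by simp
  have g_meas [measurable]: "g \<in> borel_measurable lborel"
    unfolding g_def by measurable
  have h_meas [measurable]: "h \<in> borel_measurable lborel"
    unfolding h_def by measurable
  have hh_meas [measurable]: "hh \<in> borel_measurable lborel"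
    unfolding hh_def by measurable
  have gE: "g x = 0" if "x \<notin> E" for x using kE[OF that] by (simp add: g_def)
  have kf: "(\<integral>\<^sup>+z. ennreal (norm (k x z * f z)) \<partial>lborel)\<^sup>2 \<le> ennreal B * \<phi>" for x
    using Cauchy_Schwarz_norm[of "k x" lborel f] mult_right_mono[OF kB[of x], of \<phi>]
    unfolding \<phi>_def by (auto intro: order_trans)
  have Bphi: "ennreal B * \<phi> < \<infinity>"
    using f2 by (simp add: \<phi>_def ennreal_mult_less_top)
  have kk: "(\<integral>\<^sup>+z. ennreal (norm (k x z * k x' z)) \<partial>lborel) \<le> ennreal B" for x x'
  proof -
    have "(\<integral>\<^sup>+z. ennreal (norm (k x z * k x' z)) \<partial>lborel)\<^sup>2 \<le> ennreal B * ennreal B"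
      using Cauchy_Schwarz_norm[of "k x" lborel "k x'"] mult_mono[OF kB[of x] kB[of x']]
      by (auto intro: order_trans)
    then show ?thesis by (simp add: ennreal_power2_le_iff flip: power2_eq_square)
  qed
  have g_le: "ennreal ((norm (g x))\<^sup>2) \<le> ennreal B * \<phi>" for x
  proof -
    have "ennreal (norm (g x)) \<le> (\<integral>\<^sup>+z. ennreal (norm (k x z * f z)) \<partial>lborel)"
      unfolding g_def by (rule norm_integral_le_nn_integral) 
    then have "(ennreal (norm (g x)))\<^sup>2 \<le> (\<integral>\<^sup>+z. ennreal (norm (k x z * f z)) \<partial>lborel)\<^sup>2"
      by (rule power_mono) simp
    with kf[of x] show ?thesis by (auto simp: ennreal_power intro: order_trans)
  qed
  have Gfin: "G < \<infinity>"
  proof -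
    have "G \<le> (\<integral>\<^sup>+x. (ennreal B * \<phi>) * indicator E x \<partial>lborel)"
      unfolding G_def
      by (rule nn_integral_mono) (use g_le gE in \<open>auto split: split_indicator\<close>)
    also have "\<dots> < \<infinity>"
      using E Bphi by (simp add: nn_integral_cmult_indicator ennreal_mult_less_top)
    finally show ?thesis .
  qed
  have g1: "(\<integral>\<^sup>+x. ennreal (norm (g x)) \<partial>lborel) < \<infinity>"
  proof -
    have "(\<integral>\<^sup>+x. ennreal (norm (g x)) \<partial>lborel) = (\<integral>\<^sup>+x. ennreal (norm (g x * indicator E x)) \<partial>lborel)"
      by (rule nn_integral_cong) (use gE in \<open>auto split: split_indicator\<close>)
    also have "\<dots>\<^sup>2 \<le> G * (\<integral>\<^sup>+x. ennreal ((norm (indicator E x :: complex))\<^sup>2) \<partial>lborel)"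
      unfolding G_def by (rule Cauchy_Schwarz_norm) measurable
    also have "(\<integral>\<^sup>+x. ennreal ((norm (indicator E x :: complex))\<^sup>2) \<partial>lborel) = (\<integral>\<^sup>+x. indicator E x \<partial>lborel)"
      by (rule nn_integral_cong) (auto split: split_indicator)
    also have "G * \<dots> < \<infinity>"
      using E Gfin by (simp add: ennreal_mult_less_top)
    finally show ?thesis by (simp add: power_less_top_ennreal)
  qed
  \<comment> \<open>The square is a double integral in x and x'; z is integrated first, where
    \<open>kk\<close> gives the bound \<open>B\<close>, and g is integrable.\<close>
  have hh2: "(\<integral>\<^sup>+z. (hh z)\<^sup>2 \<partial>lborel) < \<infinity>"
  proof -
    have "(\<integral>\<^sup>+z. (hh z)\<^sup>2 \<partial>lborel)
      = (\<integral>\<^sup>+z. \<integral>\<^sup>+x. ennreal (norm (g x) * norm (k x z)) * hh z \<partial>lborel \<partial>lborel)"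
      by (subst nn_integral_multc) (auto simp: hh_def power2_eq_square)
    also have "\<dots> = (\<integral>\<^sup>+x. \<integral>\<^sup>+z. ennreal (norm (g x) * norm (k x z)) * hh z \<partial>lborel \<partial>lborel)"
      by (rule lborel_pair.Fubini') measurable
    also have "\<dots> = (\<integral>\<^sup>+x. \<integral>\<^sup>+z. \<integral>\<^sup>+x'. ennreal (norm (g x) * norm (k x z)) * ennreal (norm (g x') * norm (k x' z)) \<partial>lborel \<partial>lborel \<partial>lborel)"
      by (subst nn_integral_cmult) (auto simp: hh_def)
    also have "\<dots> = (\<integral>\<^sup>+x. \<integral>\<^sup>+x'. \<integral>\<^sup>+z. ennreal (norm (g x) * norm (k x z)) * ennreal (norm (g x') * norm (k x' z)) \<partial>lborel \<partial>lborel \<partial>lborel)"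
      by (intro nn_integral_cong lborel_pair.Fubini') measurable
    also have "\<dots> = (\<integral>\<^sup>+x. \<integral>\<^sup>+x'. \<integral>\<^sup>+z. ennreal (norm (g x)) * ennreal (norm (g x')) * ennreal (norm (k x z * k x' z)) \<partial>lborel \<partial>lborel \<partial>lborel)"
      by (simp add: ennreal_mult' norm_mult mult_ac)
    also have "\<dots> = (\<integral>\<^sup>+x. \<integral>\<^sup>+x'. ennreal (norm (g x)) * ennreal (norm (g x')) * (\<integral>\<^sup>+z. ennreal (norm (k x z * k x' z)) \<partial>lborel) \<partial>lborel \<partial>lborel)"
      by (simp add: nn_integral_cmult)
    also have "\<dots> \<le> (\<integral>\<^sup>+x. \<integral>\<^sup>+x'. ennreal (norm (g x)) * ennreal (norm (g x')) * ennreal B \<partial>lborel \<partial>lborel)"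
      by (intro nn_integral_mono mult_left_mono kk) auto
    also have "\<dots> = (\<integral>\<^sup>+x. ennreal (norm (g x)) \<partial>lborel) * ((\<integral>\<^sup>+x. ennreal (norm (g x)) \<partial>lborel) * ennreal B)"
      by (simp add: nn_integral_cmult nn_integral_multc mult.assoc)
    also have "\<dots> < \<infinity>" using g1 by (simp add: ennreal_mult_less_top)
    finally show ?thesis .
  qed
  have cnj_h: "cnj (h z) = (LINT x|lborel. g x * cnj (k x z))" for z
  proof -
    have "(LINT x|lborel. g x * cnj (k x z)) = (LINT x|lborel. cnj (cnj (g x) * k x z))"
      by (simp only: complex_cnj_mult complex_cnj_cnj)
    also have "\<dots> = cnj (h z)" unfolding h_def by (rule Bochner_Integration.integral_cnj)
    finally show ?thesis by simp
  qed
  have h_hh: "ennreal (norm (h z)) \<le> hh z" for z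
  proof -
    have "ennreal (norm (h z)) \<le> (\<integral>\<^sup>+x. ennreal (norm (cnj (g x) * k x z)) \<partial>lborel)"
      unfolding h_def by (rule norm_integral_le_nn_integral)
    then show ?thesis by (simp add: hh_def norm_mult)
  qed
  have Hfin: "H < \<infinity>"
  proof -
    have "H \<le> (\<integral>\<^sup>+z. (hh z)\<^sup>2 \<partial>lborel)"
      unfolding H_def using h_hh by (intro nn_integral_mono) (simp add: ennreal_power[symmetric] power_mono)
    with hh2 show ?thesis by simp
  qed
  have HN: "H \<le> N * G"
  proof -
    have inner: "(LINT z|lborel. k x z * g x' * cnj (k x' z)) = g x' * (LINT z|lborel. k x z * cnj (k x' z))" for x x'
      by (subst integral_mult_right_zero[symmetric]) (simp add: mult_ac)
    have swap: "(LINT z|lborel. LINT x'|lborel. k x z * g x' * cnj (k x' z))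
        = (LINT x'|lborel. LINT z|lborel. k x z * g x' * cnj (k x' z))" for x
    proof (rule Fubini_swap[symmetric])
      have "(\<integral>\<^sup>+ x'. \<integral>\<^sup>+ z. ennreal (norm (k x z * g x' * cnj (k x' z))) \<partial>lborel \<partial>lborel)
         = (\<integral>\<^sup>+ x'. ennreal (norm (g x')) * (\<integral>\<^sup>+ z. ennreal (norm (k x z * k x' z)) \<partial>lborel) \<partial>lborel)"
        by (subst nn_integral_cmult[symmetric]) (auto simp: norm_mult ennreal_mult mult_ac)
      also have "\<dots> \<le> (\<integral>\<^sup>+ x'. ennreal (norm (g x')) * ennreal B \<partial>lborel)"
        by (intro nn_integral_mono mult_left_mono kk) auto
      also have "\<dots> < \<infinity>" using g1 by (simp add: nn_integral_multc ennreal_mult_less_top)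
      finally show "(\<integral>\<^sup>+ x'. \<integral>\<^sup>+ z. ennreal (norm (k x z * g x' * cnj (k x' z))) \<partial>lborel \<partial>lborel) < \<infinity>" .
    qed measurable
    have "complex_of_real (LINT z|lborel. (norm (h z))\<^sup>2) = (LINT z|lborel. LINT x|lborel. cnj (g x) * k x z * cnj (h z))"
    proof -
      have "complex_of_real (LINT z|lborel. (norm (h z))\<^sup>2) = (LINT z|lborel. h z * cnj (h z))"
        by (simp only: complex_norm_square flip: integral_complex_of_real)
      then show ?thesis by (simp add: h_def)
    qed
    also have "\<dots> = (LINT x|lborel. LINT z|lborel. cnj (g x) * k x z * cnj (h z))"
    proof (rule Fubini_swap)
      have "(\<integral>\<^sup>+z. \<integral>\<^sup>+x. ennreal (norm (cnj (g x) * k x z * cnj (h z))) \<partial>lborel \<partial>lborel)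
          = (\<integral>\<^sup>+z. hh z * ennreal (norm (h z)) \<partial>lborel)"
        unfolding hh_def by (subst nn_integral_multc[symmetric]) (auto simp: norm_mult ennreal_mult)
      also have "\<dots> \<le> (\<integral>\<^sup>+z. (hh z)\<^sup>2 \<partial>lborel)"
        using h_hh by (intro nn_integral_mono) (simp add: power2_eq_square mult_left_mono)
      finally show "(\<integral>\<^sup>+z. \<integral>\<^sup>+x. ennreal (norm (cnj (g x) * k x z * cnj (h z))) \<partial>lborel \<partial>lborel) < \<infinity>"
        using hh2 by simp
    qed measurable
    also have "\<dots> = (LINT x|lborel. cnj (g x) * (LINT z|lborel. LINT x'|lborel. k x z * g x' * cnj (k x' z)))"
      by (simp add: cnj_h mult.assoc)
    also have "\<dots> = (LINT x|lborel. cnj (g x) * (LINT x'|lborel. LINT z|lborel. k x z * g x' * cnj (k x' z)))"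
      by (simp only: swap)
    also have "\<dots> = (LINT x|lborel. LINT x'|lborel. cnj (g x) * (g x' * (LINT z|lborel. k x z * cnj (k x' z))))"
      by (simp only: inner integral_mult_right_zero)
    finally have eq: "complex_of_real (LINT z|lborel. (norm (h z))\<^sup>2)
      = (LINT x|lborel. LINT x'|lborel. cnj (g x) * (g x' * (LINT z|lborel. k x z * cnj (k x' z))))" .
    have "H = ennreal (LINT z|lborel. (norm (h z))\<^sup>2)"
      unfolding H_def using Hfin
      by (intro nn_integral_eq_integral integrableI_bounded) (auto simp: H_def)
    also have "\<dots> = ennreal (norm (complex_of_real (LINT z|lborel. (norm (h z))\<^sup>2)))"
      by simp
    also have "\<dots> \<le> (\<integral>\<^sup>+x. \<integral>\<^sup>+x'. ennreal (norm (cnj (g x) * (g x' * (LINT z|lborel. k x z * cnj (k x' z))))) \<partial>lborel \<partial>lborel)"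
      unfolding eq
      by (intro order_trans[OF norm_integral_le_nn_integral] nn_integral_mono norm_integral_le_nn_integral)
    also have "\<dots> = (\<integral>\<^sup>+x. \<integral>\<^sup>+x'. ennreal (norm (LINT z|lborel. k x z * cnj (k x' z)) * norm (g x) * norm (g x')) \<partial>lborel \<partial>lborel)"
      by (simp add: norm_mult mult_ac)
    also have "\<dots> \<le> N * (\<integral>\<^sup>+x. ennreal ((norm (g x))\<^sup>2) \<partial>lborel)"
      using Gfin gE by (intro N) (auto simp: G_def)
    finally show ?thesis unfolding G_def .
  qed
  have "G\<^sup>2 \<le> \<phi> * H"
  proof -
    have "complex_of_real (LINT x|lborel. (norm (g x))\<^sup>2) = (LINT x|lborel. LINT z|lborel. cnj (g x) * k x z * f z)"
    proof -
      have "complex_of_real (LINT z|lborel. (norm (g z))\<^sup>2) = (LINT z|lborel. cnj (g z) * g z)"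
        by (simp only: complex_norm_square mult.commute flip: integral_complex_of_real)
      then show ?thesis by (simp add: g_def mult.assoc)
    qed
    also have "\<dots> = (LINT z|lborel. LINT x|lborel. cnj (g x) * k x z * f z)"
    proof (rule Fubini_swap)
      have "(\<integral>\<^sup>+x. \<integral>\<^sup>+z. ennreal (norm (cnj (g x) * k x z * f z)) \<partial>lborel \<partial>lborel)
          = (\<integral>\<^sup>+x. ennreal (norm (g x)) * (\<integral>\<^sup>+z. ennreal (norm (k x z * f z)) \<partial>lborel) \<partial>lborel)"
        by (subst nn_integral_cmult[symmetric]) (auto simp: norm_mult ennreal_mult mult_ac)
      also have "\<dots> \<le> (\<integral>\<^sup>+x. ennreal (norm (g x)) * (1 + ennreal B * \<phi>) \<partial>lborel)"
      proof (intro nn_integral_mono mult_left_mono)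
        fix x
        let ?s = "\<integral>\<^sup>+z. ennreal (norm (k x z * f z)) \<partial>lborel"
        \<comment> \<open>\<open>kf\<close> controls only the square of \<open>?s\<close>; this
          inequality avoids a root in \<open>ennreal\<close>.\<close>
        have "?s \<le> 1 + ?s\<^sup>2"
        proof (cases "?s \<le> 1")
          case False
          then have "?s * 1 \<le> ?s * ?s" by (intro mult_left_mono) auto
          then show ?thesis by (simp add: power2_eq_square add_increasing)
        qed (simp add: add_increasing2)
        also have "\<dots> \<le> 1 + ennreal B * \<phi>" using kf[of x] by (intro add_left_mono)
        finally show "?s \<le> 1 + ennreal B * \<phi>" .
      qed simp
      also have "\<dots> < \<infinity>" using g1 Bphi by (simp add: nn_integral_multc ennreal_mult_less_top)
      finally show "(\<integral>\<^sup>+x. \<integral>\<^sup>+z. ennreal (norm (cnj (g x) * k x z * f z)) \<partial>lborel \<partial>lborel) < \<infinity>" .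
    qed measurable
    also have "\<dots> = (LINT z|lborel. f z * h z)"
      by (simp add: h_def mult_ac)
    finally have eq: "complex_of_real (LINT x|lborel. (norm (g x))\<^sup>2) = (LINT z|lborel. f z * h z)" .
    have "G = ennreal (LINT z|lborel. (norm (g z))\<^sup>2)"
      unfolding G_def using Gfin
      by (intro nn_integral_eq_integral integrableI_bounded) (auto simp: G_def)
    also have "\<dots> = ennreal (norm (complex_of_real (LINT z|lborel. (norm (g z))\<^sup>2)))"
      by simp
    also have "\<dots> \<le> (\<integral>\<^sup>+z. ennreal (norm (f z * h z)) \<partial>lborel)"
      unfolding eq by (rule norm_integral_le_nn_integral)
    finally have "G\<^sup>2 \<le> (\<integral>\<^sup>+z. ennreal (norm (f z * h z)) \<partial>lborel)\<^sup>2"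
      by (rule power_mono) simp
    also have "\<dots> \<le> \<phi> * H"
      unfolding \<phi>_def H_def by (rule Cauchy_Schwarz_norm) measurable
    finally show ?thesis .
  qed
  also have "\<dots> \<le> \<phi> * (N * G)" using HN by (rule mult_left_mono) simp
  finally have "G\<^sup>2 \<le> (N * \<phi>) * G" by (simp add: mult_ac)
  with Gfin have "G \<le> N * \<phi>" by (rule ennreal_le_of_square_le)
  then show ?thesis by (simp add: G_def g_def \<phi>_def)
qed

section \<open>Poisson and conjugate Poisson kernels\<close>

text \<open>Taken without the usual factor 1/pi, so the mass is pi. With \<open>conj_poisson\<close>
  it makes up the Cauchy kernel: 1/(y - i r) = \<open>conj_poisson r y\<close> + i
  \<open>poisson r y\<close>.\<close>

definition poisson :: "real \<Rightarrow> real \<Rightarrow> real" where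
  "poisson r y = r / (r\<^sup>2 + y\<^sup>2)"

definition conj_poisson :: "real \<Rightarrow> real \<Rightarrow> real" where
  "conj_poisson r y = y / (r\<^sup>2 + y\<^sup>2)"

lemma poisson_measurable [measurable (raw)]:
  assumes [measurable]: "f \<in> borel_measurable M" "g \<in> borel_measurable M"
  shows "(\<lambda>x. poisson (f x) (g x)) \<in> borel_measurable M"
  unfolding poisson_def by measurable

lemma conj_poisson_measurable [measurable (raw)]:
  assumes [measurable]: "f \<in> borel_measurable M" "g \<in> borel_measurable M"
  shows "(\<lambda>x. conj_poisson (f x) (g x)) \<in> borel_measurable M"
  unfolding conj_poisson_def by measurable

lemma poisson_nonneg [simp]: "0 \<le> r \<Longrightarrow> 0 \<le> poisson r y"
  by (simp add: poisson_def)

lemma poisson_minus [simp]: "poisson r (- y) = poisson r y"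
  by (simp add: poisson_def)

lemma poisson_commute: "poisson r (x - y) = poisson r (y - x)"
  by (simp add: poisson_def power2_commute)

lemma poisson_le_inverse: "0 < r \<Longrightarrow> poisson r y \<le> 1 / r"
  using divide_left_mono[of "r\<^sup>2" "r\<^sup>2 + y\<^sup>2" r]
  by (simp add: poisson_def power2_eq_square add_pos_nonneg)

lemma nn_integral_poisson:
  assumes "0 < r"
  shows "(\<integral>\<^sup>+z. ennreal (poisson r (x - z)) \<partial>lborel) = ennreal pi"
proof -
  have half: "(\<integral>\<^sup>+y. ennreal (poisson r y) * indicator {0..} y \<partial>lborel) = ennreal (pi / 2)"
  proof -
    have "(\<integral>\<^sup>+y. ennreal (poisson r y) * indicator {0..} y \<partial>lborel) = ennreal (pi / 2 - arctan (0 / r))"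
    proof (rule nn_integral_FTC_atLeast)
      fix y :: real
      show "((\<lambda>y. arctan (y / r)) has_real_derivative poisson r y) (at y)"
        using assms
        by (auto intro!: derivative_eq_intros simp: poisson_def field_simps power2_eq_square add_nonneg_eq_0_iff)
      show "0 \<le> poisson r y" using assms by simp
    next
      have "filterlim (\<lambda>y. y / r) at_top at_top"
        using filterlim_at_top_mult_tendsto_pos[OF tendsto_const[of "inverse r"] _ filterlim_ident] assms
        by (simp add: divide_inverse)
      then show "((\<lambda>y. arctan (y / r)) \<longlongrightarrow> pi / 2) at_top"
        by (rule filterlim_compose[OF tendsto_arctan_at_top])
    qed simp
    then show ?thesis by simp
  qed
  have "(\<integral>\<^sup>+z. ennreal (poisson r (x - z)) \<partial>lborel) = (\<integral>\<^sup>+y. ennreal (poisson r y) \<partial>lborel)"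
    by (subst nn_integral_real_affine[of "\<lambda>y. ennreal (poisson r y)" "-1" x]) auto
  also have "\<dots> = (\<integral>\<^sup>+y. ennreal (poisson r y) * indicator {0..} y + ennreal (poisson r (- y)) * indicator {0<..} (- y) \<partial>lborel)"
    by (rule nn_integral_cong) (auto split: split_indicator)
  also have "\<dots> = ennreal (pi / 2) + (\<integral>\<^sup>+y. ennreal (poisson r (- y)) * indicator {0<..} (- y) \<partial>lborel)"
    by (subst nn_integral_add) (auto simp: half simp del: poisson_minus)
  also have "(\<integral>\<^sup>+y. ennreal (poisson r (- y)) * indicator {0<..} (- y) \<partial>lborel) = (\<integral>\<^sup>+y. ennreal (poisson r y) * indicator {0<..} y \<partial>lborel)"
    by (subst nn_integral_real_affine[of "\<lambda>y. ennreal (poisson r y) * indicator {0<..} y" "-1" 0])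
      (auto split: split_indicator simp del: poisson_minus)
  also have "\<dots> = (\<integral>\<^sup>+y. ennreal (poisson r y) * indicator {0..} y \<partial>lborel)"
    by (rule nn_integral_cong_AE) (use AE_lborel_singleton[of 0] in \<open>auto split: split_indicator\<close>)
  also have "ennreal (pi / 2) + \<dots> = ennreal pi"
    by (simp add: half flip: ennreal_plus)
  finally show ?thesis .
qed

lemma nn_integral_poisson':
  assumes "0 < r"
  shows "(\<integral>\<^sup>+z. ennreal (poisson r (z - x)) \<partial>lborel) = ennreal pi"
  using nn_integral_poisson[OF assms, of x] by (simp add: poisson_commute)

text \<open>One of |x - z| and |x' - z| is at least half of |x - x'|, and |v| <= 2 |u| implies
  P_s(u) <= 4 P_s(v), so that factor may be evaluated at x - x'. The exact convolution is pi times
  the Poisson kernel of scale r + r', which mixes the two scales; here each summand involves only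
  one scale once z is integrated out, as \<open>linearized_bound\<close> requires.\<close>

lemma poisson_mult_le:
  assumes "0 < r" "0 < r'"
  shows "poisson r (x - z) * poisson r' (x' - z)
    \<le> 4 * poisson r (x - x') * poisson r' (x' - z) + 4 * poisson r' (x - x') * poisson r (x - z)"
proof -
  have key: "poisson s u \<le> 4 * poisson s v" if "0 < s" "\<bar>v\<bar> \<le> 2 * \<bar>u\<bar>" for s u v :: real
  proof -
    have "v\<^sup>2 \<le> (2 * u)\<^sup>2" using that by (intro abs_le_square_iff[THEN iffD1]) (simp add: abs_mult)
    then have "(s\<^sup>2 + v\<^sup>2) \<le> 4 * (s\<^sup>2 + u\<^sup>2)" by (simp add: power_mult_distrib) (use zero_le_power2[of s] in linarith)
    then have "s * (s\<^sup>2 + v\<^sup>2) \<le> s * (4 * (s\<^sup>2 + u\<^sup>2))" using that by (intro mult_left_mono) auto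
    then show ?thesis using that unfolding poisson_def
      by (subst times_divide_eq_right, subst frac_le_eq) (auto simp: field_simps add_pos_nonneg intro!: divide_nonpos_pos add_pos_nonneg mult_pos_pos)
  qed
  have pos: "0 \<le> poisson r (x - z)" "0 \<le> poisson r' (x' - z)" "0 \<le> poisson r (x - x')" "0 \<le> poisson r' (x - x')"
    using assms by auto
  have "\<bar>x - x'\<bar> \<le> 2 * \<bar>x - z\<bar> \<or> \<bar>x - x'\<bar> \<le> 2 * \<bar>x' - z\<bar>"
    using abs_triangle_ineq4[of "x - z" "x' - z"] by auto
  then consider "\<bar>x - x'\<bar> \<le> 2 * \<bar>x - z\<bar>" | "\<bar>x - x'\<bar> \<le> 2 * \<bar>x' - z\<bar>" by blast
  then show ?thesis
  proof cases
    case 1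
    then have "poisson r (x - z) * poisson r' (x' - z) \<le> 4 * poisson r (x - x') * poisson r' (x' - z)"
      using key[of r "x - x'" "x - z"] assms pos by (intro mult_right_mono) auto
    then show ?thesis using pos by (simp add: add_increasing2)
  next
    case 2
    then have "poisson r (x - z) * poisson r' (x' - z) \<le> poisson r (x - z) * (4 * poisson r' (x - x'))"
      using key[of r' "x - x'" "x' - z"] assms pos by (intro mult_left_mono) auto
    then show ?thesis using pos by (simp add: add_increasing mult_ac)
  qed
qed

lemma nn_integral_poisson_mult_le:
  assumes "0 < r" "0 < r'"
  shows "(\<integral>\<^sup>+z. ennreal (poisson r (x - z) * poisson r' (x' - z)) \<partial>lborel)
    \<le> ennreal (4 * pi * (poisson r (x - x') + poisson r' (x - x')))"
proof -
  have "(\<integral>\<^sup>+z. ennreal (poisson r (x - z) * poisson r' (x' - z)) \<partial>lborel)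
    \<le> (\<integral>\<^sup>+z. ennreal (4 * poisson r (x - x')) * ennreal (poisson r' (x' - z))
        + ennreal (4 * poisson r' (x - x')) * ennreal (poisson r (x - z)) \<partial>lborel)"
    using assms
    by (intro nn_integral_mono) (simp add: poisson_mult_le flip: ennreal_mult ennreal_plus)
  also have "\<dots> = ennreal (4 * poisson r (x - x')) * ennreal pi + ennreal (4 * poisson r' (x - x')) * ennreal pi"
    by (simp add: nn_integral_add nn_integral_cmult nn_integral_poisson assms)
  also have "\<dots> = ennreal (4 * pi * (poisson r (x - x') + poisson r' (x - x')))"
    using assms by (simp add: algebra_simps flip: ennreal_mult ennreal_plus)
  finally show ?thesis .
qed

lemma poisson_mult_integrable:
  assumes "0 < r" "0 < r'"
  shows "integrable lborel (\<lambda>z. poisson r (x - z) * poisson r' (x' - z))"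
    and "(LINT z|lborel. poisson r (x - z) * poisson r' (x' - z)) \<le> 4 * pi * (poisson r (x - x') + poisson r' (x - x'))"
proof -
  show *: "integrable lborel (\<lambda>z. poisson r (x - z) * poisson r' (x' - z))"
    using nn_integral_poisson_mult_le[OF assms, of x x'] assms
    by (intro integrableI_bounded) (auto intro: le_less_trans)
  show "(LINT z|lborel. poisson r (x - z) * poisson r' (x' - z)) \<le> 4 * pi * (poisson r (x - x') + poisson r' (x - x'))"
    using nn_integral_poisson_mult_le[OF assms, of x x'] assms
    by (simp add: nn_integral_eq_integral[OF *])
qed

section \<open>Cauchy kernels and the correlation of conjugate Poisson kernels\<close>

lemma LINT_eq_0_of_antiderivative:
  fixes f F :: "real \<Rightarrow> complex"
  assumes f: "integrable lborel f" and cont: "continuous_on UNIV f"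
    and F: "\<And>x. (F has_vector_derivative f x) (at x)"
    and lim: "(F \<longlongrightarrow> 0) at_top" "(F \<longlongrightarrow> 0) at_bot"
  shows "(LINT x|lborel. f x) = 0"
proof -
  have [measurable]: "f \<in> borel_measurable lborel" using f by auto
  have "(\<lambda>n. LINT x|lborel. indicator {- real n..real n} x *\<^sub>R f x) \<longlonglongrightarrow> (LINT x|lborel. f x)"
  proof (rule integral_dominated_convergence[where w="\<lambda>x. norm (f x)"])
    show "AE x in lborel. (\<lambda>n. indicator {- real n..real n} x *\<^sub>R f x) \<longlonglongrightarrow> f x"
    proof (rule AE_I2)
      fix x :: real
      have "\<forall>\<^sub>F n in sequentially. indicator {- real n..real n} x *\<^sub>R f x = f x"
        using eventually_ge_at_top[of "nat \<lceil>\<bar>x\<bar>\<rceil>"] by eventually_elim (auto split: split_indicator simp: nat_ceiling_le_eq abs_le_iff)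
      then show "(\<lambda>n. indicator {- real n..real n} x *\<^sub>R f x) \<longlonglongrightarrow> f x" by (rule tendsto_eventually)
    qed
  qed (use f in \<open>auto split: split_indicator\<close>)
  moreover have "(LINT x|lborel. indicator {- real n..real n} x *\<^sub>R f x) = F (real n) - F (- real n)" for n
    using F cont by (intro integral_FTC_Icc) (auto intro: has_vector_derivative_at_within continuous_on_subset)
  moreover have "(\<lambda>n. F (real n) - F (- real n)) \<longlonglongrightarrow> 0 - 0"
    by (intro tendsto_diff filterlim_compose[OF lim(1)] filterlim_compose[OF lim(2)])
      (auto intro: filterlim_real_sequentially simp: filterlim_uminus_at_bot)
  ultimately show ?thesis using LIMSEQ_unique by fastforce
qed

lemma norm_inverse_shift_sq:
  fixes a :: complex
  assumes "Im a \<noteq> 0"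
  shows "(norm (1 / (complex_of_real y + a)))\<^sup>2 = poisson \<bar>Im a\<bar> (y - (- Re a)) / \<bar>Im a\<bar>"
  using assms by (simp add: norm_divide cmod_power2 poisson_def power_divide add.commute)

lemma of_real_add_neq_0: "Im a \<noteq> 0 \<Longrightarrow> complex_of_real y + a \<noteq> 0"
  by (auto simp: complex_eq_iff)

text \<open>Both poles -a and -b lie in the lower half-plane, so closing the contour in the upper
  one would give 0. Instead an explicit antiderivative vanishing at both ends is used: -1/(y + a)
  for a double pole, otherwise the difference of logarithms from partial fractions, divided by b -
  a. Integrability is Cauchy-Schwarz, because |1/(y + a)|^2 is a multiple of a Poisson
  kernel.\<close>

lemma cauchy_kernel_mult:
  fixes a b :: complex
  assumes "0 < Im a" "0 < Im b"
  shows "integrable lborel (\<lambda>y. 1 / (complex_of_real y + a) * (1 / (complex_of_real y + b)))" (is ?I)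
    and "(LINT y|lborel. 1 / (complex_of_real y + a) * (1 / (complex_of_real y + b))) = 0" (is ?Z)
proof -
  have nz: "complex_of_real y + a \<noteq> 0" "complex_of_real y + b \<noteq> 0" for y
    using assms of_real_add_neq_0[of a y] of_real_add_neq_0[of b y] by auto
  let ?f = "\<lambda>y. 1 / (complex_of_real y + a) * (1 / (complex_of_real y + b))"
  have fin: "(\<integral>\<^sup>+y. ennreal ((norm (1 / (complex_of_real y + c)))\<^sup>2) \<partial>lborel) < \<infinity>" if "0 < Im c" for c
  proof -
    have "(\<integral>\<^sup>+y. ennreal ((norm (1 / (complex_of_real y + c)))\<^sup>2) \<partial>lborel)
        = (\<integral>\<^sup>+y. ennreal (inverse (Im c)) * ennreal (poisson (Im c) (y - (- Re c))) \<partial>lborel)"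
    proof (rule nn_integral_cong)
      fix y
      show "ennreal ((norm (1 / (complex_of_real y + c)))\<^sup>2) = ennreal (inverse (Im c)) * ennreal (poisson (Im c) (y - (- Re c)))"
        using that by (subst norm_inverse_shift_sq)
          (simp_all add: divide_inverse mult.commute del: diff_minus_eq_add flip: ennreal_mult)
    qed
    also have "\<dots> = ennreal (inverse (Im c)) * ennreal pi"
      using that by (simp add: nn_integral_cmult nn_integral_poisson' del: diff_minus_eq_add)
    finally show ?thesis by (simp add: ennreal_mult_less_top)
  qed
  show I: ?I
  proof (rule integrableI_bounded)
    have "(\<integral>\<^sup>+y. ennreal (norm (?f y)) \<partial>lborel)\<^sup>2 < \<infinity>"
      by (rule le_less_trans[OF Cauchy_Schwarz_norm])
        (use fin assms in \<open>auto simp: ennreal_mult_less_top intro!: borel_measurable_continuous_onI continuous_intros nz\<close>)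
    then show "(\<integral>\<^sup>+y. ennreal (norm (?f y)) \<partial>lborel) < \<infinity>" by (simp add: power_less_top_ennreal)
  qed (auto intro!: borel_measurable_continuous_onI continuous_intros nz)
  have cont: "continuous_on UNIV ?f" by (intro continuous_intros) (auto simp: nz)
  have inv: "((\<lambda>y. 1 / (complex_of_real y + c)) \<longlongrightarrow> 0) F" if "filterlim complex_of_real at_infinity F" for c F
    by (rule tendsto_divide_0[OF tendsto_const tendsto_add_filterlim_at_infinity'[OF that tendsto_const]])
  have inf: "filterlim complex_of_real at_infinity G" if "G \<le> at_infinity" for G
    using filterlim_at_infinity_imp_norm_at_top[OF filterlim_mono[OF filterlim_ident order_refl that]]
    by (intro filterlim_norm_at_top_imp_at_infinity) simp
  note inf = inf[OF at_top_le_at_infinity] inf[OF at_bot_le_at_infinity]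
  show ?Z
  proof (cases "a = b")
    case True
    show ?thesis
    proof (rule LINT_eq_0_of_antiderivative[OF I cont])
      fix y :: real
      have "((\<lambda>z. - (1 / (z + a))) has_field_derivative 1 / (complex_of_real y + a) * (1 / (complex_of_real y + b))) (at (complex_of_real y))"
        using nz[of y] by (auto intro!: derivative_eq_intros simp: True field_simps power2_eq_square)
      then show "((\<lambda>y. - (1 / (complex_of_real y + a))) has_vector_derivative ?f y) (at y)"
        by (rule has_vector_derivative_real_field)
    qed (use tendsto_minus[OF inv[OF inf(1), of a]] tendsto_minus[OF inv[OF inf(2), of a]] in auto)
  next
    case False
    \<comment> \<open>The difference of logarithms is differentiable because both arguments stay in
      the upper half-plane, off the cut. Its decay is read off from the logarithm of the quotient,
      which tends to 1. The two forms agree because both imaginary parts lie in (0, pi), so their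
      difference lies in (-pi, pi).\<close>
    define D where "D y = Ln (complex_of_real y + a) - Ln (complex_of_real y + b)" for y
    have D: "D y = Ln ((complex_of_real y + a) / (complex_of_real y + b))" for y
    proof -
      have "0 < Im (Ln (complex_of_real y + a)) \<and> Im (Ln (complex_of_real y + a)) < pi"
        "0 < Im (Ln (complex_of_real y + b)) \<and> Im (Ln (complex_of_real y + b)) < pi"
        using nz[of y] assms by (simp_all add: Im_Ln_pos_lt)
      then have "Ln (exp (D y)) = D y" by (intro Ln_exp) (auto simp: D_def)
      moreover have "exp (D y) = (complex_of_real y + a) / (complex_of_real y + b)"
        using nz[of y] by (simp add: D_def exp_diff)
      ultimately show ?thesis by simp
    qed
    have limD: "(D \<longlongrightarrow> 0) F" if "filterlim complex_of_real at_infinity F" for F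
    proof -
      have "((\<lambda>y. 1 + (a - b) * (1 / (complex_of_real y + b))) \<longlongrightarrow> 1 + (a - b) * 0) F"
        by (intro tendsto_intros inv that)
      moreover have "1 + (a - b) * (1 / (complex_of_real y + b)) = (complex_of_real y + a) / (complex_of_real y + b)" for y
        using nz[of y] by (simp add: field_simps)
      ultimately have "((\<lambda>y. (complex_of_real y + a) / (complex_of_real y + b)) \<longlongrightarrow> 1) F" by simp
      then have "((\<lambda>y. Ln ((complex_of_real y + a) / (complex_of_real y + b))) \<longlongrightarrow> Ln 1) F"
        by (intro tendsto_Ln) auto
      then show ?thesis by (simp add: D[abs_def])
    qed
    show ?thesis
    proof (rule LINT_eq_0_of_antiderivative[OF I cont])
      fix y :: real
      have np: "complex_of_real y + a \<notin> \<real>\<^sub>\<le>\<^sub>0" "complex_of_real y + b \<notin> \<real>\<^sub>\<le>\<^sub>0"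
        using assms by (auto simp: complex_nonpos_Reals_iff)
      have "((\<lambda>z. (Ln (z + a) - Ln (z + b)) / (b - a)) has_field_derivative
          (1 / (complex_of_real y + a) - 1 / (complex_of_real y + b)) / (b - a)) (at (complex_of_real y))"
        using np False by (auto intro!: derivative_eq_intros simp: inverse_eq_divide)
      also have "(1 / (complex_of_real y + a) - 1 / (complex_of_real y + b)) / (b - a) = ?f y"
      proof -
        have "1 / (complex_of_real y + a) - 1 / (complex_of_real y + b) = (b - a) * ?f y"
          using nz[of y] by (simp add: field_simps)
        then show ?thesis using False by simp
      qed
      finally show "((\<lambda>y. D y / (b - a)) has_vector_derivative ?f y) (at y)"
        unfolding D_def by (rule has_vector_derivative_real_field)
    qed (use tendsto_divide_zero[OF limD[OF inf(1)], of "b - a"] tendsto_divide_zero[OF limD[OF inf(2)], of "b - a"] in auto)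
  qed
qed

text \<open>The real part of \<open>cauchy_kernel_mult\<close>: a product of two Cauchy kernels has
  as real part the product of the conjugate Poisson kernels minus that of the Poisson kernels. This
  is the fact that the Hilbert transform preserves inner products, and it hands the T T^* estimate
  of the Poisson maximal operator to the conjugate one.\<close>

lemma conj_poisson_mult:
  assumes "0 < r" "0 < r'"
  shows "(LINT z|lborel. conj_poisson r (x - z) * conj_poisson r' (x' - z))
    = (LINT z|lborel. poisson r (x - z) * poisson r' (x' - z))"
proof -
  define f where "f z = 1 / (complex_of_real z + Complex (- x) r) * (1 / (complex_of_real z + Complex (- x') r'))" for z
  have f: "integrable lborel f" "(LINT z|lborel. f z) = 0"
    unfolding f_def using cauchy_kernel_mult[of "Complex (- x) r" "Complex (- x') r'"] assms by auto
  have one: "1 / (complex_of_real z + Complex (- x) r) = - Complex (conj_poisson r (x - z)) (poisson r (x - z))" if "0 < r" for x r z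
  proof -
    define u where "u = z - x"
    have eq: "x - z = - u" "complex_of_real z + Complex (- x) r = Complex u r" by (auto simp: u_def complex_eq_iff)
    show ?thesis unfolding eq
      by (simp add: complex_eq_iff Re_divide Im_divide conj_poisson_def poisson_def add.commute)
  qed
  have Re: "Re (f z) = conj_poisson r (x - z) * conj_poisson r' (x' - z) - poisson r (x - z) * poisson r' (x' - z)" for z
    using assms by (simp add: f_def one)
  have "(LINT z|lborel. Re (f z)) = 0" using f by simp
  moreover have "integrable lborel (\<lambda>z. Re (f z))" using f by simp
  ultimately show ?thesis
    using poisson_mult_integrable(1)[OF assms, of x x']
      Bochner_Integration.integral_add[of lborel "\<lambda>z. Re (f z)" "\<lambda>z. poisson r (x - z) * poisson r' (x' - z)"]
    by (simp add: Re)
qed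

text \<open>\<open>TTstar\<close> for a correlation that splits into a part governed by the scale at
  x and its mirror image with x and x' exchanged. By Tonelli both parts have the same quadratic
  form, whence the factor 2.\<close>

lemma linearized_bound:
  fixes k :: "real \<Rightarrow> real \<Rightarrow> complex" and f :: "real \<Rightarrow> complex" and W :: "real \<Rightarrow> real \<Rightarrow> real"
  assumes k: "(\<lambda>(x, z). k x z) \<in> borel_measurable (lborel \<Otimes>\<^sub>M lborel)"
    and E: "E \<in> sets lborel" "emeasure lborel E < \<infinity>"
    and kE: "\<And>x z. x \<notin> E \<Longrightarrow> k x z = 0"
    and kB: "\<And>x. (\<integral>\<^sup>+z. ennreal ((norm (k x z))\<^sup>2) \<partial>lborel) \<le> ennreal B"
    and W [measurable]: "(\<lambda>(x, z). W x z) \<in> borel_measurable (lborel \<Otimes>\<^sub>M lborel)"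
    and W_nonneg: "\<And>x y. 0 \<le> W x y"
    and kW: "\<And>x x'. norm (LINT z|lborel. k x z * cnj (k x' z)) \<le> W x x' + W x' x"
    and \<beta>: "\<And>u :: real \<Rightarrow> real. u \<in> borel_measurable lborel \<Longrightarrow> (\<And>x. 0 \<le> u x) \<Longrightarrow>
        (\<integral>\<^sup>+x. ennreal ((u x)\<^sup>2) \<partial>lborel) < \<infinity> \<Longrightarrow> (\<And>x. x \<notin> E \<Longrightarrow> u x = 0) \<Longrightarrow>
        (\<integral>\<^sup>+x. \<integral>\<^sup>+x'. ennreal (W x x' * u x * u x') \<partial>lborel \<partial>lborel) \<le> \<beta> * (\<integral>\<^sup>+x. ennreal ((u x)\<^sup>2) \<partial>lborel)"
    and f: "f \<in> borel_measurable lborel" "(\<integral>\<^sup>+x. ennreal ((norm (f x))\<^sup>2) \<partial>lborel) < \<infinity>"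
  shows "(\<integral>\<^sup>+x. ennreal ((norm (LINT z|lborel. k x z * f z))\<^sup>2) \<partial>lborel)
    \<le> 2 * \<beta> * (\<integral>\<^sup>+x. ennreal ((norm (f x))\<^sup>2) \<partial>lborel)"
proof (rule TTstar[OF k E kE kB _ f])
  fix u :: "real \<Rightarrow> real"
  assume u: "u \<in> borel_measurable lborel" "\<And>x. 0 \<le> u x"
    "(\<integral>\<^sup>+x. ennreal ((u x)\<^sup>2) \<partial>lborel) < \<infinity>" "\<And>x. x \<notin> E \<Longrightarrow> u x = 0"
  note [measurable] = u(1)
  have [measurable (raw)]: "(\<lambda>p. W (a p) (b p)) \<in> borel_measurable M"
    if [measurable]: "a \<in> borel_measurable M" "b \<in> borel_measurable M" for a b and M :: "'x measure"
    using measurable_compose[OF measurable_Pair[of a M lborel b lborel] W] that by simp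
  let ?A = "\<integral>\<^sup>+x. \<integral>\<^sup>+x'. ennreal (W x x' * u x * u x') \<partial>lborel \<partial>lborel"
  have "(\<integral>\<^sup>+x. \<integral>\<^sup>+x'. ennreal (norm (LINT z|lborel. k x z * cnj (k x' z)) * u x * u x') \<partial>lborel \<partial>lborel)
    \<le> (\<integral>\<^sup>+x. \<integral>\<^sup>+x'. ennreal (W x x' * u x * u x') + ennreal (W x' x * u x' * u x) \<partial>lborel \<partial>lborel)"
  proof (intro nn_integral_mono)
    fix x x'
    have "norm (LINT z|lborel. k x z * cnj (k x' z)) * (u x * u x') \<le> (W x x' + W x' x) * (u x * u x')"
      using kW u(2) by (intro mult_right_mono) auto
    then show "ennreal (norm (LINT z|lborel. k x z * cnj (k x' z)) * u x * u x')
        \<le> ennreal (W x x' * u x * u x') + ennreal (W x' x * u x' * u x)"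
      using W_nonneg u(2) by (simp add: algebra_simps flip: ennreal_plus)
  qed
  also have "\<dots> = ?A + (\<integral>\<^sup>+x. \<integral>\<^sup>+x'. ennreal (W x' x * u x' * u x) \<partial>lborel \<partial>lborel)"
    by (simp add: nn_integral_add)
  also have "(\<integral>\<^sup>+x. \<integral>\<^sup>+x'. ennreal (W x' x * u x' * u x) \<partial>lborel \<partial>lborel) = ?A"
    by (rule lborel_pair.Fubini') measurable
  also have "?A + ?A = 2 * ?A" by (simp add: mult_2)
  also have "\<dots> \<le> 2 * \<beta> * (\<integral>\<^sup>+x. ennreal ((u x)\<^sup>2) \<partial>lborel)"
    unfolding mult.assoc[of 2 \<beta>] by (intro mult_left_mono \<beta> u) simp_all
  finally show "(\<integral>\<^sup>+x. \<integral>\<^sup>+x'. ennreal (norm (LINT z|lborel. k x z * cnj (k x' z)) * u x * u x') \<partial>lborel \<partial>lborel)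
    \<le> 2 * \<beta> * (\<integral>\<^sup>+x. ennreal ((u x)\<^sup>2) \<partial>lborel)" .
qed

lemma nn_integral_poisson_square:
  assumes "0 < r"
  shows "(\<integral>\<^sup>+z. ennreal ((poisson r (x - z))\<^sup>2) \<partial>lborel) \<le> ennreal (pi / r)"
proof -
  have "(\<integral>\<^sup>+z. ennreal ((poisson r (x - z))\<^sup>2) \<partial>lborel) \<le> (\<integral>\<^sup>+z. ennreal (1 / r) * ennreal (poisson r (x - z)) \<partial>lborel)"
  proof (intro nn_integral_mono)
    fix z
    have "poisson r (x - z) * poisson r (x - z) \<le> 1 / r * poisson r (x - z)"
      using assms by (intro mult_right_mono poisson_le_inverse) auto
    then show "ennreal ((poisson r (x - z))\<^sup>2) \<le> ennreal (1 / r) * ennreal (poisson r (x - z))"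
      using assms by (simp add: power2_eq_square flip: ennreal_mult)
  qed
  also have "\<dots> = ennreal (pi / r)"
    using assms by (subst nn_integral_cmult) (simp_all add: nn_integral_poisson flip: ennreal_mult)
  finally show ?thesis .
qed

text \<open>The quadratic form of the linearised Poisson operator \<open>T\<close> controls the kernel of \<open>T T\<^sup>*\<close>, so its
  norm \<open>b\<close> satisfies \<open>b\<^sup>2 \<le> 8 \<pi> b\<close>; the a priori bound by the measure of \<open>E\<close> only serves to make
  \<open>b\<close> finite.\<close>

lemma poisson_bilinear:
  fixes \<rho> u :: "real \<Rightarrow> real"
  assumes \<rho> [measurable]: "\<rho> \<in> borel_measurable lborel" and m: "0 < m" "\<And>x. m \<le> \<rho> x"
    and E: "E \<in> sets lborel" "emeasure lborel E < \<infinity>"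
    and u: "u \<in> borel_measurable lborel" "\<And>x. 0 \<le> u x"
      "(\<integral>\<^sup>+x. ennreal ((u x)\<^sup>2) \<partial>lborel) < \<infinity>" "\<And>x. x \<notin> E \<Longrightarrow> u x = 0"
  shows "(\<integral>\<^sup>+x. \<integral>\<^sup>+x'. ennreal (poisson (\<rho> x) (x - x') * u x * u x') \<partial>lborel \<partial>lborel)
    \<le> ennreal 27 * (\<integral>\<^sup>+x. ennreal ((u x)\<^sup>2) \<partial>lborel)"
proof -
  note [measurable] = E(1)
  have \<rho>0: "0 < \<rho> x" for x using m(1) m(2)[of x] by linarith
  then have \<rho>0': "0 \<le> \<rho> x" for x using less_imp_le by blast
  define adm :: "(real \<Rightarrow> real) set" where "adm = {u. u \<in> borel_measurable lborel \<and> (\<forall>x. 0 \<le> u x) \<and>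
      (\<integral>\<^sup>+x. ennreal ((u x)\<^sup>2) \<partial>lborel) < \<infinity> \<and> (\<forall>x. x \<notin> E \<longrightarrow> u x = 0)}"
  define Q where "Q u = (\<integral>\<^sup>+x. \<integral>\<^sup>+x'. ennreal (poisson (\<rho> x) (x - x') * u x * u x') \<partial>lborel \<partial>lborel)" for u :: "real \<Rightarrow> real"
  define S where "S u = (\<integral>\<^sup>+x. ennreal ((u x)\<^sup>2) \<partial>lborel)" for u :: "real \<Rightarrow> real"
  define V where "V = {\<beta>. 0 \<le> \<beta> \<and> (\<forall>u\<in>adm. Q u \<le> ennreal \<beta> * S u)}"
  \<comment> \<open>With a known bound \<open>\<beta>\<close>, \<open>linearized_bound\<close> makes
    the squared norm of T u at most 8 pi \<beta> times that of u; Cauchy-Schwarz for the pairing of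
    u with T u then gives the new constant.\<close>
  have step: "sqrt (8 * pi * \<beta>) \<in> V" if "\<beta> \<in> V" for \<beta>
  proof -
    have \<beta>: "0 \<le> \<beta>" "\<And>u. u \<in> adm \<Longrightarrow> Q u \<le> ennreal \<beta> * S u" using that by (auto simp: V_def)
    have "Q u \<le> ennreal (sqrt (8 * pi * \<beta>)) * S u" if "u \<in> adm" for u
    proof -
      have u: "u \<in> borel_measurable lborel" "\<And>x. 0 \<le> u x" "S u < \<infinity>" "\<And>x. x \<notin> E \<Longrightarrow> u x = 0"
        using that by (auto simp: adm_def S_def)
      note [measurable] = u(1)
      define k where "k x z = complex_of_real (indicator E x * poisson (\<rho> x) (x - z))" for x z
      have int_k: "integrable lborel (\<lambda>z. poisson (\<rho> x) (x - z) * u z)" for x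
      proof (rule integrableI_bounded)
        have "(\<integral>\<^sup>+z. ennreal (norm (poisson (\<rho> x) (x - z) * u z)) \<partial>lborel)\<^sup>2 \<le> ennreal (pi / \<rho> x) * S u"
          by (rule order_trans[OF Cauchy_Schwarz_norm])
            (use nn_integral_poisson_square[OF \<rho>0, of x x] in \<open>auto simp: S_def intro!: mult_right_mono\<close>)
        also have "\<dots> < \<infinity>" using u by (simp add: ennreal_mult_less_top)
        finally show "(\<integral>\<^sup>+z. ennreal (norm (poisson (\<rho> x) (x - z) * u z)) \<partial>lborel) < \<infinity>"
          by (simp add: power_less_top_ennreal)
      qed measurable
      have "(\<integral>\<^sup>+x. ennreal ((norm (LINT z|lborel. k x z * complex_of_real (u z)))\<^sup>2) \<partial>lborel)
          \<le> 2 * ennreal (4 * pi * \<beta>) * (\<integral>\<^sup>+x. ennreal ((norm (complex_of_real (u x)))\<^sup>2) \<partial>lborel)"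
      proof (rule linearized_bound[where W="\<lambda>x y. 4 * pi * poisson (\<rho> x) (x - y)" and B="pi / m", OF _ E])
        show "(\<lambda>(x, z). k x z) \<in> borel_measurable (lborel \<Otimes>\<^sub>M lborel)"
          unfolding k_def by measurable
        show "k x z = 0" if "x \<notin> E" for x z using that by (simp add: k_def)
        show "(\<integral>\<^sup>+z. ennreal ((norm (k x z))\<^sup>2) \<partial>lborel) \<le> ennreal (pi / m)" for x
        proof -
          have "(\<integral>\<^sup>+z. ennreal ((norm (k x z))\<^sup>2) \<partial>lborel) \<le> (\<integral>\<^sup>+z. ennreal ((poisson (\<rho> x) (x - z))\<^sup>2) \<partial>lborel)"
            using \<rho>0' by (intro nn_integral_mono) (auto simp: k_def norm_mult split: split_indicator)
          also have "\<dots> \<le> ennreal (pi / \<rho> x)" by (rule nn_integral_poisson_square[OF \<rho>0])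
          also have "\<dots> \<le> ennreal (pi / m)" using m \<rho>0 by (intro ennreal_leI divide_left_mono) auto
          finally show ?thesis .
        qed
        show "norm (LINT z|lborel. k x z * cnj (k x' z)) \<le> 4 * pi * poisson (\<rho> x) (x - x') + 4 * pi * poisson (\<rho> x') (x' - x)" for x x'
        proof -
          have "(LINT z|lborel. k x z * cnj (k x' z))
            = (LINT z|lborel. complex_of_real (indicator E x * indicator E x' * (poisson (\<rho> x) (x - z) * poisson (\<rho> x') (x' - z))))"
            by (simp add: k_def mult_ac)
          also have "\<dots> = complex_of_real (indicator E x * indicator E x' * (LINT z|lborel. poisson (\<rho> x) (x - z) * poisson (\<rho> x') (x' - z)))"
            by (simp only: integral_complex_of_real integral_mult_right_zero)
          also have "norm \<dots> \<le> \<bar>LINT z|lborel. poisson (\<rho> x) (x - z) * poisson (\<rho> x') (x' - z)\<bar>"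
            unfolding norm_of_real by (auto simp: abs_mult split: split_indicator)
          also have "\<dots> = (LINT z|lborel. poisson (\<rho> x) (x - z) * poisson (\<rho> x') (x' - z))"
            using \<rho>0' by (intro abs_of_nonneg Bochner_Integration.integral_nonneg) auto
          also have "\<dots> \<le> 4 * pi * poisson (\<rho> x) (x - x') + 4 * pi * poisson (\<rho> x') (x' - x)"
            using poisson_mult_integrable(2)[OF \<rho>0 \<rho>0, of x x x' x']
            by (simp add: poisson_commute[of _ x' x] distrib_left)
          finally show ?thesis .
        qed
        fix v :: "real \<Rightarrow> real"
        assume v: "v \<in> borel_measurable lborel" "\<And>x. 0 \<le> v x"
          "(\<integral>\<^sup>+x. ennreal ((v x)\<^sup>2) \<partial>lborel) < \<infinity>" "\<And>x. x \<notin> E \<Longrightarrow> v x = 0"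
        note [measurable] = v(1)
        have "(\<integral>\<^sup>+x. \<integral>\<^sup>+x'. ennreal (4 * pi * poisson (\<rho> x) (x - x') * v x * v x') \<partial>lborel \<partial>lborel)
          = ennreal (4 * pi) * Q v"
          using \<rho>0' v(2) by (simp add: Q_def nn_integral_cmult[symmetric] mult.assoc flip: ennreal_mult)
        also have "\<dots> \<le> ennreal (4 * pi) * (ennreal \<beta> * S v)"
          using v by (intro mult_left_mono \<beta>(2)) (auto simp: adm_def)
        finally show "(\<integral>\<^sup>+x. \<integral>\<^sup>+x'. ennreal (4 * pi * poisson (\<rho> x) (x - x') * v x * v x') \<partial>lborel \<partial>lborel)
          \<le> ennreal (4 * pi * \<beta>) * (\<integral>\<^sup>+x. ennreal ((v x)\<^sup>2) \<partial>lborel)"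
          using \<beta>(1) by (simp add: S_def ennreal_mult mult.assoc)
      qed (use \<rho>0' u in \<open>auto simp: S_def\<close>)
      also have "(\<integral>\<^sup>+x. ennreal ((norm (complex_of_real (u x)))\<^sup>2) \<partial>lborel) = S u"
        by (simp add: S_def)
      finally have T: "(\<integral>\<^sup>+x. ennreal ((norm (LINT z|lborel. k x z * complex_of_real (u z)))\<^sup>2) \<partial>lborel) \<le> ennreal (8 * pi * \<beta>) * S u"
        using \<beta>(1) ennreal_mult[of 2 "4 * pi * \<beta>"] by (simp add: mult.assoc)
      have k_eq: "ennreal (norm (LINT z|lborel. k x z * complex_of_real (u z))) = indicator E x * (\<integral>\<^sup>+z. ennreal (poisson (\<rho> x) (x - z) * u z) \<partial>lborel)" for x
      proof -
        have "(LINT z|lborel. k x z * complex_of_real (u z)) = (LINT z|lborel. complex_of_real (indicator E x * (poisson (\<rho> x) (x - z) * u z)))"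
          by (simp add: k_def mult.assoc)
        also have "\<dots> = complex_of_real (indicator E x * (LINT z|lborel. poisson (\<rho> x) (x - z) * u z))"
          by (simp only: integral_complex_of_real integral_mult_right_zero)
        finally have "ennreal (norm (LINT z|lborel. k x z * complex_of_real (u z))) = ennreal (indicator E x * (LINT z|lborel. poisson (\<rho> x) (x - z) * u z))"
          using \<rho>0' u(2) by (simp only: norm_of_real) (simp add: abs_mult Bochner_Integration.integral_nonneg)
        also have "\<dots> = indicator E x * (\<integral>\<^sup>+z. ennreal (poisson (\<rho> x) (x - z) * u z) \<partial>lborel)"
          using \<rho>0' u(2) by (subst nn_integral_eq_integral[OF int_k]) (auto split: split_indicator)
        finally show ?thesis .
      qed
      have [measurable]: "(\<lambda>x. LINT z|lborel. k x z * complex_of_real (u z)) \<in> borel_measurable lborel"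
        unfolding k_def by measurable
      have "Q u = (\<integral>\<^sup>+x. ennreal (norm (complex_of_real (u x) * (LINT z|lborel. k x z * complex_of_real (u z)))) \<partial>lborel)"
        unfolding Q_def
      proof (rule nn_integral_cong)
        fix x
        have "(\<integral>\<^sup>+x'. ennreal (poisson (\<rho> x) (x - x') * u x * u x') \<partial>lborel) = ennreal (u x) * (\<integral>\<^sup>+z. ennreal (poisson (\<rho> x) (x - z) * u z) \<partial>lborel)"
          using \<rho>0' u(2) by (simp add: nn_integral_cmult[symmetric] mult_ac flip: ennreal_mult)
        also have "\<dots> = ennreal (u x) * (indicator E x * (\<integral>\<^sup>+z. ennreal (poisson (\<rho> x) (x - z) * u z) \<partial>lborel))"
          using u(4)[of x] by (auto split: split_indicator)
        also have "\<dots> = ennreal (u x) * ennreal (norm (LINT z|lborel. k x z * complex_of_real (u z)))"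
          by (simp only: k_eq)
        finally show "(\<integral>\<^sup>+x'. ennreal (poisson (\<rho> x) (x - x') * u x * u x') \<partial>lborel) 
            = ennreal (norm (complex_of_real (u x) * (LINT z|lborel. k x z * complex_of_real (u z))))"
          using u(2) by (simp add: norm_mult ennreal_mult del: integral_mult_right_zero)
      qed
      then have "(Q u)\<^sup>2 \<le> (\<integral>\<^sup>+x. ennreal ((norm (complex_of_real (u x)))\<^sup>2) \<partial>lborel) * (\<integral>\<^sup>+x. ennreal ((norm (LINT z|lborel. k x z * complex_of_real (u z)))\<^sup>2) \<partial>lborel)"
        using Cauchy_Schwarz_norm[of "\<lambda>x. complex_of_real (u x)" lborel "\<lambda>x. LINT z|lborel. k x z * complex_of_real (u z)"] by simp
      also have "\<dots> \<le> S u * (ennreal (8 * pi * \<beta>) * S u)"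
        using T by (intro mult_mono) (auto simp: S_def)
      also have "\<dots> = (ennreal (sqrt (8 * pi * \<beta>)) * S u)\<^sup>2"
        using \<beta>(1) by (simp add: power_mult_distrib ennreal_power power2_eq_square[of "S u"] mult_ac)
      finally show ?thesis by (simp add: ennreal_power2_le_iff)
    qed
    then show ?thesis using \<beta>(1) by (auto simp: V_def)
  qed
  have "V \<noteq> {}"
  proof -
    have "Q u \<le> ennreal (measure lborel E / m) * S u" if "u \<in> adm" for u
    proof -
      have u: "u \<in> borel_measurable lborel" "\<And>x. 0 \<le> u x" "S u < \<infinity>" "\<And>x. x \<notin> E \<Longrightarrow> u x = 0"
        using that by (auto simp: adm_def S_def)
      note [measurable] = u(1)
      have "Q u \<le> (\<integral>\<^sup>+x. \<integral>\<^sup>+x'. ennreal (1 / m) * ennreal (u x) * ennreal (u x') \<partial>lborel \<partial>lborel)"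
        unfolding Q_def
      proof (intro nn_integral_mono)
        fix x x'
        have "poisson (\<rho> x) (x - x') \<le> 1 / m"
          using poisson_le_inverse[OF \<rho>0, of x "x - x'"] m \<rho>0[of x]
          by (auto intro: order_trans simp: frac_le)
        then have "poisson (\<rho> x) (x - x') * (u x * u x') \<le> 1 / m * (u x * u x')"
          using u(2) by (intro mult_right_mono) auto
        then show "ennreal (poisson (\<rho> x) (x - x') * u x * u x') \<le> ennreal (1 / m) * ennreal (u x) * ennreal (u x')"
          using u(2) m by (simp add: mult.assoc flip: ennreal_mult)
      qed
      also have "\<dots> = ennreal (1 / m) * (\<integral>\<^sup>+x. ennreal (u x) \<partial>lborel)\<^sup>2"
        by (simp add: nn_integral_cmult nn_integral_multc power2_eq_square mult.assoc)
      also have "(\<integral>\<^sup>+x. ennreal (u x) \<partial>lborel) = (\<integral>\<^sup>+x. ennreal (norm (u x * indicator E x)) \<partial>lborel)"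
        using u(2,4) by (intro nn_integral_cong) (auto split: split_indicator)
      also have "\<dots>\<^sup>2 \<le> S u * (\<integral>\<^sup>+x. ennreal ((norm (indicator E x :: real))\<^sup>2) \<partial>lborel)"
        using Cauchy_Schwarz_norm[of u lborel "indicator E"] by (simp add: S_def)
      also have "(\<integral>\<^sup>+x. ennreal ((norm (indicator E x :: real))\<^sup>2) \<partial>lborel) = (\<integral>\<^sup>+x. indicator E x \<partial>lborel)"
        by (rule nn_integral_cong) (auto split: split_indicator)
      also have "\<dots> = ennreal (measure lborel E)"
        using E by (simp add: emeasure_eq_ennreal_measure)
      finally have "Q u \<le> ennreal (1 / m) * (S u * ennreal (measure lborel E))"
        by (simp add: mult_left_mono)
      then show ?thesis using m
        by (simp add: divide_inverse mult_ac ennreal_mult)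
    qed
    then have "measure lborel E / m \<in> V" using m by (auto simp: V_def)
    then show ?thesis by blast
  qed
  \<comment> \<open>By \<open>step\<close>, b^2 <= 8 pi \<beta> for every \<beta> in
    \<open>V\<close>, hence b^2 <= 8 pi b. As 8 pi < 27, some \<beta> in \<open>V\<close> lies below
    27 whether or not the infimum is attained, and 27 depends neither on \<open>m\<close> nor on
    \<open>E\<close>.\<close>
  define b where "b = Inf V"
  have b_le: "b \<le> \<beta>" if "\<beta> \<in> V" for \<beta>
    unfolding b_def using that by (intro cInf_lower) (auto intro!: bdd_belowI[of _ 0] simp: V_def)
  have b0: "0 \<le> b"
    unfolding b_def using \<open>V \<noteq> {}\<close> by (intro cInf_greatest) (auto simp: V_def)
  have "b\<^sup>2 / (8 * pi) \<le> b"
    unfolding b_def[symmetric]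
  proof -
    have "b\<^sup>2 / (8 * pi) \<le> \<beta>" if "\<beta> \<in> V" for \<beta>
    proof -
      have "b\<^sup>2 \<le> (sqrt (8 * pi * \<beta>))\<^sup>2" using b_le[OF step[OF that]] b0 by (intro power_mono)
      also have "\<dots> = 8 * pi * \<beta>" using that by (simp add: V_def)
      finally show ?thesis by (simp add: field_simps)
    qed
    then show "b\<^sup>2 / (8 * pi) \<le> b"
      using \<open>V \<noteq> {}\<close> cInf_greatest[of V "b\<^sup>2 / (8 * pi)"] by (simp add: b_def)
  qed
  then have "b * b \<le> (8 * pi) * b" by (simp add: power2_eq_square field_simps)
  then have "b \<le> 8 * pi" using b0 by (cases "b = 0") auto
  also have "\<dots> < 27" using pi_less_4 pi_approx by simp
  finally obtain \<beta> where "\<beta> \<in> V" "\<beta> < 27"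
    using cInf_lessD[OF \<open>V \<noteq> {}\<close>] unfolding b_def by blast
  moreover have "u \<in> adm" using u by (simp add: adm_def)
  ultimately have "Q u \<le> ennreal \<beta> * S u" by (auto simp: V_def)
  also have "\<dots> \<le> ennreal 27 * S u" using \<open>\<beta> < 27\<close> by (intro mult_right_mono ennreal_leI) auto
  finally show ?thesis by (simp add: Q_def S_def)
qed

section \<open>Maximal functions of dilation families\<close>

text \<open>A new scale replaces the current one exactly where it is strictly better. The hypothesis
  on \<open>T\<close> allows variable scales, so that this set is measurable at each stage of the
  induction.\<close>

lemma measurable_argmax:
  fixes T :: "real \<Rightarrow> real \<Rightarrow> real"
  assumes "finite F" "F \<noteq> {}"
    and T: "\<And>\<rho>. \<rho> \<in> borel_measurable M \<Longrightarrow> (\<lambda>x. T (\<rho> x) x) \<in> borel_measurable M"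
  shows "\<exists>\<rho> \<in> borel_measurable M. (\<forall>x. \<rho> x \<in> F) \<and> (\<forall>x. \<forall>r\<in>F. T r x \<le> T (\<rho> x) x)"
  using assms(1,2)
proof (induction F rule: finite_ne_induct)
  case (singleton r)
  then show ?case by (intro bexI[of _ "\<lambda>_. r"]) auto
next
  case (insert r F)
  then obtain \<rho> where \<rho> [measurable]: "\<rho> \<in> borel_measurable M" and
    \<rho>F: "\<And>x. \<rho> x \<in> F" "\<And>x r. r \<in> F \<Longrightarrow> T r x \<le> T (\<rho> x) x" by blast
  note [measurable] = T[OF \<rho>] T[of "\<lambda>_. r", simplified]
  have "(\<lambda>x. if T (\<rho> x) x < T r x then r else \<rho> x) \<in> borel_measurable M" by measurable
  moreover have "T s x \<le> T (if T (\<rho> x) x < T r x then r else \<rho> x) x" if "s \<in> insert r F" for s x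
    using that \<rho>F(2)[of s x] by auto
  ultimately show ?case
    using \<rho>F(1) by (intro bexI[of _ "\<lambda>x. if T (\<rho> x) x < T r x then r else \<rho> x"]) auto
qed

text \<open>For the first scales on [-N, N] the maximiser \<open>\<rho>\<close> is measurable and
  bounded below by a positive number, so \<open>linearized_bound\<close> and
  \<open>poisson_bilinear\<close> apply with constants independent of N; monotone convergence
  removes N. The second scale \<open>\<tau> * r\<close> costs one more use of
  \<open>poisson_bilinear\<close>, for \<open>\<tau> * \<rho>\<close>, whence 108 as twice 27 +
  27.\<close>

lemma maximal_bound:
  fixes \<kappa> :: "real \<Rightarrow> real \<Rightarrow> complex" and rs :: "nat \<Rightarrow> real" and f :: "real \<Rightarrow> complex"
  assumes \<kappa>: "(\<lambda>(r, y). \<kappa> r y) \<in> borel_measurable (lborel \<Otimes>\<^sub>M lborel)"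
    and L2: "\<And>r. 0 < r \<Longrightarrow> (\<integral>\<^sup>+y. ennreal ((norm (\<kappa> r y))\<^sup>2) \<partial>lborel) < \<infinity>"
    and \<tau>: "0 < \<tau>" and c: "0 \<le> c"
    and K: "\<And>r r' x x'. 0 < r \<Longrightarrow> 0 < r' \<Longrightarrow>
      norm (LINT z|lborel. \<kappa> r (x - z) * cnj (\<kappa> r' (x' - z)))
      \<le> c * (poisson r (x - x') + poisson (\<tau> * r) (x - x')) + c * (poisson r' (x - x') + poisson (\<tau> * r') (x - x'))"
    and f [measurable]: "f \<in> borel_measurable lborel" and f2: "(\<integral>\<^sup>+x. ennreal ((norm (f x))\<^sup>2) \<partial>lborel) < \<infinity>"
    and rs: "\<And>n. 0 < rs n"
  shows "(\<integral>\<^sup>+x. (SUP n. ennreal ((norm (LINT z|lborel. \<kappa> (rs n) (x - z) * f z))\<^sup>2)) \<partial>lborel)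
    \<le> ennreal (108 * c) * (\<integral>\<^sup>+x. ennreal ((norm (f x))\<^sup>2) \<partial>lborel)"
proof -
  have \<kappa>m [measurable (raw)]: "(\<lambda>p. \<kappa> (a p) (b p)) \<in> borel_measurable M"
    if [measurable]: "a \<in> borel_measurable M" "b \<in> borel_measurable M" for a b and M :: "'x measure"
    using measurable_compose[OF measurable_Pair[of a M lborel b lborel] \<kappa>] that by simp
  define T where "T r x = norm (LINT z|lborel. \<kappa> r (x - z) * f z)" for r x
  have T_meas [measurable (raw)]: "(\<lambda>x. T (\<rho> x) x) \<in> borel_measurable lborel"
    if [measurable]: "\<rho> \<in> borel_measurable lborel" for \<rho>
    unfolding T_def by measurable
  have T_meas' [measurable]: "T r \<in> borel_measurable lborel" for r
    using T_meas[of "\<lambda>_. r"] by simp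
  define g where "g N x = indicator {- real N..real N} x * (SUP n\<in>{..N}. ennreal ((T (rs n) x)\<^sup>2))" for N :: nat and x
  have fin: "(\<integral>\<^sup>+x. g N x \<partial>lborel) \<le> ennreal (108 * c) * (\<integral>\<^sup>+x. ennreal ((norm (f x))\<^sup>2) \<partial>lborel)" for N
  proof -
    define E where "E = {- real N..real N}"
    define F where "F = rs ` {..N}"
    have F: "finite F" "F \<noteq> {}" "\<And>r. r \<in> F \<Longrightarrow> 0 < r" by (auto simp: F_def rs)
    obtain \<rho> where \<rho> [measurable]: "\<rho> \<in> borel_measurable lborel" and
      \<rho>F: "\<And>x. \<rho> x \<in> F" "\<And>x r. r \<in> F \<Longrightarrow> T r x \<le> T (\<rho> x) x"
      using measurable_argmax[OF F(1,2), of lborel T] T_meas by blast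
    have \<rho>0: "0 < \<rho> x" for x using \<rho>F F by blast
    define m where "m = Min F"
    have m: "0 < m" "\<And>x. m \<le> \<rho> x" using F \<rho>F by (auto simp: m_def)
    have E: "E \<in> sets lborel" "emeasure lborel E < \<infinity>" by (auto simp: E_def)
    note [measurable] = E(1)
    define k where "k x z = indicator E x * \<kappa> (\<rho> x) (x - z)" for x z
    \<comment> \<open>\<open>\<rho>\<close> takes finitely many values, so the sum of the squared
      norms over \<open>F\<close> is a finite bound uniform in x.\<close>
    define n2 where "n2 r = (\<integral>\<^sup>+y. ennreal ((norm (\<kappa> r y))\<^sup>2) \<partial>lborel)" for r
    have kz: "(LINT z|lborel. k x z * f z) = indicator E x * (LINT z|lborel. \<kappa> (\<rho> x) (x - z) * f z)" for x
      unfolding k_def mult.assoc by (rule integral_mult_right_zero)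
    have "(\<integral>\<^sup>+x. g N x \<partial>lborel) \<le> (\<integral>\<^sup>+x. ennreal ((norm (LINT z|lborel. k x z * f z))\<^sup>2) \<partial>lborel)"
    proof (intro nn_integral_mono)
      fix x
      have "(SUP n\<in>{..N}. ennreal ((T (rs n) x)\<^sup>2)) \<le> ennreal ((T (\<rho> x) x)\<^sup>2)"
        using \<rho>F(2)[of _ x] by (intro SUP_least ennreal_leI power_mono) (auto simp: F_def T_def)
      then have "g N x \<le> indicator E x * ennreal ((T (\<rho> x) x)\<^sup>2)"
        unfolding g_def E_def by (intro mult_left_mono) auto
      then show "g N x \<le> ennreal ((norm (LINT z|lborel. k x z * f z))\<^sup>2)"
        unfolding kz T_def by (auto split: split_indicator)
    qed
    also have "\<dots> \<le> 2 * ennreal (54 * c) * (\<integral>\<^sup>+x. ennreal ((norm (f x))\<^sup>2) \<partial>lborel)"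
    proof (rule linearized_bound[where W="\<lambda>x y. c * (poisson (\<rho> x) (x - y) + poisson (\<tau> * \<rho> x) (x - y))"
          and B="enn2real (\<Sum>r\<in>F. n2 r)", OF _ E])
      show "(\<lambda>(x, z). k x z) \<in> borel_measurable (lborel \<Otimes>\<^sub>M lborel)"
        unfolding k_def by measurable
      show "k x z = 0" if "x \<notin> E" for x z using that by (simp add: k_def)
      show "(\<integral>\<^sup>+z. ennreal ((norm (k x z))\<^sup>2) \<partial>lborel) \<le> ennreal (enn2real (\<Sum>r\<in>F. n2 r))" for x
      proof -
        have "(\<integral>\<^sup>+z. ennreal ((norm (k x z))\<^sup>2) \<partial>lborel) \<le> (\<integral>\<^sup>+z. ennreal ((norm (\<kappa> (\<rho> x) (x - z)))\<^sup>2) \<partial>lborel)"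
          by (intro nn_integral_mono) (auto simp: k_def split: split_indicator)
        also have "\<dots> = n2 (\<rho> x)"
          unfolding n2_def
          by (subst nn_integral_real_affine[of "\<lambda>y. ennreal ((norm (\<kappa> (\<rho> x) y))\<^sup>2)" "-1" x]) auto
        also have "\<dots> \<le> (\<Sum>r\<in>F. n2 r)" using F \<rho>F by (intro member_le_sum) auto
        also have "\<dots> = ennreal (enn2real (\<Sum>r\<in>F. n2 r))"
          using F L2 by (simp add: n2_def less_top)
        finally show ?thesis .
      qed
      show "(\<lambda>(x, y). c * (poisson (\<rho> x) (x - y) + poisson (\<tau> * \<rho> x) (x - y))) \<in> borel_measurable (lborel \<Otimes>\<^sub>M lborel)"
        by measurable
      show "0 \<le> c * (poisson (\<rho> x) (x - y) + poisson (\<tau> * \<rho> x) (x - y))" for x y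
        using c \<rho>0[of x] \<tau> by simp
      show "norm (LINT z|lborel. k x z * cnj (k x' z)) \<le> c * (poisson (\<rho> x) (x - x') + poisson (\<tau> * \<rho> x) (x - x'))
           + c * (poisson (\<rho> x') (x' - x) + poisson (\<tau> * \<rho> x') (x' - x))" for x x'
      proof -
        have "(LINT z|lborel. k x z * cnj (k x' z)) = (LINT z|lborel. indicator E x * indicator E x' * (\<kappa> (\<rho> x) (x - z) * cnj (\<kappa> (\<rho> x') (x' - z))))"
          by (intro Bochner_Integration.integral_cong) (auto simp: k_def split: split_indicator)
        also have "\<dots> = indicator E x * indicator E x' * (LINT z|lborel. \<kappa> (\<rho> x) (x - z) * cnj (\<kappa> (\<rho> x') (x' - z)))"
          by (rule integral_mult_right_zero)
        also have "norm \<dots> \<le> norm (LINT z|lborel. \<kappa> (\<rho> x) (x - z) * cnj (\<kappa> (\<rho> x') (x' - z)))"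
          by (auto simp: norm_mult split: split_indicator)
        also have "\<dots> \<le> c * (poisson (\<rho> x) (x - x') + poisson (\<tau> * \<rho> x) (x - x'))
           + c * (poisson (\<rho> x') (x - x') + poisson (\<tau> * \<rho> x') (x - x'))"
          by (rule K[OF \<rho>0 \<rho>0])
        finally show ?thesis by (simp add: poisson_commute[of _ x' x])
      qed
      fix u :: "real \<Rightarrow> real"
      assume u: "u \<in> borel_measurable lborel" "\<And>x. 0 \<le> u x"
        "(\<integral>\<^sup>+x. ennreal ((u x)\<^sup>2) \<partial>lborel) < \<infinity>" "\<And>x. x \<notin> E \<Longrightarrow> u x = 0"
      note [measurable] = u(1)
      let ?S = "\<integral>\<^sup>+x. ennreal ((u x)\<^sup>2) \<partial>lborel"
      let ?Q = "\<lambda>\<rho>. \<integral>\<^sup>+x. \<integral>\<^sup>+x'. ennreal (poisson (\<rho> x) (x - x') * u x * u x') \<partial>lborel \<partial>lborel"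
      have "(\<integral>\<^sup>+x. \<integral>\<^sup>+x'. ennreal (c * (poisson (\<rho> x) (x - x') + poisson (\<tau> * \<rho> x) (x - x')) * u x * u x') \<partial>lborel \<partial>lborel)
        = (\<integral>\<^sup>+x. \<integral>\<^sup>+x'. ennreal c * (ennreal (poisson (\<rho> x) (x - x') * u x * u x') + ennreal (poisson (\<tau> * \<rho> x) (x - x') * u x * u x')) \<partial>lborel \<partial>lborel)"
      proof (intro nn_integral_cong)
        fix x x'
        have "0 \<le> \<rho> x" "0 \<le> \<tau> * \<rho> x" using \<rho>0[of x] \<tau> by auto
        then show "ennreal (c * (poisson (\<rho> x) (x - x') + poisson (\<tau> * \<rho> x) (x - x')) * u x * u x')
          = ennreal c * (ennreal (poisson (\<rho> x) (x - x') * u x * u x') + ennreal (poisson (\<tau> * \<rho> x) (x - x') * u x * u x'))"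
          using u(2) c by (simp add: algebra_simps flip: ennreal_mult ennreal_plus)
      qed
      also have "\<dots> = ennreal c * (?Q \<rho> + ?Q (\<lambda>x. \<tau> * \<rho> x))"
        by (simp add: nn_integral_cmult nn_integral_add)
      also have "\<dots> \<le> ennreal c * (ennreal 27 * ?S + ennreal 27 * ?S)"
        using m \<tau> by (intro mult_left_mono add_mono poisson_bilinear[OF _ _ _ E u] poisson_bilinear[OF _ _ _ E u, where m="\<tau> * m"]) auto
      also have "\<dots> = ennreal (54 * c) * ?S"
      proof -
        have "ennreal 27 * ?S + ennreal 27 * ?S = ennreal 54 * ?S"
          by (simp flip: distrib_right ennreal_plus)
        then show ?thesis using c by (simp add: ennreal_mult mult_ac)
      qed
      finally show "(\<integral>\<^sup>+x. \<integral>\<^sup>+x'. ennreal (c * (poisson (\<rho> x) (x - x') + poisson (\<tau> * \<rho> x) (x - x')) * u x * u x') \<partial>lborel \<partial>lborel)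
        \<le> ennreal (54 * c) * ?S" .
    qed (use f f2 in auto)
    also have "2 * ennreal (54 * c) = ennreal (108 * c)"
      using c ennreal_mult[of 2 "54 * c"] by simp
    finally show ?thesis .
  qed
  have [measurable]: "g N \<in> borel_measurable lborel" for N
    unfolding g_def by measurable
  have inc: "incseq g"
  proof (intro incseq_SucI le_funI)
    fix N x
    show "g N x \<le> g (Suc N) x"
      unfolding g_def by (intro mult_mono SUP_subset_mono) (auto split: split_indicator)
  qed
  have sup: "(SUP n. ennreal ((T (rs n) x)\<^sup>2)) = (SUP N. g N x)" for x
  proof (rule antisym)
    show "(SUP n. ennreal ((T (rs n) x)\<^sup>2)) \<le> (SUP N. g N x)"
    proof (rule SUP_least)
      fix n
      define N where "N = max n (nat \<lceil>\<bar>x\<bar>\<rceil>)"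
      have "\<bar>x\<bar> \<le> real N" 
        using real_nat_ceiling_ge[of "\<bar>x\<bar>"] by (simp add: N_def of_nat_max le_max_iff_disj)
      then have "ennreal ((T (rs n) x)\<^sup>2) \<le> g N x"
        unfolding g_def by (auto intro!: SUP_upper simp: N_def abs_le_iff split: split_indicator)
      also have "\<dots> \<le> (SUP N. g N x)" by (rule SUP_upper) simp
      finally show "ennreal ((T (rs n) x)\<^sup>2) \<le> (SUP N. g N x)" .
    qed
    show "(SUP N. g N x) \<le> (SUP n. ennreal ((T (rs n) x)\<^sup>2))"
      unfolding g_def by (intro SUP_least) (auto intro!: SUP_subset_mono split: split_indicator)
  qed
  have "(\<integral>\<^sup>+x. (SUP n. ennreal ((T (rs n) x)\<^sup>2)) \<partial>lborel) = (SUP N. \<integral>\<^sup>+x. g N x \<partial>lborel)"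
    unfolding sup by (rule nn_integral_monotone_convergence_SUP[OF inc]) measurable
  also have "\<dots> \<le> ennreal (108 * c) * (\<integral>\<^sup>+x. ennreal ((norm (f x))\<^sup>2) \<partial>lborel)"
    by (rule SUP_least) (rule fin)
  finally show ?thesis by (simp add: T_def)
qed

section \<open>Oscillatory kernels\<close>

text \<open>Integration by parts: exp(i \<Phi>) \<Phi>' a is the derivative of -i exp(i \<Phi>) a
  plus i exp(i \<Phi>) a'. What this leaves of the amplitude is \<open>b\<close>. \<open>D\<close>
  and \<open>E\<close> are antiderivatives of majorants of |a'| and |b|, so the bound is explicit
  and needs no monotonicity of \<Phi>'.\<close>

lemma oscillatory_integral_bound:
  fixes \<Phi> \<Phi>' a a' D D' E E' b w :: "real \<Rightarrow> real"
  assumes le: "\<alpha> \<le> \<beta>"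
    and \<Phi>: "\<And>y. y \<in> {\<alpha>..\<beta>} \<Longrightarrow> (\<Phi> has_real_derivative \<Phi>' y) (at y)"
    and a: "\<And>y. y \<in> {\<alpha>..\<beta>} \<Longrightarrow> (a has_real_derivative a' y) (at y)"
    and D: "\<And>y. y \<in> {\<alpha>..\<beta>} \<Longrightarrow> (D has_real_derivative D' y) (at y)"
    and E: "\<And>y. y \<in> {\<alpha>..\<beta>} \<Longrightarrow> (E has_real_derivative E' y) (at y)"
    and w: "\<And>y. y \<in> {\<alpha>..\<beta>} \<Longrightarrow> w y = \<Phi>' y * a y + b y"
    and b: "\<And>y. y \<in> {\<alpha>..\<beta>} \<Longrightarrow> \<bar>b y\<bar> \<le> E' y"
    and a': "\<And>y. y \<in> {\<alpha>..\<beta>} \<Longrightarrow> \<bar>a' y\<bar> \<le> D' y"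
    and int: "(\<lambda>y. exp (\<i> * complex_of_real (\<Phi> y)) * complex_of_real (w y)) integrable_on {\<alpha>..\<beta>}"
  shows "norm (integral {\<alpha>..\<beta>} (\<lambda>y. exp (\<i> * complex_of_real (\<Phi> y)) * complex_of_real (w y)))
    \<le> \<bar>a \<alpha>\<bar> + \<bar>a \<beta>\<bar> + (D \<beta> - D \<alpha>) + (E \<beta> - E \<alpha>)"
proof -
  let ?e = "\<lambda>y. exp (\<i> * complex_of_real (\<Phi> y))"
  define G where "G y = - \<i> * ?e y * complex_of_real (a y)" for y
  define G' where "G' y = ?e y * complex_of_real (\<Phi>' y * a y) - \<i> * ?e y * complex_of_real (a' y)" for y
  have G: "(G has_vector_derivative G' y) (at y within {\<alpha>..\<beta>})" if "y \<in> {\<alpha>..\<beta>}" for y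
  proof -
    have 1: "((\<lambda>y. complex_of_real (\<Phi> y)) has_vector_derivative complex_of_real (\<Phi>' y)) (at y)"
      "((\<lambda>y. complex_of_real (a y)) has_vector_derivative complex_of_real (a' y)) (at y)"
      using \<Phi>[OF that] a[OF that] by (auto intro: has_vector_derivative_of_real)
    have "((\<lambda>y. ?e y) has_vector_derivative (\<i> * complex_of_real (\<Phi>' y)) * ?e y) (at y)"
      using field_vector_diff_chain_at[OF has_vector_derivative_mult_right[OF 1(1), of \<i>], of exp "?e y"] DERIV_exp
      by (auto simp: o_def)
    from has_vector_derivative_mult[OF has_vector_derivative_mult_right[OF this, of "- \<i>"] 1(2)]
    have "(G has_vector_derivative G' y) (at y)"
      unfolding G_def G'_def by (rule has_vector_derivative_eq_rhs) (simp add: algebra_simps)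
    then show ?thesis by (rule has_vector_derivative_at_within)
  qed
  have FTC: "(G' has_integral (G \<beta> - G \<alpha>)) {\<alpha>..\<beta>}"
    using le G by (rule fundamental_theorem_of_calculus)
  have DE: "((\<lambda>y. D' y + E' y) has_integral (D \<beta> + E \<beta> - (D \<alpha> + E \<alpha>))) {\<alpha>..\<beta>}"
  proof (rule fundamental_theorem_of_calculus[OF le])
    fix y assume "y \<in> {\<alpha>..\<beta>}"
    then have "((\<lambda>y. D y + E y) has_real_derivative D' y + E' y) (at y)"
      by (intro DERIV_add D E)
    then show "((\<lambda>y. D y + E y) has_vector_derivative D' y + E' y) (at y within {\<alpha>..\<beta>})"
      by (simp add: has_real_derivative_iff_has_vector_derivative has_vector_derivative_at_within)
  qed
  define R where "R y = ?e y * complex_of_real (w y) - G' y" for y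
  have R_int: "R integrable_on {\<alpha>..\<beta>}"
    unfolding R_def using int FTC by (intro integrable_diff) auto
  have R_le: "norm (R y) \<le> D' y + E' y" if "y \<in> {\<alpha>..\<beta>}" for y
  proof -
    have "R y = ?e y * (\<i> * complex_of_real (a' y) + complex_of_real (b y))"
      by (simp add: R_def G'_def w[OF that] algebra_simps)
    also have "norm \<dots> \<le> \<bar>a' y\<bar> + \<bar>b y\<bar>"
      by (simp add: norm_mult) (metis norm_triangle_ineq norm_mult norm_ii norm_of_real mult_1)
    finally show ?thesis using a'[OF that] b[OF that] by linarith
  qed
  have "norm (integral {\<alpha>..\<beta>} R) \<le> integral {\<alpha>..\<beta>} (\<lambda>y. D' y + E' y)"
    using R_int DE R_le by (intro integral_norm_bound_integral) auto
  also have "\<dots> = D \<beta> + E \<beta> - (D \<alpha> + E \<alpha>)" using DE by (rule integral_unique)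
  finally have R: "norm (integral {\<alpha>..\<beta>} R) \<le> (D \<beta> - D \<alpha>) + (E \<beta> - E \<alpha>)" by simp
  have "integral {\<alpha>..\<beta>} (\<lambda>y. ?e y * complex_of_real (w y)) = integral {\<alpha>..\<beta>} R + (G \<beta> - G \<alpha>)"
    using integral_add[OF R_int has_integral_integrable[OF FTC]] integral_unique[OF FTC]
    by (simp add: R_def)
  also have "norm \<dots> \<le> norm (integral {\<alpha>..\<beta>} R) + (norm (G \<beta>) + norm (G \<alpha>))"
    by (intro order_trans[OF norm_triangle_ineq] add_left_mono norm_triangle_ineq4)
  finally show ?thesis using R by (simp add: G_def norm_mult)
qed

section \<open>Correlation of two oscillatory kernels, away from the diagonal and near it\<close>

lemma abs_div_sum_squares_le:
  fixes h \<sigma> :: real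
  assumes "0 < \<sigma>"
  shows "\<bar>h\<bar> / (h\<^sup>2 + \<sigma>\<^sup>2) \<le> 1 / (2 * \<sigma>)"
proof -
  have "0 \<le> (\<bar>h\<bar> - \<sigma>)\<^sup>2" by simp
  then have "\<bar>h\<bar> * (2 * \<sigma>) \<le> h\<^sup>2 + \<sigma>\<^sup>2" by (simp add: power2_eq_square algebra_simps)
  then show ?thesis using assms by (simp add: divide_simps add_nonneg_pos)
qed

text \<open>The ratio 2^(1/|\<epsilon>|) of an annulus is chosen so that the powers \<epsilon> and
  -\<epsilon> stay between 1/2 and 2 along it, whatever the sign of \<epsilon>.\<close>

lemma powr_inverse_abs_bounds:
  fixes t \<epsilon> s :: real
  assumes "\<epsilon> \<noteq> 0" "1 \<le> t" "t \<le> 2 powr (1 / \<bar>\<epsilon>\<bar>)" "\<bar>s\<bar> = \<bar>\<epsilon>\<bar>"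
  shows "1 / 2 \<le> t powr s" "t powr s \<le> 2"
proof -
  have "t powr \<bar>\<epsilon>\<bar> \<le> (2 powr (1 / \<bar>\<epsilon>\<bar>)) powr \<bar>\<epsilon>\<bar>" using assms by (intro powr_mono2) auto
  then have *: "1 \<le> t powr \<bar>s\<bar>" "t powr \<bar>s\<bar> \<le> 2" using assms by (auto simp: powr_powr ge_one_powr_ge_zero)
  have "t powr s = t powr \<bar>s\<bar> \<or> t powr s = 1 / t powr \<bar>s\<bar>" by (auto simp: powr_minus_divide abs_if)
  then show "1 / 2 \<le> t powr s" "t powr s \<le> 2"
    using * by (auto simp: le_divide_eq divide_le_eq)
qed

text \<open>With \<open>g = (y/r)\<^sup>\<epsilon> ((y-d)/r')\<^sup>-\<^sup>\<epsilon> (y-d)/y\<close> and \<open>h = g - 1\<close>, the derivative of the phase is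
  \<open>(N \<epsilon> / (y-d)) ((y-d)/r')\<^sup>\<epsilon> h\<close>. As \<open>g\<close> is monotone, splitting the amplitude by means of
  \<open>1 = h\<^sup>2/(h\<^sup>2+\<sigma>\<^sup>2) + \<sigma>\<^sup>2/(h\<^sup>2+\<sigma>\<^sup>2)\<close> takes care of the stationary point without locating it.\<close>

lemma oscillatory_kernel_off_diagonal:
  fixes \<epsilon> N r r' d \<sigma> \<alpha> \<beta> :: real
  defines "q \<equiv> 2 powr (1 / \<bar>\<epsilon>\<bar>)"
  assumes \<epsilon>: "\<epsilon> \<noteq> 0" "\<epsilon> \<noteq> 1" and N: "N \<noteq> 0" and r: "0 < r" "0 < r'" and d: "d \<noteq> 0" and \<sigma>: "0 < \<sigma>"
    and le: "\<alpha> \<le> \<beta>"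
    and rng: "r \<le> \<alpha>" "\<beta> \<le> q * r" "r' + d \<le> \<alpha>" "\<beta> \<le> q * r' + d"
  shows "norm (integral {\<alpha>..\<beta>} (\<lambda>y. exp (\<i> * complex_of_real (N * ((y / r) powr \<epsilon> - ((y - d) / r') powr \<epsilon>)))
        * complex_of_real (1 / (y * (y - d)))))
    \<le> 11 / (\<bar>N\<bar> * \<bar>\<epsilon>\<bar> * r * \<sigma>) + (q * \<sigma> / (2 * r) + pi * q\<^sup>2 * \<sigma> / (\<bar>\<epsilon> - 1\<bar> * \<bar>d\<bar>))"
proof -
  define p where "p y = ((y - d) / r') powr (- \<epsilon>)" for y
  define g where "g y = (y / r) powr \<epsilon> * p y * ((y - d) / y)" for y
  define h where "h y = g y - 1" for y
  define h' where "h' y = - g y * (\<epsilon> - 1) * d / (y * (y - d))" for y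
  \<comment> \<open>\<open>h'\<close> has the constant sign \<open>s\<close>, as g, y and y - d are
    positive. So \<open>A\<close> below increases, with derivative |h'| \<sigma> / (h^2 +
    \<sigma>^2), and its total growth is at most pi however small \<sigma> is.\<close>
  define s where "s = - sgn ((\<epsilon> - 1) * d)"
  define m where "m y = h y / ((h y)\<^sup>2 + \<sigma>\<^sup>2)" for y
  define m' where "m' y = h' y * (\<sigma>\<^sup>2 - (h y)\<^sup>2) / ((h y)\<^sup>2 + \<sigma>\<^sup>2)\<^sup>2" for y
  define A where "A y = s * arctan (h y / \<sigma>)" for y
  define \<Phi> where "\<Phi> y = N * ((y / r) powr \<epsilon> - ((y - d) / r') powr \<epsilon>)" for y
  define \<Phi>' where "\<Phi>' y = N * \<epsilon> / (y - d) * ((y - d) / r') powr \<epsilon> * h y" for y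
  define c where "c = 1 / (N * \<epsilon>)"
  \<comment> \<open>\<open>m\<close> replaces 1/h and stays below 1/(2 \<sigma>) even at a zero of
    h; \<open>p\<close> cancels the power in \<open>\<Phi>'\<close>. Thus
    \<open>\<Phi>' y * a y\<close> is the amplitude times h^2/(h^2 + \<sigma>^2), and
    \<open>b\<close> is the rest.\<close>
  define a where "a y = c * (1 / y) * p y * m y" for y
  define a' where "a' y = c * (- (1 / y\<^sup>2) * p y * m y + (1 / y) * (- \<epsilon> * p y / (y - d)) * m y + (1 / y) * p y * m' y)" for y
  \<comment> \<open>One summand for each term of the product rule in \<open>a'\<close>: the
    derivatives of 1/y, of \<open>p\<close>, which is monotone with sign -sgn \<epsilon>, and of
    \<open>m\<close>, which is at most \<open>A' y / \<sigma>\<close> in modulus.\<close>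
  define D where "D y = \<bar>c\<bar> * (- (1 / y) / \<sigma> + (- sgn \<epsilon> * p y) / (2 * \<sigma> * r) + 2 * A y / (r * \<sigma>))" for y
  define A' where "A' y = \<bar>h' y\<bar> * \<sigma> / ((h y)\<^sup>2 + \<sigma>\<^sup>2)" for y
  define D' where "D' y = \<bar>c\<bar> * ((1 / y\<^sup>2) / \<sigma> + (\<bar>\<epsilon>\<bar> * p y / (y - d)) / (2 * \<sigma> * r) + 2 * A' y / (r * \<sigma>))" for y
  \<comment> \<open>Chosen so that g <= B |h'|: indeed |h'| = g |\<epsilon> - 1| |d| / (y (y - d)),
    and y (y - d) <= q^2 r r'.\<close>
  define B where "B = q\<^sup>2 * r * r' / (\<bar>\<epsilon> - 1\<bar> * \<bar>d\<bar>)"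
  define E where "E y = 1 / (r * r') * (\<sigma> / 2 * y + B * \<sigma> * A y)" for y
  define E' where "E' y = 1 / (r * r') * (\<sigma> / 2 + B * \<sigma> * A' y)" for y
  define b where "b y = \<sigma>\<^sup>2 / ((y * (y - d)) * ((h y)\<^sup>2 + \<sigma>\<^sup>2))" for y
  have q1: "1 \<le> q" unfolding q_def by (intro ge_one_powr_ge_zero) auto
  have H: "0 < (h y)\<^sup>2 + \<sigma>\<^sup>2" for y using \<sigma> by (simp add: add_nonneg_pos)
  have c0: "c \<noteq> 0" using N \<epsilon> by (simp add: c_def)
  have B0: "0 < B" using q1 r \<epsilon> d by (simp add: B_def)
  have pos: "0 < y" "0 < y - d" "r \<le> y" "y \<le> q * r" "r' \<le> y - d" "y - d \<le> q * r'" if "y \<in> {\<alpha>..\<beta>}" for y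
    using that rng r by auto
  have p_rng: "0 < p y" "p y \<le> 2" if "y \<in> {\<alpha>..\<beta>}" for y
    using powr_inverse_abs_bounds[of \<epsilon> "(y - d) / r'" "- \<epsilon>"] pos[OF that] r \<epsilon>
    by (auto simp: p_def q_def field_simps)
  have g_pos: "0 < g y" if "y \<in> {\<alpha>..\<beta>}" for y
    using pos[OF that] p_rng[OF that] r by (simp add: g_def)
  have dP: "((\<lambda>y. (y / r) powr \<epsilon>) has_real_derivative \<epsilon> * (y / r) powr \<epsilon> / y) (at y)" if "y \<in> {\<alpha>..\<beta>}" for y
    using pos[OF that] r by (auto intro!: derivative_eq_intros simp: powr_diff field_simps)
  have dV: "((\<lambda>y. ((y - d) / r') powr e) has_real_derivative e * ((y - d) / r') powr e / (y - d)) (at y)" if "y \<in> {\<alpha>..\<beta>}" for y e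
    using pos[OF that] r by (auto intro!: derivative_eq_intros simp: powr_diff field_simps)
  have dp: "(p has_real_derivative - \<epsilon> * p y / (y - d)) (at y)" if "y \<in> {\<alpha>..\<beta>}" for y
    unfolding p_def using dV[OF that, of "- \<epsilon>"] by simp
  have dg: "(g has_real_derivative h' y) (at y)" if "y \<in> {\<alpha>..\<beta>}" for y
  proof -
    have "((\<lambda>y. (y - d) / y) has_real_derivative (1 / (y - d) - 1 / y) * ((y - d) / y)) (at y)"
      using pos[OF that] by (auto intro!: derivative_eq_intros simp: field_simps power2_eq_square)
    note 3 = this
    have 1: "((\<lambda>y. (y / r) powr \<epsilon>) has_real_derivative (y / r) powr \<epsilon> * (\<epsilon> / y)) (at y)"
      using dP[OF that] by (simp add: mult_ac)
    have 2: "(p has_real_derivative p y * (- (\<epsilon> / (y - d)))) (at y)"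
      using dp[OF that] by (simp add: mult_ac)
    have alg: "(X * e1 * P + P * (- e2) * X) * V + (e3 * V) * (X * P) = X * P * V * (e1 - e2 + e3)"
      for X P V e1 e2 e3 :: real by (simp add: algebra_simps)
    have "(g has_real_derivative g y * (\<epsilon> / y - \<epsilon> / (y - d) + (1 / (y - d) - 1 / y))) (at y)"
      unfolding g_def by (rule DERIV_cong[OF DERIV_mult[OF DERIV_mult[OF 1 2] 3]]) (rule alg)
    moreover have "g y * (\<epsilon> / y - \<epsilon> / (y - d) + (1 / (y - d) - 1 / y)) = h' y"
    proof -
      have "\<epsilon> / y - \<epsilon> / (y - d) + (1 / (y - d) - 1 / y) = - ((\<epsilon> - 1) * d) / (y * (y - d))"
      proof -
        have k: "1 / (y - d) - 1 / y = d / (y * (y - d))"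
          using pos[OF that] by (simp add: diff_frac_eq mult.commute)
        have "\<epsilon> / y - \<epsilon> / (y - d) = - \<epsilon> * (1 / (y - d) - 1 / y)" by (simp add: algebra_simps)
        then show ?thesis unfolding k by (simp add: algebra_simps diff_divide_distrib)
      qed
      then show ?thesis by (simp add: h'_def)
    qed
    ultimately show ?thesis by simp
  qed
  have dh: "(h has_real_derivative h' y) (at y)" if "y \<in> {\<alpha>..\<beta>}" for y
    unfolding h_def using DERIV_diff[OF dg[OF that] DERIV_const] by simp
  have dm: "(m has_real_derivative m' y) (at y)" if "y \<in> {\<alpha>..\<beta>}" for y
  proof -
    have "((\<lambda>y. h y / ((h y)\<^sup>2 + \<sigma>\<^sup>2)) has_real_derivative
       (h' y * ((h y)\<^sup>2 + \<sigma>\<^sup>2) - h y * (2 * h y * h' y)) / (((h y)\<^sup>2 + \<sigma>\<^sup>2) * ((h y)\<^sup>2 + \<sigma>\<^sup>2))) (at y)"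
      using H[of y] by (auto intro!: derivative_eq_intros dh[OF that])
    then show ?thesis unfolding m_def m'_def
      by (rule DERIV_cong) (simp add: power2_eq_square algebra_simps)
  qed
  have sh': "s * h' y = \<bar>h' y\<bar>" if "y \<in> {\<alpha>..\<beta>}" for y
  proof -
    have "h' y = - ((\<epsilon> - 1) * d) * (g y / (y * (y - d)))" by (simp add: h'_def)
    moreover have "0 < g y / (y * (y - d))" using pos[OF that] g_pos[OF that] by simp
    moreover have "- sgn X * (- X * Y) = \<bar>- X * Y\<bar>" if "0 < Y" for X Y :: real
      using that by (auto simp: abs_mult sgn_if)
    ultimately show ?thesis unfolding s_def by metis
  qed
  have dA: "(A has_real_derivative A' y) (at y)" if "y \<in> {\<alpha>..\<beta>}" for y
  proof -
    have "(A has_real_derivative s * (h' y / \<sigma> / (1 + (h y / \<sigma>)\<^sup>2))) (at y)"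
      unfolding A_def using \<sigma> by (auto intro!: derivative_eq_intros dh[OF that] simp: divide_inverse mult_ac)
    moreover have "s * (h' y / \<sigma> / (1 + (h y / \<sigma>)\<^sup>2)) = (s * h' y) * \<sigma> / ((h y)\<^sup>2 + \<sigma>\<^sup>2)"
    proof -
      have "1 + (h y / \<sigma>)\<^sup>2 = ((h y)\<^sup>2 + \<sigma>\<^sup>2) / \<sigma>\<^sup>2" using \<sigma> by (simp add: field_simps)
      then show ?thesis using \<sigma> by (simp add: power2_eq_square)
    qed
    ultimately show ?thesis using sh'[OF that] by (simp add: A'_def)
  qed
  have A_rng: "A \<beta> - A \<alpha> \<le> pi"
  proof -
    have "\<bar>s\<bar> \<le> 1" by (simp add: s_def sgn_if)
    have "\<bar>A y\<bar> \<le> pi / 2" for y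
    proof -
      have "\<bar>A y\<bar> \<le> 1 * (pi / 2)"
        unfolding A_def abs_mult using \<open>\<bar>s\<bar> \<le> 1\<close> arctan_bounded[of "h y / \<sigma>"]
        by (intro mult_mono) auto
      then show ?thesis by simp
    qed
    from this[of \<alpha>] this[of \<beta>] show ?thesis by linarith
  qed
  have m_le: "\<bar>m y\<bar> \<le> 1 / (2 * \<sigma>)" for y
    using abs_div_sum_squares_le[OF \<sigma>, of "h y"] by (simp add: m_def)
  have m'_le: "\<bar>m' y\<bar> \<le> A' y / \<sigma>" for y
  proof -
    have "\<bar>\<sigma>\<^sup>2 - (h y)\<^sup>2\<bar> \<le> (h y)\<^sup>2 + \<sigma>\<^sup>2" by (simp add: abs_le_iff)
    then have "\<bar>h' y\<bar> * \<bar>\<sigma>\<^sup>2 - (h y)\<^sup>2\<bar> / ((h y)\<^sup>2 + \<sigma>\<^sup>2)\<^sup>2 \<le> \<bar>h' y\<bar> * ((h y)\<^sup>2 + \<sigma>\<^sup>2) / ((h y)\<^sup>2 + \<sigma>\<^sup>2)\<^sup>2"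
      by (intro divide_right_mono mult_left_mono) auto
    also have "\<dots> = \<bar>h' y\<bar> / ((h y)\<^sup>2 + \<sigma>\<^sup>2)" using H[of y] by (simp add: power2_eq_square)
    finally show ?thesis using \<sigma> H[of y] by (simp add: m'_def A'_def abs_mult)
  qed
  have A'0: "0 \<le> A' y" for y using H[of y] \<sigma> by (simp add: A'_def)
  have "norm (integral {\<alpha>..\<beta>} (\<lambda>y. exp (\<i> * complex_of_real (\<Phi> y)) * complex_of_real (1 / (y * (y - d)))))
    \<le> \<bar>a \<alpha>\<bar> + \<bar>a \<beta>\<bar> + (D \<beta> - D \<alpha>) + (E \<beta> - E \<alpha>)"
  proof (rule oscillatory_integral_bound[OF le, where \<Phi>'=\<Phi>' and a'=a' and D'=D' and E'=E' and b=b])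
    fix y assume y: "y \<in> {\<alpha>..\<beta>}"
    note P = pos[OF y]
    show "(\<Phi> has_real_derivative \<Phi>' y) (at y)"
    proof -
      have "(\<Phi> has_real_derivative N * (\<epsilon> * (y / r) powr \<epsilon> / y - \<epsilon> * ((y - d) / r') powr \<epsilon> / (y - d))) (at y)"
        unfolding \<Phi>_def by (intro DERIV_cmult DERIV_diff dP dV y)
      moreover have "\<Phi>' y = N * (\<epsilon> * (y / r) powr \<epsilon> / y - \<epsilon> * ((y - d) / r') powr \<epsilon> / (y - d))"
        using P r by (simp add: \<Phi>'_def h_def g_def p_def powr_minus field_simps)
      ultimately show ?thesis by simp
    qed
    show "(a has_real_derivative a' y) (at y)"
    proof -
      have "((\<lambda>y. 1 / y) has_real_derivative - (1 / y\<^sup>2)) (at y)"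
        using P by (auto intro!: derivative_eq_intros simp: power2_eq_square)
      from DERIV_cmult[OF DERIV_mult[OF DERIV_mult[OF this dp[OF y]] dm[OF y]], of c]
      show ?thesis unfolding a_def a'_def mult.assoc
        by (rule DERIV_cong) (simp add: algebra_simps)
    qed
    show "(D has_real_derivative D' y) (at y)"
    proof -
      have 1: "((\<lambda>y. - (1 / y) / \<sigma>) has_real_derivative (1 / y\<^sup>2) / \<sigma>) (at y)"
        using P \<sigma> by (auto intro!: derivative_eq_intros simp: power2_eq_square)
      have 2: "((\<lambda>y. (- sgn \<epsilon> * p y) / (2 * \<sigma> * r)) has_real_derivative (- sgn \<epsilon> * (- \<epsilon> * p y / (y - d))) / (2 * \<sigma> * r)) (at y)"
        by (intro DERIV_cdivide DERIV_cmult dp y)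
      have eq: "- sgn \<epsilon> * (- \<epsilon> * p y / (y - d)) = \<bar>\<epsilon>\<bar> * p y / (y - d)" by (simp add: abs_sgn[of \<epsilon>] mult_ac)
      note 2 = 2[unfolded eq]
      show ?thesis unfolding D_def D'_def
        by (intro DERIV_cmult DERIV_add DERIV_cdivide 1 2 dA y)
    qed
    show "(E has_real_derivative E' y) (at y)"
      unfolding E_def E'_def using DERIV_cmult[OF DERIV_ident, of "\<sigma> / 2" y]
      by (intro DERIV_cmult DERIV_add dA y) simp
    show "1 / (y * (y - d)) = \<Phi>' y * a y + b y"
    proof -
      have "((y - d) / r') powr \<epsilon> * p y = 1" using P r by (simp add: p_def powr_minus)
      then have "\<Phi>' y * a y = (N * \<epsilon> * c) * (1 / (y * (y - d))) * (h y * m y)"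
        by (simp add: \<Phi>'_def a_def field_simps)
      also have "\<dots> = 1 / (y * (y - d)) * ((h y)\<^sup>2 / ((h y)\<^sup>2 + \<sigma>\<^sup>2))"
        using N \<epsilon> by (simp add: c_def m_def power2_eq_square)
      finally have eq: "\<Phi>' y * a y = 1 / (y * (y - d)) * ((h y)\<^sup>2 / ((h y)\<^sup>2 + \<sigma>\<^sup>2))" .
      have "\<Phi>' y * a y + b y = 1 / (y * (y - d)) * (((h y)\<^sup>2 + \<sigma>\<^sup>2) / ((h y)\<^sup>2 + \<sigma>\<^sup>2))"
        by (simp only: eq b_def add_divide_distrib distrib_left times_divide_times_eq mult_1)
      then show ?thesis using H[of y] \<sigma> by simp
    qed
    show "\<bar>b y\<bar> \<le> E' y"
    proof -
      have yv: "r * r' \<le> y * (y - d)" "y * (y - d) \<le> q\<^sup>2 * r * r'"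
        using mult_mono[of r y r' "y - d"] mult_mono[of y "q * r" "y - d" "q * r'"] P r q1
        by (auto simp: power2_eq_square mult_ac)
      \<comment> \<open>From 1 = g - h. The part with |h| costs at most \<sigma>/2 pointwise, while
        g is traded for B |h'|, whose integral the arctangent in \<open>A\<close> controls.\<close>
      have "1 \<le> g y + \<bar>h y\<bar>" by (simp add: h_def)
      then have "\<sigma>\<^sup>2 / ((h y)\<^sup>2 + \<sigma>\<^sup>2) \<le> \<sigma>\<^sup>2 * (g y + \<bar>h y\<bar>) / ((h y)\<^sup>2 + \<sigma>\<^sup>2)"
        using H[of y] mult_left_mono[of 1 "g y + \<bar>h y\<bar>" "\<sigma>\<^sup>2"] by (intro divide_right_mono) auto
      also have "\<dots> = g y * (\<sigma>\<^sup>2 / ((h y)\<^sup>2 + \<sigma>\<^sup>2)) + \<sigma>\<^sup>2 * (\<bar>h y\<bar> / ((h y)\<^sup>2 + \<sigma>\<^sup>2))"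
        by (simp add: field_simps add_divide_distrib)
      also have "\<dots> \<le> (B * \<bar>h' y\<bar>) * (\<sigma>\<^sup>2 / ((h y)\<^sup>2 + \<sigma>\<^sup>2)) + \<sigma>\<^sup>2 * (1 / (2 * \<sigma>))"
      proof (intro add_mono mult_left_mono mult_right_mono abs_div_sum_squares_le \<sigma>)
        have "\<bar>h' y\<bar> = g y * (\<bar>\<epsilon> - 1\<bar> * \<bar>d\<bar>) / (y * (y - d))"
          using P g_pos[OF y] by (simp add: h'_def abs_mult)
        then have "B * \<bar>h' y\<bar> = g y * (q\<^sup>2 * r * r' / (y * (y - d)))"
          using \<epsilon> d by (simp add: B_def)
        moreover have "1 \<le> q\<^sup>2 * r * r' / (y * (y - d))" using yv P by simp
        ultimately have "g y * 1 \<le> B * \<bar>h' y\<bar>" using g_pos[OF y] by (simp only:) (intro mult_left_mono, auto)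
        then show "g y \<le> B * \<bar>h' y\<bar>" by simp
      qed (use H[of y] in auto)
      also have "\<dots> = \<sigma> / 2 + B * \<sigma> * A' y"
        using \<sigma> by (simp add: A'_def power2_eq_square)
      finally have 1: "\<sigma>\<^sup>2 / ((h y)\<^sup>2 + \<sigma>\<^sup>2) \<le> \<sigma> / 2 + B * \<sigma> * A' y" .
      have "\<bar>b y\<bar> = 1 / (y * (y - d)) * (\<sigma>\<^sup>2 / ((h y)\<^sup>2 + \<sigma>\<^sup>2))"
        using P H[of y] by (simp add: b_def abs_mult)
      also have "\<dots> \<le> 1 / (r * r') * (\<sigma> / 2 + B * \<sigma> * A' y)"
        using 1 yv r P H[of y] by (intro mult_mono divide_left_mono) auto
      finally show ?thesis by (simp add: E'_def)
    qed
    show "\<bar>a' y\<bar> \<le> D' y"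
    proof -
      have iy: "1 / y \<le> 1 / r" using P r by (intro divide_left_mono) auto
      have "\<bar>- (1 / y\<^sup>2) * p y * m y\<bar> \<le> (1 / y\<^sup>2) * 2 * (1 / (2 * \<sigma>))"
        unfolding abs_mult using m_le[of y] p_rng[OF y] \<sigma> by (intro mult_mono) auto
      moreover have "\<bar>(1 / y) * (- \<epsilon> * p y / (y - d)) * m y\<bar> \<le> (1 / r) * (\<bar>\<epsilon>\<bar> * p y / (y - d)) * (1 / (2 * \<sigma>))"
        unfolding abs_mult using m_le[of y] p_rng[OF y] P iy r by (intro mult_mono) (auto simp: abs_mult)
      moreover have "\<bar>(1 / y) * p y * m' y\<bar> \<le> (1 / r) * 2 * (A' y / \<sigma>)"
        unfolding abs_mult using m'_le[of y] p_rng[OF y] P iy r by (intro mult_mono) auto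
      ultimately have "\<bar>- (1 / y\<^sup>2) * p y * m y + (1 / y) * (- \<epsilon> * p y / (y - d)) * m y + (1 / y) * p y * m' y\<bar>
        \<le> (1 / y\<^sup>2) * 2 * (1 / (2 * \<sigma>)) + (1 / r) * (\<bar>\<epsilon>\<bar> * p y / (y - d)) * (1 / (2 * \<sigma>)) + (1 / r) * 2 * (A' y / \<sigma>)"
        by linarith
      also have "\<dots> = (1 / y\<^sup>2) / \<sigma> + (\<bar>\<epsilon>\<bar> * p y / (y - d)) / (2 * \<sigma> * r) + 2 * A' y / (r * \<sigma>)"
        by (simp add: mult_ac)
      finally show ?thesis unfolding a'_def D'_def abs_mult by (intro mult_left_mono) auto
    qed
  next
    have "continuous_on {\<alpha>..\<beta>} \<Phi>"
    proof -
      have "y / r \<noteq> 0" "(y - d) / r' \<noteq> 0" if "y \<in> {\<alpha>..\<beta>}" for y using pos[OF that] r by auto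
      then show ?thesis unfolding \<Phi>_def using r by (intro continuous_intros) (blast | simp)+
    qed
    moreover have "y * (y - d) \<noteq> 0" if "y \<in> {\<alpha>..\<beta>}" for y using pos[OF that] by auto
    ultimately show "(\<lambda>y. exp (\<i> * complex_of_real (\<Phi> y)) * complex_of_real (1 / (y * (y - d)))) integrable_on {\<alpha>..\<beta>}"
      by (intro integrable_continuous_interval continuous_intros) (blast | assumption)+
  qed
  also have "\<dots> \<le> (\<bar>c\<bar> / (r * \<sigma>) + \<bar>c\<bar> / (r * \<sigma>) + \<bar>c\<bar> * (2 + 2 * pi) / (r * \<sigma>)) + (q * \<sigma> / (2 * r) + pi * q\<^sup>2 * \<sigma> / (\<bar>\<epsilon> - 1\<bar> * \<bar>d\<bar>))"
  proof -
    have ep: "\<alpha> \<in> {\<alpha>..\<beta>}" "\<beta> \<in> {\<alpha>..\<beta>}" using le by auto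
    have a_le: "\<bar>a y\<bar> \<le> \<bar>c\<bar> / (r * \<sigma>)" if "y \<in> {\<alpha>..\<beta>}" for y
    proof -
      have "1 / y \<le> 1 / r" using pos[OF that] r by (intro divide_left_mono) auto
      then have "\<bar>a y\<bar> \<le> \<bar>c\<bar> * (1 / r) * 2 * (1 / (2 * \<sigma>))"
        unfolding a_def abs_mult using m_le[of y] p_rng[OF that] pos[OF that] r by (intro mult_mono) auto
      then show ?thesis by simp
    qed
    have D_le: "D \<beta> - D \<alpha> \<le> \<bar>c\<bar> * (2 + 2 * pi) / (r * \<sigma>)"
    proof -
      have "1 / \<alpha> \<le> 1 / r" "0 \<le> 1 / \<beta>" using pos[OF ep(1)] pos[OF ep(2)] r by (auto intro: divide_left_mono)
      then have "(1 / \<alpha> - 1 / \<beta>) / \<sigma> \<le> (1 / r) / \<sigma>" using \<sigma> by (intro divide_right_mono) linarith+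
      then have 1: "- (1 / \<beta>) / \<sigma> - (- (1 / \<alpha>) / \<sigma>) \<le> (1 / r) / \<sigma>"
        by (simp add: diff_divide_distrib)
      have "- sgn \<epsilon> * p \<beta> - - sgn \<epsilon> * p \<alpha> \<le> 2"
        using p_rng[OF ep(1)] p_rng[OF ep(2)] by (auto simp: sgn_if)
      then have 2: "(- sgn \<epsilon> * p \<beta>) / (2 * \<sigma> * r) - (- sgn \<epsilon> * p \<alpha>) / (2 * \<sigma> * r) \<le> 2 / (2 * \<sigma> * r)"
        unfolding diff_divide_distrib[symmetric] using \<sigma> r by (intro divide_right_mono) auto
      have 3: "2 * A \<beta> / (r * \<sigma>) - 2 * A \<alpha> / (r * \<sigma>) \<le> 2 * pi / (r * \<sigma>)"
        unfolding diff_divide_distrib[symmetric] using A_rng \<sigma> r by (intro divide_right_mono) auto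
      have "D \<beta> - D \<alpha> = \<bar>c\<bar> * ((- (1 / \<beta>) / \<sigma> - (- (1 / \<alpha>) / \<sigma>)) + ((- sgn \<epsilon> * p \<beta>) / (2 * \<sigma> * r) - (- sgn \<epsilon> * p \<alpha>) / (2 * \<sigma> * r))
          + (2 * A \<beta> / (r * \<sigma>) - 2 * A \<alpha> / (r * \<sigma>)))"
        unfolding D_def by (simp add: algebra_simps)
      also have "\<dots> \<le> \<bar>c\<bar> * ((1 / r) / \<sigma> + 2 / (2 * \<sigma> * r) + 2 * pi / (r * \<sigma>))"
        by (intro mult_left_mono add_mono 1 2 3) auto
      also have "\<dots> = \<bar>c\<bar> * (2 + 2 * pi) / (r * \<sigma>)"
        using r \<sigma> by (simp add: field_simps)
      finally show ?thesis .
    qed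
    have E_le: "E \<beta> - E \<alpha> \<le> q * \<sigma> / (2 * r) + pi * q\<^sup>2 * \<sigma> / (\<bar>\<epsilon> - 1\<bar> * \<bar>d\<bar>)"
    proof -
      \<comment> \<open>The length is compared with r' rather than r, so that r' cancels against the
        factor 1/(r r') in \<open>E\<close>.\<close>
      have "\<beta> - \<alpha> \<le> q * r'" using rng r by auto
      then have "\<sigma> / 2 * (\<beta> - \<alpha>) + B * \<sigma> * (A \<beta> - A \<alpha>) \<le> \<sigma> / 2 * (q * r') + B * \<sigma> * pi"
        using A_rng \<sigma> B0 by (intro add_mono mult_left_mono) auto
      then have "1 / (r * r') * (\<sigma> / 2 * (\<beta> - \<alpha>) + B * \<sigma> * (A \<beta> - A \<alpha>)) \<le> 1 / (r * r') * (\<sigma> / 2 * (q * r') + B * \<sigma> * pi)"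
        using r by (intro mult_left_mono) auto
      also have "\<dots> = q * \<sigma> / (2 * r) + pi * q\<^sup>2 * \<sigma> / (\<bar>\<epsilon> - 1\<bar> * \<bar>d\<bar>)"
        using r d \<epsilon> by (simp add: B_def field_simps)
      also have "1 / (r * r') * (\<sigma> / 2 * (\<beta> - \<alpha>) + B * \<sigma> * (A \<beta> - A \<alpha>)) = E \<beta> - E \<alpha>"
        by (simp add: E_def algebra_simps diff_divide_distrib)
      finally show ?thesis .
    qed
    show ?thesis using a_le[OF ep(1)] a_le[OF ep(2)] D_le E_le by linarith
  qed
  \<comment> \<open>The two endpoint terms and the growth of \<open>D\<close> add up to 4 + 2 pi,
    about 10.3, times |c|/(r \<sigma>).\<close>
  also have "\<bar>c\<bar> / (r * \<sigma>) + \<bar>c\<bar> / (r * \<sigma>) + \<bar>c\<bar> * (2 + 2 * pi) / (r * \<sigma>) \<le> 11 / (\<bar>N\<bar> * \<bar>\<epsilon>\<bar> * r * \<sigma>)"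
  proof -
    have "\<bar>c\<bar> / (r * \<sigma>) + \<bar>c\<bar> / (r * \<sigma>) + \<bar>c\<bar> * (2 + 2 * pi) / (r * \<sigma>) = (4 + 2 * pi) * (\<bar>c\<bar> / (r * \<sigma>))"
    proof -
      have "X + X + (2 + 2 * pi) * X = (4 + 2 * pi) * X" for X :: real by (simp add: algebra_simps)
      from this[of "\<bar>c\<bar> / (r * \<sigma>)"] show ?thesis by (simp add: mult.commute)
    qed
    also have "\<dots> \<le> 11 * (\<bar>c\<bar> / (r * \<sigma>))"
      using pi_approx r \<sigma> by (intro mult_right_mono) auto
    also have "\<dots> = 11 / (\<bar>N\<bar> * \<bar>\<epsilon>\<bar> * r * \<sigma>)" by (simp add: c_def abs_mult)
    finally show ?thesis .
  qed
  finally show ?thesis by (simp add: \<Phi>_def)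
qed

text \<open>The support starts at \<open>r\<close>, where the phase is \<open>N\<close>; along it \<open>(y/r)\<^sup>\<epsilon>\<close> runs from 1 to 2 or to 1/2.\<close>

definition osc_kernel :: "real \<Rightarrow> real \<Rightarrow> real \<Rightarrow> real \<Rightarrow> complex" where
  "osc_kernel \<epsilon> N r y = (if r < y \<and> y \<le> 2 powr (1 / \<bar>\<epsilon>\<bar>) * r
     then exp (\<i> * complex_of_real (N * (y / r) powr \<epsilon>)) / complex_of_real y else 0)"

lemma osc_kernel_measurable [measurable (raw)]:
  assumes [measurable]: "f \<in> borel_measurable M" "g \<in> borel_measurable M"
  shows "(\<lambda>x. osc_kernel \<epsilon> N (f x) (g x)) \<in> borel_measurable M"
proof -
  have "(\<lambda>x. if f x < g x \<and> g x \<le> q * f x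
      then exp (\<i> * complex_of_real (N * (g x / f x) powr \<epsilon>)) / complex_of_real (g x) else 0) \<in> borel_measurable M"
    for q :: real by measurable
  then show ?thesis unfolding osc_kernel_def .
qed

text \<open>If |d| < \<tau> r, absolute values give q/r, and the factor \<tau> appears because the
  Poisson kernel of scale \<tau> r is at least 1/(2 \<tau> r) at d. Otherwise
  \<open>oscillatory_kernel_off_diagonal\<close> with \<sigma> = \<tau>^2 gives a multiple of
  \<tau>/r, and 1/r is at most 2 q^2 times P_r(d), since overlapping supports force |d| <= q r. Here
  r is the larger of the two scales.\<close>

lemma osc_kernel_correlation:
  fixes \<epsilon> N r r' d \<tau> \<delta> :: real
  defines "Q \<equiv> 2 powr (1 / \<delta>)"
  assumes \<delta>: "0 < \<delta>" "\<delta> < 1" and \<epsilon>: "\<delta> < \<bar>\<epsilon>\<bar>" "\<delta> < \<bar>\<epsilon> - 1\<bar>" and r: "0 < r'" "r' \<le> r"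
    and \<tau>: "0 < \<tau>" "\<tau> \<le> 1" "\<tau> ^ 4 * \<bar>N\<bar> = 1"
  shows "norm (LINT y|lborel. osc_kernel \<epsilon> N r y * cnj (osc_kernel \<epsilon> N r' (y - d)))
    \<le> 32 * Q ^ 4 / \<delta> * \<tau> * (poisson r d + poisson (\<tau> * r) d)"
proof -
  define q where "q = 2 powr (1 / \<bar>\<epsilon>\<bar>)"
  define \<alpha> where "\<alpha> = max r (r' + d)"
  define \<beta> where "\<beta> = min (q * r) (q * r' + d)"
  define F where "F y = exp (\<i> * complex_of_real (N * ((y / r) powr \<epsilon> - ((y - d) / r') powr \<epsilon>)))
        * complex_of_real (1 / (y * (y - d)))" for y
  have q: "1 \<le> q" "q \<le> Q"
    using \<delta> \<epsilon> by (auto simp: q_def Q_def ge_one_powr_ge_zero frac_le)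
  have r0: "0 < r" using r by simp
  have qQ: "q ^ 4 \<le> Q ^ 4" using q by (intro power_mono) auto
  have C: "32 * q ^ 4 / \<delta> * \<tau> \<le> 32 * Q ^ 4 / \<delta> * \<tau>"
    using qQ \<delta> \<tau> by (intro mult_right_mono divide_right_mono) auto
  have eq: "osc_kernel \<epsilon> N r y * cnj (osc_kernel \<epsilon> N r' (y - d)) = indicator {\<alpha><..\<beta>} y *\<^sub>R F y" for y
  proof (cases "y \<in> {\<alpha><..\<beta>}")
    case True
    then have "r < y" "y \<le> q * r" "r' < y - d" "y - d \<le> q * r'" by (auto simp: \<alpha>_def \<beta>_def)
    moreover have "exp (\<i> * complex_of_real (N * (y / r) powr \<epsilon>)) * cnj (exp (\<i> * complex_of_real (N * ((y - d) / r') powr \<epsilon>)))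
      = exp (\<i> * complex_of_real (N * ((y / r) powr \<epsilon> - ((y - d) / r') powr \<epsilon>)))"
      by (simp add: exp_cnj flip: exp_add) (simp add: algebra_simps)
    ultimately show ?thesis using True
      by (simp add: osc_kernel_def F_def q_def)
  next
    case False
    then have "\<not> (r < y \<and> y \<le> q * r) \<or> \<not> (r' < y - d \<and> y - d \<le> q * r')" by (auto simp: \<alpha>_def \<beta>_def)
    with False show ?thesis by (auto simp: osc_kernel_def q_def)
  qed
  have pp: "0 \<le> poisson r d" "0 \<le> poisson (\<tau> * r) d" using r0 \<tau> by auto
  have Q0: "0 \<le> 32 * Q ^ 4 / \<delta> * \<tau>" using \<delta> \<tau> q by (intro mult_nonneg_nonneg divide_nonneg_pos) auto
  show ?thesis
  proof (cases "\<alpha> < \<beta>")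
    case False
    then have "(LINT y|lborel. osc_kernel \<epsilon> N r y * cnj (osc_kernel \<epsilon> N r' (y - d))) = 0"
      unfolding eq by simp
    then show ?thesis using mult_nonneg_nonneg[OF Q0 add_nonneg_nonneg[OF pp]] by (simp only: norm_zero)
  next
    case True
    have rng: "r \<le> \<alpha>" "\<beta> \<le> q * r" "r' + d \<le> \<alpha>" "\<beta> \<le> q * r' + d" by (auto simp: \<alpha>_def \<beta>_def)
    have pos: "r \<le> y" "r' \<le> y - d" if "y \<in> {\<alpha>..\<beta>}" for y using that rng by auto
    have cont: "continuous_on {\<alpha>..\<beta>} F"
    proof -
      have "y / r \<noteq> 0" "(y - d) / r' \<noteq> 0" "y * (y - d) \<noteq> 0" if "y \<in> {\<alpha>..\<beta>}" for y
        using pos[OF that] r r0 by auto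
      then show ?thesis unfolding F_def using r r0 by (intro continuous_intros) (blast | simp)+
    qed
    have "(LINT y|lborel. osc_kernel \<epsilon> N r y * cnj (osc_kernel \<epsilon> N r' (y - d))) = (LINT y:{\<alpha>..\<beta>}|lborel. F y)"
      unfolding eq set_lebesgue_integral_def
    proof (rule integral_cong_AE)
      show 1: "(\<lambda>y. indicator {\<alpha>..\<beta>} y *\<^sub>R F y) \<in> borel_measurable lborel"
        using borel_integrable_atLeastAtMost'[OF cont] by (auto simp: set_integrable_def)
      have "(\<lambda>y. indicator {\<alpha><..} y *\<^sub>R (indicator {\<alpha>..\<beta>} y *\<^sub>R F y)) \<in> borel_measurable lborel"
        by (rule borel_measurable_scaleR[OF _ 1]) simp
      moreover have "(\<lambda>y. indicator {\<alpha><..\<beta>} y *\<^sub>R F y) = (\<lambda>y. indicator {\<alpha><..} y *\<^sub>R (indicator {\<alpha>..\<beta>} y *\<^sub>R F y))"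
        by (auto split: split_indicator)
      ultimately show "(\<lambda>y. indicator {\<alpha><..\<beta>} y *\<^sub>R F y) \<in> borel_measurable lborel"
        by (simp only:)
      show "AE y in lborel. indicator {\<alpha><..\<beta>} y *\<^sub>R F y = indicator {\<alpha>..\<beta>} y *\<^sub>R F y"
        using AE_lborel_singleton[of \<alpha>] by eventually_elim (auto split: split_indicator)
    qed
    also have "\<dots> = integral {\<alpha>..\<beta>} F"
      by (rule set_borel_integral_eq_integral) (rule borel_integrable_atLeastAtMost'[OF cont])
    finally have K: "(LINT y|lborel. osc_kernel \<epsilon> N r y * cnj (osc_kernel \<epsilon> N r' (y - d))) = integral {\<alpha>..\<beta>} F" .
    \<comment> \<open>As the interval is nonempty, each support begins before the other ends; r' <=
      r turns both inequalities into a bound by q r.\<close>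
    have d: "\<bar>d\<bar> \<le> q * r"
    proof -
      have "q * r' \<le> q * r" using r q by (intro mult_left_mono) auto
      moreover have "r' + d < q * r" "r < q * r' + d" using True rng by auto
      ultimately show ?thesis using r r0 by auto
    qed
    show ?thesis
    proof (cases "\<bar>d\<bar> < \<tau> * r")
      case near: True
      have "norm (integral {\<alpha>..\<beta>} F) \<le> 1 / (r * r') * (\<beta> - \<alpha>)"
      proof (rule integral_bound[OF _ cont])
        fix y assume y: "y \<in> {\<alpha>..\<beta>}"
        have "r * r' \<le> y * (y - d)" using pos[OF y] r r0 by (intro mult_mono) auto
        moreover have "0 < y * (y - d)" using pos[OF y] r r0 by auto
        moreover have "norm (F y) = \<bar>1 / (y * (y - d))\<bar>"
          by (simp only: F_def norm_mult norm_exp_i_times norm_of_real mult_1)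
        ultimately show "norm (F y) \<le> 1 / (r * r')"
          using r r0 by (simp only: abs_of_pos zero_less_divide_1_iff) (intro divide_left_mono, auto)
      qed (use True in auto)
      also have "\<dots> \<le> 1 / (r * r') * (q * r')"
        using rng r r0 by (intro mult_left_mono) auto
      also have "\<dots> = 2 * \<tau> * q * (1 / (2 * \<tau> * r))" using r r0 \<tau> by simp
      also have "\<dots> \<le> 2 * \<tau> * q * poisson (\<tau> * r) d"
      proof (intro mult_left_mono)
        have "d\<^sup>2 \<le> (\<tau> * r)\<^sup>2" using near by (intro abs_le_square_iff[THEN iffD1]) auto
        then have "\<tau> * r / (2 * (\<tau> * r)\<^sup>2) \<le> \<tau> * r / ((\<tau> * r)\<^sup>2 + d\<^sup>2)"
          using r0 \<tau> by (intro divide_left_mono) (auto simp: add_pos_nonneg)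
        then show "1 / (2 * \<tau> * r) \<le> poisson (\<tau> * r) d"
          using r0 \<tau> by (simp add: poisson_def power2_eq_square)
      qed (use q \<tau> in auto)
      also have "\<dots> \<le> 32 * q ^ 4 / \<delta> * \<tau> * poisson (\<tau> * r) d"
      proof (rule mult_right_mono)
        have "q * 1 \<le> q ^ 4 * (1 / \<delta>)"
          using q \<delta> self_le_power[of q 4] by (intro mult_mono) auto
        then have "2 * q \<le> 32 * q ^ 4 / \<delta>" using q by simp
        then have "2 * q * \<tau> \<le> 32 * q ^ 4 / \<delta> * \<tau>" using \<tau> by (intro mult_right_mono) auto
        then show "2 * \<tau> * q \<le> 32 * q ^ 4 / \<delta> * \<tau>" by (simp only: mult.assoc mult.commute[of q])
      qed (use pp in auto)
      also have "\<dots> \<le> 32 * Q ^ 4 / \<delta> * \<tau> * (poisson r d + poisson (\<tau> * r) d)"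
        by (rule mult_mono[OF C]) (use pp Q0 in auto)
      finally show ?thesis unfolding K .
    next
      case far: False
      have d0: "d \<noteq> 0" using far r0 \<tau> by auto
      have N0: "N \<noteq> 0" using \<tau> by auto
      have t0: "norm (integral {\<alpha>..\<beta>} F) \<le> 11 / (\<bar>N\<bar> * \<bar>\<epsilon>\<bar> * r * \<tau>\<^sup>2) + (q * \<tau>\<^sup>2 / (2 * r) + pi * q\<^sup>2 * \<tau>\<^sup>2 / (\<bar>\<epsilon> - 1\<bar> * \<bar>d\<bar>))"
        unfolding F_def q_def
        using oscillatory_kernel_off_diagonal[of \<epsilon> N r r' d "\<tau>\<^sup>2" \<alpha> \<beta>] \<epsilon> \<delta> N0 r r0 d0 \<tau> True rng
        by (auto simp: q_def)
      \<comment> \<open>Two of the three terms are even of order \<tau>^2; the third, where |d| may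
        be as small as \<tau> r, is only of order \<tau> and fixes the rate.\<close>
      have \<tau>r: "\<tau> * \<tau> / r \<le> \<tau> * 1 / r"
        using \<tau> r0 by (intro divide_right_mono mult_left_mono) auto
      have t1: "11 / (\<bar>N\<bar> * \<bar>\<epsilon>\<bar> * r * \<tau>\<^sup>2) \<le> 11 * q\<^sup>2 / \<delta> * (\<tau> / r)"
      proof -
        have inv: "1 / (\<bar>N\<bar> * \<tau>\<^sup>2) = \<tau>\<^sup>2"
          using \<tau> N0 by (simp add: field_simps power2_eq_square power4_eq_xxxx)
        have "11 / (\<bar>N\<bar> * \<bar>\<epsilon>\<bar> * r * \<tau>\<^sup>2) = 11 * (1 / (\<bar>N\<bar> * \<tau>\<^sup>2)) / (\<bar>\<epsilon>\<bar> * r)"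
          by (simp add: mult_ac)
        also have "\<dots> = 11 * \<tau>\<^sup>2 / (\<bar>\<epsilon>\<bar> * r)" unfolding inv ..
        also have "\<dots> = (11 / \<bar>\<epsilon>\<bar>) * (\<tau> * \<tau> / r)" by (simp add: power2_eq_square)
        also have "\<dots> \<le> (11 * q\<^sup>2 / \<delta>) * (\<tau> * 1 / r)"
        proof (rule mult_mono[OF _ \<tau>r])
          show "11 / \<bar>\<epsilon>\<bar> \<le> 11 * q\<^sup>2 / \<delta>"
            by (rule frac_le) (use \<epsilon> \<delta> one_le_power[OF q(1), of 2] in auto)
        qed (use \<delta> \<tau> r0 in auto)
        finally show ?thesis by simp
      qed
      have t2: "q * \<tau>\<^sup>2 / (2 * r) \<le> q\<^sup>2 / (2 * \<delta>) * (\<tau> / r)"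
      proof -
        have "q * \<tau>\<^sup>2 / (2 * r) = (q / 2) * (\<tau> * \<tau> / r)" by (simp add: power2_eq_square)
        also have "\<dots> \<le> (q\<^sup>2 / (2 * \<delta>)) * (\<tau> * 1 / r)"
        proof (rule mult_mono[OF _ \<tau>r])
          show "q / 2 \<le> q\<^sup>2 / (2 * \<delta>)"
            by (rule frac_le) (use \<delta> self_le_power[OF q(1), of 2] in auto)
        qed (use \<delta> \<tau> r0 in auto)
        finally show ?thesis by simp
      qed
      have t3: "pi * q\<^sup>2 * \<tau>\<^sup>2 / (\<bar>\<epsilon> - 1\<bar> * \<bar>d\<bar>) \<le> 4 * q\<^sup>2 / \<delta> * (\<tau> / r)"
      proof -
        have "pi * q\<^sup>2 * \<tau>\<^sup>2 / (\<bar>\<epsilon> - 1\<bar> * \<bar>d\<bar>) \<le> 4 * q\<^sup>2 * \<tau>\<^sup>2 / (\<delta> * (\<tau> * r))"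
        proof (rule frac_le)
          show "pi * q\<^sup>2 * \<tau>\<^sup>2 \<le> 4 * q\<^sup>2 * \<tau>\<^sup>2"
            using pi_less_4 by (intro mult_right_mono) auto
          show "\<delta> * (\<tau> * r) \<le> \<bar>\<epsilon> - 1\<bar> * \<bar>d\<bar>"
            using far \<epsilon> \<delta> \<tau> r0 by (intro mult_mono) auto
        qed (use \<delta> \<tau> r0 in auto)
        also have "\<dots> = 4 * q\<^sup>2 / \<delta> * (\<tau> / r)" using \<tau> by (simp add: power2_eq_square)
        finally show ?thesis .
      qed
      have "norm (integral {\<alpha>..\<beta>} F) \<le> (11 * q\<^sup>2 / \<delta> + q\<^sup>2 / (2 * \<delta>) + 4 * q\<^sup>2 / \<delta>) * (\<tau> / r)"
        unfolding distrib_right using t0 t1 t2 t3 by linarith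
      \<comment> \<open>11 + 1/2 + 4 = 15.5; the factor 2 q^2 from the lower bound for P_r(d) then
        turns 16 q^2 into 32 q^4.\<close>
      also have "\<dots> \<le> (16 * q\<^sup>2 / \<delta>) * (\<tau> / r)"
      proof (rule mult_right_mono)
        have "11 * q\<^sup>2 / \<delta> + q\<^sup>2 / (2 * \<delta>) + 4 * q\<^sup>2 / \<delta> = 31 / 2 * (q\<^sup>2 / \<delta>)" by (simp add: field_simps)
        also have "\<dots> \<le> 16 * (q\<^sup>2 / \<delta>)" using \<delta> by (intro mult_right_mono) auto
        finally show "11 * q\<^sup>2 / \<delta> + q\<^sup>2 / (2 * \<delta>) + 4 * q\<^sup>2 / \<delta> \<le> 16 * q\<^sup>2 / \<delta>" by simp
      qed (use \<tau> r0 in auto)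
      also have "\<dots> = (16 * q\<^sup>2 / \<delta>) * \<tau> * (1 / r)" by simp
      also have "\<dots> \<le> (16 * q\<^sup>2 / \<delta>) * \<tau> * (2 * q\<^sup>2 * poisson r d)"
      proof (rule mult_left_mono)
        have "d\<^sup>2 \<le> (q * r)\<^sup>2" using d q r0 by (intro abs_le_square_iff[THEN iffD1]) auto
        moreover have "r\<^sup>2 \<le> (q * r)\<^sup>2" using q r0 by (intro power_mono) auto
        ultimately have "r\<^sup>2 + d\<^sup>2 \<le> 2 * (q * r)\<^sup>2" by linarith
        then have "r / (2 * (q * r)\<^sup>2) \<le> r / (r\<^sup>2 + d\<^sup>2)"
          by (rule divide_left_mono) (use r0 q in \<open>auto simp: add_pos_nonneg\<close>)
        then have "2 * q\<^sup>2 * (r / (2 * (q * r)\<^sup>2)) \<le> 2 * q\<^sup>2 * poisson r d"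
          unfolding poisson_def by (intro mult_left_mono) auto
        then show "1 / r \<le> 2 * q\<^sup>2 * poisson r d"
          using r0 q by (simp add: power2_eq_square)
      qed (use \<tau> \<delta> q in auto)
      also have "\<dots> = 32 * q ^ 4 / \<delta> * \<tau> * poisson r d"
        by (simp add: power2_eq_square power4_eq_xxxx)
      also have "\<dots> \<le> 32 * Q ^ 4 / \<delta> * \<tau> * (poisson r d + poisson (\<tau> * r) d)"
        by (rule mult_mono[OF C]) (use pp Q0 in auto)
      finally show ?thesis unfolding K .
    qed
  qed
qed

section \<open>Truncated integrals and their limits\<close>

text \<open>\<open>\<theta> = 1\<close> gives the even phase and \<open>\<theta> = -1\<close> the odd one.\<close>

definition phase_factor :: "real \<Rightarrow> real \<Rightarrow> real \<Rightarrow> real \<Rightarrow> complex" where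
  "phase_factor \<theta> \<epsilon> A y = exp (\<i> * complex_of_real (A * (if 0 < y then 1 else \<theta>) * \<bar>y\<bar> powr \<epsilon>))"

lemma norm_phase_factor [simp]: "norm (phase_factor \<theta> \<epsilon> A y) = 1"
  unfolding phase_factor_def by (rule norm_exp_i_times)

lemma phase_factor_measurable [measurable]: "phase_factor \<theta> \<epsilon> A \<in> borel_measurable borel"
  unfolding phase_factor_def by measurable

lemma annulus_measurable [measurable]: "{y::real. a < \<bar>y\<bar> \<and> \<bar>y\<bar> \<le> b} \<in> sets borel" "{y::real. a < \<bar>y\<bar>} \<in> sets borel"
  by measurable

lemma set_integral_annulus:
  fixes F :: "real \<Rightarrow> complex"
  assumes "0 \<le> a" and F: "set_integrable lborel {y. a < \<bar>y\<bar> \<and> \<bar>y\<bar> \<le> b} F"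
  shows "(LINT y:{y. a < \<bar>y\<bar> \<and> \<bar>y\<bar> \<le> b}|lborel. F y) = (LINT y:{a<..b}|lborel. F y) + (LINT y:{a<..b}|lborel. F (- y))"
proof -
  have eq: "{y. a < \<bar>y\<bar> \<and> \<bar>y\<bar> \<le> b} = {a<..b} \<union> {-b..<-a}" using assms(1) by auto
  have "(LINT y:{-b..<-a}|lborel. F y) = (LINT y:{a<..b}|lborel. F (- y))"
    unfolding set_lebesgue_integral_def
    by (subst lborel_integral_real_affine[of "-1" _ 0]) (auto intro!: Bochner_Integration.integral_cong split: split_indicator)
  moreover have "(LINT y:{a<..b} \<union> {-b..<-a}|lborel. F y) = (LINT y:{a<..b}|lborel. F y) + (LINT y:{-b..<-a}|lborel. F y)"
    using assms(1) by (intro set_integral_Un set_integrable_subset[OF F]) (auto simp: eq)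
  ultimately show ?thesis unfolding eq by simp
qed

lemma set_integral_Ioc_eq_integral:
  fixes F :: "real \<Rightarrow> complex"
  assumes "continuous_on {a..b} F"
  shows "(LINT y:{a<..b}|lborel. F y) = integral {a..b} F"
proof -
  have int: "set_integrable lborel {a..b} F" by (rule borel_integrable_atLeastAtMost'[OF assms])
  have "(LINT y:{a<..b}|lborel. F y) = (LINT y:{a..b}|lborel. F y)"
  proof (rule set_integral_cong_set)
    have "set_integrable lborel {a<..b} F" by (rule set_integrable_subset[OF int]) auto
    then show "set_borel_measurable lborel {a..b} F" "set_borel_measurable lborel {a<..b} F"
      using int by (auto simp: set_integrable_def set_borel_measurable_def)
    show "AE x in lborel. (x \<in> {a..b}) = (x \<in> {a<..b})"
      using AE_lborel_singleton[of a] by eventually_elim auto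
  qed
  also have "\<dots> = integral {a..b} F" by (rule set_borel_integral_eq_integral[OF int])
  finally show ?thesis .
qed

text \<open>The amplitude 1/y is exactly \<Phi>' times y^(-\<epsilon>)/(A \<epsilon>), so no
  remainder is left, and the derivative of that factor has constant sign. As \<epsilon> < 0, the
  bound tends to 0 with the outer radius, uniformly in the inner one: oscillation takes the place of
  absolute convergence at the origin.\<close>

lemma oscillatory_integral_near_0:
  assumes \<epsilon>: "\<epsilon> < 0" and A: "A \<noteq> 0" and a: "0 < a" "a \<le> b"
  shows "norm (LINT y:{a<..b}|lborel. exp (\<i> * complex_of_real (A * y powr \<epsilon>)) * complex_of_real (1 / y))
    \<le> 4 / (\<bar>A\<bar> * \<bar>\<epsilon>\<bar>) * b powr \<bar>\<epsilon>\<bar>"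
proof -
  have cont: "continuous_on {a..b} (\<lambda>y. exp (\<i> * complex_of_real (A * y powr \<epsilon>)) * complex_of_real (1 / y))"
    using a by (intro continuous_intros) auto
  define c where "c = 1 / (\<bar>A\<bar> * \<bar>\<epsilon>\<bar>)"
  have c: "0 < c" using \<epsilon> A unfolding c_def by (intro divide_pos_pos mult_pos_pos) auto
  have "norm (integral {a..b} (\<lambda>y. exp (\<i> * complex_of_real (A * y powr \<epsilon>)) * complex_of_real (1 / y)))
    \<le> \<bar>1 / (A * \<epsilon>) * a powr (- \<epsilon>)\<bar> + \<bar>1 / (A * \<epsilon>) * b powr (- \<epsilon>)\<bar> + (c * b powr (- \<epsilon>) - c * a powr (- \<epsilon>)) + (0 - 0)"
  proof (rule oscillatory_integral_bound[where \<Phi>'="\<lambda>y. A * (\<epsilon> * y powr (\<epsilon> - 1))" and a="\<lambda>y. 1 / (A * \<epsilon>) * y powr (- \<epsilon>)"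
        and a'="\<lambda>y. 1 / (A * \<epsilon>) * (- \<epsilon> * y powr (- \<epsilon> - 1))" and D="\<lambda>y. c * y powr (- \<epsilon>)" and D'="\<lambda>y. c * (- \<epsilon> * y powr (- \<epsilon> - 1))"
        and E="\<lambda>_. 0" and E'="\<lambda>_. 0" and b="\<lambda>_. 0"])
    show "a \<le> b" by fact
    show "(\<lambda>y. exp (\<i> * complex_of_real (A * y powr \<epsilon>)) * complex_of_real (1 / y)) integrable_on {a..b}"
      by (rule integrable_continuous_interval[OF cont])
    fix y assume y: "y \<in> {a..b}"
    then have y0: "0 < y" using a by auto
    show "((\<lambda>y. A * y powr \<epsilon>) has_real_derivative A * (\<epsilon> * y powr (\<epsilon> - 1))) (at y)"
      "((\<lambda>y. 1 / (A * \<epsilon>) * y powr (- \<epsilon>)) has_real_derivative 1 / (A * \<epsilon>) * (- \<epsilon> * y powr (- \<epsilon> - 1))) (at y)"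
      "((\<lambda>y. c * y powr (- \<epsilon>)) has_real_derivative c * (- \<epsilon> * y powr (- \<epsilon> - 1))) (at y)"
      using y0 \<epsilon> A by (auto intro!: derivative_eq_intros simp: powr_diff field_simps)
    have "y powr (\<epsilon> - 1) * y powr (- \<epsilon>) = 1 / y"
      using y0 by (simp add: powr_diff powr_minus field_simps)
    then show "1 / y = A * (\<epsilon> * y powr (\<epsilon> - 1)) * (1 / (A * \<epsilon>) * y powr (- \<epsilon>)) + 0"
      using A \<epsilon> by simp
    show "\<bar>1 / (A * \<epsilon>) * (- \<epsilon> * y powr (- \<epsilon> - 1))\<bar> \<le> c * (- \<epsilon> * y powr (- \<epsilon> - 1))"
      using \<epsilon> by (simp add: c_def abs_mult)
  qed auto
  also have "\<dots> \<le> 4 * (c * b powr (- \<epsilon>))"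
  proof -
    have le: "a powr (- \<epsilon>) \<le> b powr (- \<epsilon>)" using a \<epsilon> by (intro powr_mono2) auto
    then have "c * a powr (- \<epsilon>) \<le> c * b powr (- \<epsilon>)" "0 \<le> c * a powr (- \<epsilon>)" using c by auto
    moreover have abs_eq: "\<bar>1 / (A * \<epsilon>) * t powr (- \<epsilon>)\<bar> = c * t powr (- \<epsilon>)" for t by (simp add: c_def abs_mult)
    ultimately show ?thesis unfolding abs_eq by linarith
  qed
  finally show ?thesis
    using \<epsilon> unfolding set_integral_Ioc_eq_integral[OF cont] by (simp add: c_def)
qed

lemma norm_exp_i_diff_le:
  "norm (exp (\<i> * complex_of_real u) - exp (\<i> * complex_of_real v)) \<le> \<bar>u - v\<bar>"
proof -
  have "exp (\<i> * complex_of_real u) - exp (\<i> * complex_of_real v)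
      = exp (\<i> * complex_of_real v) * (exp (\<i> * complex_of_real (u - v)) - 1)"
    by (simp add: right_diff_distrib flip: exp_add)
  then have "norm (exp (\<i> * complex_of_real u) - exp (\<i> * complex_of_real v)) = 2 * \<bar>sin ((u - v) / 2)\<bar>"
    by (simp add: norm_mult dist_exp_i_1 del: of_real_diff)
  also have "\<dots> \<le> \<bar>u - v\<bar>" using abs_sin_x_le_abs_x[of "(u - v) / 2"] by simp
  finally show ?thesis .
qed

text \<open>Folding the negative half-line onto the positive one leaves the difference of two
  integrals with parameters A and A \<theta>. It cancels for \<theta> = 1; for \<epsilon> > 0 the
  two phases differ by at most 2 |A| y^\<epsilon>, which absorbs the singularity of 1/y; for
  \<epsilon> < 0 each integral is small by oscillation. \<open>W\<close> may depend on A because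
  only convergence is at stake.\<close>

lemma phase_annulus_bound:
  assumes \<theta>: "\<theta> = 1 \<or> \<theta> = -1" and \<epsilon>: "\<epsilon> \<noteq> 0"
  shows "\<exists>W. \<forall>a b. 0 < a \<longrightarrow> a < b \<longrightarrow>
    norm (LINT y:{y. a < \<bar>y\<bar> \<and> \<bar>y\<bar> \<le> b}|lborel. phase_factor \<theta> \<epsilon> A y / complex_of_real y) \<le> W * b powr \<bar>\<epsilon>\<bar>"
proof -
  define e where "e A y = exp (\<i> * complex_of_real (A * y powr \<epsilon>)) * complex_of_real (1 / y)" for A y
  have e_cont: "continuous_on {a..b} (e A)" if "0 < a" for a b A
    unfolding e_def using that by (intro continuous_intros) auto
  have e_int: "set_integrable lborel {a<..b} (e A)" if "0 < a" for a b A
    by (rule set_integrable_subset[OF borel_integrable_atLeastAtMost'[OF e_cont[OF that]]]) auto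
  have split: "(LINT y:{y. a < \<bar>y\<bar> \<and> \<bar>y\<bar> \<le> b}|lborel. phase_factor \<theta> \<epsilon> A y / complex_of_real y)
      = (LINT y:{a<..b}|lborel. e A y) - (LINT y:{a<..b}|lborel. e (A * \<theta>) y)" if ab: "0 < a" "a < b" for a b
  proof -
    have "set_integrable lborel {y. a < \<bar>y\<bar> \<and> \<bar>y\<bar> \<le> b} (\<lambda>y. phase_factor \<theta> \<epsilon> A y / complex_of_real y)"
      unfolding set_integrable_def
    proof (rule Bochner_Integration.integrable_bound)
      show "integrable lborel (\<lambda>y. (1 / a) * indicator {-b..b} y)" using ab by simp
      show "AE y in lborel. norm (indicator {y. a < \<bar>y\<bar> \<and> \<bar>y\<bar> \<le> b} y *\<^sub>R (phase_factor \<theta> \<epsilon> A y / complex_of_real y)) \<le> norm ((1 / a) * indicator {-b..b} y)"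
        using ab by (intro AE_I2) (auto simp: norm_divide field_simps split: split_indicator)
    qed measurable
    then have "(LINT y:{y. a < \<bar>y\<bar> \<and> \<bar>y\<bar> \<le> b}|lborel. phase_factor \<theta> \<epsilon> A y / complex_of_real y)
      = (LINT y:{a<..b}|lborel. phase_factor \<theta> \<epsilon> A y / complex_of_real y) + (LINT y:{a<..b}|lborel. phase_factor \<theta> \<epsilon> A (- y) / complex_of_real (- y))"
      using ab by (intro set_integral_annulus) auto
    also have "(LINT y:{a<..b}|lborel. phase_factor \<theta> \<epsilon> A y / complex_of_real y) = (LINT y:{a<..b}|lborel. e A y)"
      using ab by (intro set_lebesgue_integral_cong) (auto simp: phase_factor_def e_def)
    also have "(LINT y:{a<..b}|lborel. phase_factor \<theta> \<epsilon> A (- y) / complex_of_real (- y)) = (LINT y:{a<..b}|lborel. - e (A * \<theta>) y)"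
      using ab by (intro set_lebesgue_integral_cong) (auto simp: phase_factor_def e_def)
    also have "\<dots> = - (LINT y:{a<..b}|lborel. e (A * \<theta>) y)"
      by (simp add: set_lebesgue_integral_def)
    finally show ?thesis by simp
  qed
  consider "\<theta> = 1 \<or> A = 0" | "\<epsilon> < 0" "A \<noteq> 0" | "0 < \<epsilon>" using \<epsilon> by linarith
  then show ?thesis
  proof cases
    case 1
    then have "A * \<theta> = A" by auto
    then show ?thesis using split by (intro exI[of _ 0]) auto
  next
    case 2
    have "norm (LINT y:{a<..b}|lborel. e C y) \<le> 4 / (\<bar>A\<bar> * \<bar>\<epsilon>\<bar>) * b powr \<bar>\<epsilon>\<bar>" if "0 < a" "a < b" "C = A \<or> C = A * \<theta>" for a b C
    proof -
      have "C \<noteq> 0" "\<bar>C\<bar> = \<bar>A\<bar>" using that 2 \<theta> by auto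
      then show ?thesis using oscillatory_integral_near_0[OF 2(1), of C a b] that by (simp add: e_def)
    qed
    note e_le = this
    show ?thesis
    proof (intro exI[of _ "8 / (\<bar>A\<bar> * \<bar>\<epsilon>\<bar>)"] allI impI)
      fix a b :: real assume ab: "0 < a" "a < b"
      show "norm (LINT y:{y. a < \<bar>y\<bar> \<and> \<bar>y\<bar> \<le> b}|lborel. phase_factor \<theta> \<epsilon> A y / complex_of_real y) \<le> 8 / (\<bar>A\<bar> * \<bar>\<epsilon>\<bar>) * b powr \<bar>\<epsilon>\<bar>"
        unfolding split[OF ab]
        by (rule order_trans[OF norm_triangle_ineq4 order_trans[OF add_mono[OF e_le[OF ab, of A] e_le[OF ab, of "A * \<theta>"]]]]) auto
    qed
  next
    case 3
    show ?thesis
    proof (intro exI[of _ "2 * \<bar>A\<bar> / \<epsilon>"] allI impI)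
      fix a b :: real assume ab: "0 < a" "a < b"
      have der: "((\<lambda>y. 2 * \<bar>A\<bar> / \<epsilon> * y powr \<epsilon>) has_vector_derivative 2 * \<bar>A\<bar> * y powr (\<epsilon> - 1)) (at y within {a..b})" if "y \<in> {a..b}" for y
      proof -
        have "((\<lambda>y. 2 * \<bar>A\<bar> / \<epsilon> * y powr \<epsilon>) has_real_derivative 2 * \<bar>A\<bar> / \<epsilon> * (\<epsilon> * y powr (\<epsilon> - 1))) (at y)"
          using that ab by (intro DERIV_cmult) (auto intro!: derivative_eq_intros simp: powr_diff field_simps)
        then show ?thesis
          using 3 by (simp add: has_real_derivative_iff_has_vector_derivative has_vector_derivative_at_within mult.assoc)
      qed
      have FTC: "((\<lambda>y. 2 * \<bar>A\<bar> * y powr (\<epsilon> - 1)) has_integral (2 * \<bar>A\<bar> / \<epsilon> * b powr \<epsilon> - 2 * \<bar>A\<bar> / \<epsilon> * a powr \<epsilon>)) {a..b}"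
        using ab der by (intro fundamental_theorem_of_calculus) auto
      have "norm (integral {a..b} (\<lambda>y. e A y - e (A * \<theta>) y)) \<le> integral {a..b} (\<lambda>y. 2 * \<bar>A\<bar> * y powr (\<epsilon> - 1))"
      proof (rule integral_norm_bound_integral)
        show "(\<lambda>y. e A y - e (A * \<theta>) y) integrable_on {a..b}"
          using e_cont[OF ab(1)] by (intro integrable_continuous_interval continuous_on_diff)
        show "(\<lambda>y. 2 * \<bar>A\<bar> * y powr (\<epsilon> - 1)) integrable_on {a..b}" using FTC by blast
        fix y assume y: "y \<in> {a..b}"
        have "norm (e A y - e (A * \<theta>) y) = norm (exp (\<i> * complex_of_real (A * y powr \<epsilon>)) - exp (\<i> * complex_of_real (A * \<theta> * y powr \<epsilon>))) / y"
          unfolding e_def left_diff_distrib[symmetric] norm_mult using y ab by (simp add: norm_divide)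
        also have "\<dots> \<le> \<bar>A * y powr \<epsilon> - A * \<theta> * y powr \<epsilon>\<bar> / y"
          using y ab by (intro divide_right_mono norm_exp_i_diff_le) auto
        also have "A * y powr \<epsilon> - A * \<theta> * y powr \<epsilon> = A * (1 - \<theta>) * y powr \<epsilon>" by (simp add: algebra_simps)
        also have "\<bar>\<dots>\<bar> / y \<le> \<bar>A\<bar> * 2 * y powr \<epsilon> / y"
          unfolding abs_mult using \<theta> y ab by (intro divide_right_mono mult_mono) auto
        also have "\<dots> = 2 * \<bar>A\<bar> * y powr (\<epsilon> - 1)" using y ab by (simp add: powr_diff)
        finally show "norm (e A y - e (A * \<theta>) y) \<le> 2 * \<bar>A\<bar> * y powr (\<epsilon> - 1)" .
      qed
      also have "\<dots> \<le> 2 * \<bar>A\<bar> / \<epsilon> * b powr \<epsilon>"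
        using integral_unique[OF FTC] 3 by simp
      also have "integral {a..b} (\<lambda>y. e A y - e (A * \<theta>) y) = (LINT y:{a<..b}|lborel. e A y) - (LINT y:{a<..b}|lborel. e (A * \<theta>) y)"
        using e_cont[OF ab(1)]
        by (simp add: set_integral_Ioc_eq_integral integral_diff integrable_continuous_interval)
      finally show "norm (LINT y:{y. a < \<bar>y\<bar> \<and> \<bar>y\<bar> \<le> b}|lborel. phase_factor \<theta> \<epsilon> A y / complex_of_real y) \<le> 2 * \<bar>A\<bar> / \<epsilon> * b powr \<bar>\<epsilon>\<bar>"
        unfolding split[OF ab] using 3 by simp
    qed
  qed
qed

text \<open>The bound depends on the larger argument alone, so the values at 1/(n+1) form a Cauchy
  sequence, and I(a) stays within \<omega>(a) of its limit.\<close>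

lemma cauchy_at_right_0:
  fixes I :: "real \<Rightarrow> complex"
  assumes I: "\<And>a b. 0 < a \<Longrightarrow> a < b \<Longrightarrow> norm (I a - I b) \<le> \<omega> b" and \<omega>: "(\<omega> \<longlongrightarrow> 0) (at_right 0)"
  shows "\<exists>l. (I \<longlongrightarrow> l) (at_right 0)"
proof -
  define X where "X n = I (inverse (real (Suc n)))" for n
  have seq: "(\<lambda>n. \<omega> (inverse (real (Suc n)))) \<longlonglongrightarrow> 0"
    by (rule filterlim_compose[OF \<omega>])
      (use LIMSEQ_inverse_real_of_nat in \<open>auto simp: filterlim_at simp del: of_nat_Suc\<close>)
  have "Cauchy X"
  proof (rule metric_CauchyI)
    fix e :: real assume "0 < e"
    then obtain M where M: "\<And>n. n \<ge> M \<Longrightarrow> \<bar>\<omega> (inverse (real (Suc n)))\<bar> < e"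
      using LIMSEQ_D[OF seq] by auto
    have half: "norm (X n - X m) < e" if "m \<ge> M" "m < n" for m n
    proof -
      have "norm (X n - X m) \<le> \<omega> (inverse (real (Suc m)))"
        unfolding X_def using that by (intro I) (auto simp: field_simps)
      then show ?thesis using M[OF that(1)] by simp
    qed
    have "dist (X m) (X n) < e" if "m \<ge> M" "n \<ge> M" for m n
      using half[of m n] half[of n m] that \<open>0 < e\<close> by (cases m n rule: linorder_cases) (auto simp: dist_norm norm_minus_commute)
    then show "\<exists>M. \<forall>m\<ge>M. \<forall>n\<ge>M. dist (X m) (X n) < e" by blast
  qed
  then obtain l where l: "X \<longlonglongrightarrow> l" using Cauchy_convergent_iff convergent_def by blast
  have "norm (I a - l) \<le> \<omega> a" if "0 < a" for a
  proof -
    have "(\<lambda>n. norm (X n - I a)) \<longlonglongrightarrow> norm (l - I a)" by (intro tendsto_intros l)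
    moreover have "\<forall>\<^sub>F n in sequentially. norm (X n - I a) \<le> \<omega> a"
      using order_tendstoD(2)[OF LIMSEQ_inverse_real_of_nat that]
      by eventually_elim (auto simp: X_def intro!: I)
    ultimately have "norm (l - I a) \<le> \<omega> a" by (rule tendsto_upperbound) simp
    then show ?thesis by (simp add: norm_minus_commute)
  qed
  then have "\<forall>\<^sub>F a in at_right 0. norm (I a - l) \<le> \<omega> a"
    by (auto simp: eventually_at_right_field intro!: exI[of _ 1])
  then have "((\<lambda>a. I a - l) \<longlongrightarrow> 0) (at_right 0)" using \<omega> by (rule Lim_null_comparison)
  then show ?thesis by (auto simp: LIM_zero_iff)
qed

text \<open>All that is used of a Schwartz function: integrability makes the truncated integrals
  converge and decay at infinity, boundedness gives square integrability and a dominating function,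
  and the Lipschitz bound gives continuity and the principal value at the origin.\<close>

locale lipschitz_L1 =
  fixes f :: "real \<Rightarrow> complex" and B L :: real
  assumes int: "integrable lborel f"
    and bound: "\<And>x. norm (f x) \<le> B"
    and lipschitz: "\<And>x y. norm (f x - f y) \<le> L * \<bar>x - y\<bar>"
begin

lemma B_nonneg: "0 \<le> B"
  using bound[of 0] norm_ge_zero[of "f 0"] by linarith

lemma L_nonneg: "0 \<le> L"
  using order_trans[OF norm_ge_zero lipschitz[of 1 0]] by simp

lemma f_cont: "continuous_on UNIV f"
proof -
  have "L-lipschitz_on UNIV f"
    using lipschitz L_nonneg by (auto simp: lipschitz_on_def dist_norm)
  then show ?thesis by (rule lipschitz_on_continuous_on)
qed

lemma f_meas [measurable]: "f \<in> borel_measurable borel"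
  using f_cont by (rule borel_measurable_continuous_onI)

lemma f_shift_int: "integrable lborel (\<lambda>y. f (x - y))"
  using lborel_integrable_real_affine[OF int, of "-1" x] by simp

definition integrand :: "real \<Rightarrow> real \<Rightarrow> real \<Rightarrow> real \<Rightarrow> real \<Rightarrow> complex" where
  "integrand \<theta> \<epsilon> A x y = phase_factor \<theta> \<epsilon> A y * f (x - y) / complex_of_real y"

definition truncated :: "real \<Rightarrow> real \<Rightarrow> real \<Rightarrow> real \<Rightarrow> real \<Rightarrow> complex" where
  "truncated \<theta> \<epsilon> A x a = (LINT y:{y. a < \<bar>y\<bar>}|lborel. integrand \<theta> \<epsilon> A x y)"

lemma integrand_measurable [measurable]: "integrand \<theta> \<epsilon> A x \<in> borel_measurable borel"
  unfolding integrand_def by measurable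

lemma integrand_integrable:
  assumes "0 < a"
  shows "set_integrable lborel {y. a < \<bar>y\<bar>} (integrand \<theta> \<epsilon> A x)"
  unfolding set_integrable_def
proof (rule Bochner_Integration.integrable_bound)
  show "integrable lborel (\<lambda>y. (1 / a) *\<^sub>R f (x - y))" using f_shift_int by simp
  show "AE y in lborel. norm (indicator {y. a < \<bar>y\<bar>} y *\<^sub>R integrand \<theta> \<epsilon> A x y) \<le> norm ((1 / a) *\<^sub>R f (x - y))"
  proof (rule AE_I2)
    fix y
    have "norm (f (x - y)) / \<bar>y\<bar> \<le> norm (f (x - y)) / a" if "a < \<bar>y\<bar>"
      using that assms by (intro divide_left_mono) auto
    then show "norm (indicator {y. a < \<bar>y\<bar>} y *\<^sub>R integrand \<theta> \<epsilon> A x y) \<le> norm ((1 / a) *\<^sub>R f (x - y))"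
      using assms by (auto simp: integrand_def norm_mult norm_divide split: split_indicator)
  qed
qed measurable

lemma truncated_diff:
  assumes "0 < a" "a \<le> b"
  shows "truncated \<theta> \<epsilon> A x a - truncated \<theta> \<epsilon> A x b = (LINT y:{y. a < \<bar>y\<bar> \<and> \<bar>y\<bar> \<le> b}|lborel. integrand \<theta> \<epsilon> A x y)"
    and "set_integrable lborel {y. a < \<bar>y\<bar> \<and> \<bar>y\<bar> \<le> b} (integrand \<theta> \<epsilon> A x)"
proof -
  show *: "set_integrable lborel {y. a < \<bar>y\<bar> \<and> \<bar>y\<bar> \<le> b} (integrand \<theta> \<epsilon> A x)"
    by (rule set_integrable_subset[OF integrand_integrable[OF assms(1)]]) auto
  have eq: "{y. a < \<bar>y\<bar>} = {y. a < \<bar>y\<bar> \<and> \<bar>y\<bar> \<le> b} \<union> {y. b < \<bar>y\<bar>}" using assms by auto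
  have "truncated \<theta> \<epsilon> A x a = (LINT y:{y. a < \<bar>y\<bar> \<and> \<bar>y\<bar> \<le> b}|lborel. integrand \<theta> \<epsilon> A x y) + truncated \<theta> \<epsilon> A x b"
    unfolding truncated_def eq using assms
    by (intro set_integral_Un * integrand_integrable) auto
  then show "truncated \<theta> \<epsilon> A x a - truncated \<theta> \<epsilon> A x b = (LINT y:{y. a < \<bar>y\<bar> \<and> \<bar>y\<bar> \<le> b}|lborel. integrand \<theta> \<epsilon> A x y)"
    by simp
qed

lemma truncated_at_top: "(truncated \<theta> \<epsilon> A x \<longlongrightarrow> 0) at_top"
proof (rule Lim_null_comparison)
  show "\<forall>\<^sub>F a in at_top. norm (truncated \<theta> \<epsilon> A x a) \<le> (LINT y|lborel. norm (f (x - y))) / a"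
    using eventually_gt_at_top[of 0]
  proof eventually_elim
    case (elim a)
    have "norm (truncated \<theta> \<epsilon> A x a) \<le> (LINT y|lborel. norm (f (x - y)) / a)"
      unfolding truncated_def set_lebesgue_integral_def
    proof (rule Bochner_Integration.integral_norm_bound_integral)
      show "integrable lborel (\<lambda>y. indicator {y. a < \<bar>y\<bar>} y *\<^sub>R integrand \<theta> \<epsilon> A x y)"
        using integrand_integrable[OF elim] by (simp add: set_integrable_def)
      show "integrable lborel (\<lambda>y. norm (f (x - y)) / a)" using f_shift_int by simp
      fix y
      have "norm (f (x - y)) / \<bar>y\<bar> \<le> norm (f (x - y)) / a" if "a < \<bar>y\<bar>"
        using that elim by (intro divide_left_mono) auto
      then show "norm (indicator {y. a < \<bar>y\<bar>} y *\<^sub>R integrand \<theta> \<epsilon> A x y) \<le> norm (f (x - y)) / a"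
        using elim by (auto simp: integrand_def norm_mult norm_divide split: split_indicator)
    qed
    then show ?case by simp
  qed
  show "((\<lambda>a. (LINT y|lborel. norm (f (x - y))) / a) \<longlongrightarrow> 0) at_top"
    by (rule real_tendsto_divide_at_top[OF tendsto_const filterlim_ident])
qed

text \<open>f(x - y) is split into its deviation from f(x) and f(x) itself. In the first part the
  Lipschitz bound cancels 1/|y|; \<open>phase_annulus_bound\<close> treats the constant.\<close>

lemma truncated_tail_bound:
  assumes \<theta>: "\<theta> = 1 \<or> \<theta> = -1" and \<epsilon>: "\<epsilon> \<noteq> 0"
  shows "\<exists>W. \<forall>a b. 0 < a \<longrightarrow> a < b \<longrightarrow>
    norm (truncated \<theta> \<epsilon> A x a - truncated \<theta> \<epsilon> A x b) \<le> 2 * L * b + norm (f x) * (W * b powr \<bar>\<epsilon>\<bar>)"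
proof -
  obtain W where W: "\<And>a b. 0 < a \<Longrightarrow> a < b \<Longrightarrow>
      norm (LINT y:{y. a < \<bar>y\<bar> \<and> \<bar>y\<bar> \<le> b}|lborel. phase_factor \<theta> \<epsilon> A y / complex_of_real y) \<le> W * b powr \<bar>\<epsilon>\<bar>"
    using phase_annulus_bound[OF \<theta> \<epsilon>, of A] by blast
  show ?thesis
  proof (intro exI[of _ W] allI impI)
    fix a b :: real assume ab: "0 < a" "a < b"
    let ?S = "{y. a < \<bar>y\<bar> \<and> \<bar>y\<bar> \<le> b}"
    let ?p = "\<lambda>y. phase_factor \<theta> \<epsilon> A y / complex_of_real y"
    let ?d = "\<lambda>y. phase_factor \<theta> \<epsilon> A y * (f (x - y) - f x) / complex_of_real y"
    have int_ind: "integrable lborel (indicator {-b..b} :: real \<Rightarrow> real)"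
      using ab by simp
    have p: "set_integrable lborel ?S ?p"
      unfolding set_integrable_def
    proof (rule Bochner_Integration.integrable_bound)
      show "integrable lborel (\<lambda>y. (1 / a) * indicator {-b..b} y)" using int_ind by simp
      show "AE y in lborel. norm (indicator ?S y *\<^sub>R ?p y) \<le> norm ((1 / a) * indicator {-b..b} y)"
        using ab by (intro AE_I2) (auto simp: norm_divide field_simps split: split_indicator)
    qed measurable
    have d_le: "norm (indicator ?S y *\<^sub>R ?d y) \<le> L * indicator {-b..b} y" for y
    proof (cases "y \<in> ?S")
      case True
      have "norm (f (x - y) - f x) \<le> L * \<bar>y\<bar>" using lipschitz[of "x - y" x] by simp
      moreover have "0 < \<bar>y\<bar>" using True ab by auto
      ultimately have "norm (f (x - y) - f x) / \<bar>y\<bar> \<le> L" by (simp only: pos_divide_le_eq)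
      then show ?thesis using True by (auto simp: norm_divide norm_mult split: split_indicator)
    qed (use L_nonneg in auto)
    have d: "set_integrable lborel ?S ?d"
      unfolding set_integrable_def
    proof (rule Bochner_Integration.integrable_bound)
      show "integrable lborel (\<lambda>y. L * indicator {-b..b} y)" using int_ind by simp
      show "AE y in lborel. norm (indicator ?S y *\<^sub>R ?d y) \<le> norm (L * indicator {-b..b} y)"
        by (intro AE_I2 order_trans[OF d_le]) auto
    qed measurable
    have d_int: "norm (LINT y:?S|lborel. ?d y) \<le> 2 * L * b"
    proof -
      have "norm (LINT y:?S|lborel. ?d y) \<le> (LINT y|lborel. L * indicator {-b..b} y)"
        unfolding set_lebesgue_integral_def
        using d int_ind d_le by (intro Bochner_Integration.integral_norm_bound_integral) (auto simp: set_integrable_def)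
      also have "\<dots> = 2 * L * b" using ab by simp
      finally show ?thesis .
    qed
    have "truncated \<theta> \<epsilon> A x a - truncated \<theta> \<epsilon> A x b = (LINT y:?S|lborel. ?d y + f x * ?p y)"
      using ab unfolding truncated_diff(1)[OF ab(1) less_imp_le[OF ab(2)]]
      by (intro set_lebesgue_integral_cong) (auto simp: integrand_def diff_divide_distrib algebra_simps)
    also have "\<dots> = (LINT y:?S|lborel. ?d y) + f x * (LINT y:?S|lborel. ?p y)"
      by (simp only: set_integral_add(2)[OF d set_integrable_mult_right[of "f x", OF p]] set_integral_mult_right)
    finally have eq: "truncated \<theta> \<epsilon> A x a - truncated \<theta> \<epsilon> A x b = (LINT y:?S|lborel. ?d y) + f x * (LINT y:?S|lborel. ?p y)" .
    show "norm (truncated \<theta> \<epsilon> A x a - truncated \<theta> \<epsilon> A x b) \<le> 2 * L * b + norm (f x) * (W * b powr \<bar>\<epsilon>\<bar>)"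
      unfolding eq
      by (rule order_trans[OF norm_triangle_ineq]) (simp only: norm_mult add_mono[OF d_int mult_left_mono[OF W[OF ab] norm_ge_zero]])
  qed
qed

text \<open>\<open>Lim\<close> says something only about a convergent function, so this has to
  precede every estimate of \<open>pv_integral\<close>.\<close>

lemma truncated_convergent:
  assumes "\<theta> = 1 \<or> \<theta> = -1" "\<epsilon> \<noteq> 0"
  shows "\<exists>l. (truncated \<theta> \<epsilon> A x \<longlongrightarrow> l) (at_right 0)"
proof -
  obtain W where W: "\<And>a b. 0 < a \<Longrightarrow> a < b \<Longrightarrow>
      norm (truncated \<theta> \<epsilon> A x a - truncated \<theta> \<epsilon> A x b) \<le> 2 * L * b + norm (f x) * (W * b powr \<bar>\<epsilon>\<bar>)"
    using truncated_tail_bound[OF assms, of A x] by blast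
  show ?thesis
  proof (rule cauchy_at_right_0[OF W])
    have "((\<lambda>b. b powr \<bar>\<epsilon>\<bar>) \<longlongrightarrow> 0) (at_right 0)"
    proof -
      have "\<forall>\<^sub>F b in at_right (0::real). 0 \<le> b"
        using eventually_at_right_less[of "0::real"] by eventually_elim simp
      then have "((\<lambda>b. b powr \<bar>\<epsilon>\<bar>) \<longlongrightarrow> 0 powr \<bar>\<epsilon>\<bar>) (at_right 0)"
        using assms(2) by (intro tendsto_powr') (auto intro: tendsto_ident_at)
      then show ?thesis by simp
    qed
    then have "((\<lambda>b. 2 * L * b + norm (f x) * (W * b powr \<bar>\<epsilon>\<bar>)) \<longlongrightarrow> 2 * L * 0 + norm (f x) * (W * 0)) (at_right 0)"
      by (intro tendsto_intros)
    then show "((\<lambda>b. 2 * L * b + norm (f x) * (W * b powr \<bar>\<epsilon>\<bar>)) \<longlongrightarrow> 0) (at_right 0)" by simp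
  qed
qed

lemma pv_integral_eq:
  assumes "(truncated \<theta> \<epsilon> A x \<longlongrightarrow> l) (at_right 0)"
  shows "pv_integral (integrand \<theta> \<epsilon> A x) = l"
  using assms unfolding pv_integral_def truncated_def by (intro tendsto_Lim) auto

end

section \<open>Maximal operators over rational dilations\<close>

text \<open>A countable dense set of dilations keeps the supremum in \<open>maxop\<close> measurable
  and fits the sequence of scales in \<open>maximal_bound\<close>. Real scales are recovered later,
  by comparison for Poisson kernels and by continuity for oscillating ones.\<close>

definition posrat :: "nat \<Rightarrow> real" where
  "posrat = from_nat_into {q. q \<in> \<rat> \<and> 0 < q}"

lemma range_posrat: "range posrat = {q. q \<in> \<rat> \<and> 0 < q}"
proof -
  have "countable {q::real. q \<in> \<rat> \<and> 0 < q}" by (rule countable_subset[OF _ countable_rat]) auto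
  moreover have "{q::real. q \<in> \<rat> \<and> 0 < q} \<noteq> {}" by (auto intro!: exI[of _ 1])
  ultimately show ?thesis unfolding posrat_def by (rule range_from_nat_into[rotated])
qed

lemma posrat_pos: "0 < posrat n"
  using range_posrat by blast

lemma posrat_between:
  assumes "0 \<le> a" "a < b"
  obtains n where "a < posrat n" "posrat n < b"
proof -
  obtain q where "q \<in> \<rat>" "a < q" "q < b" using Rats_dense_in_real[OF assms(2)] by blast
  moreover from this have "q \<in> range posrat" using assms by (simp add: range_posrat)
  ultimately show ?thesis using that by blast
qed

lemma ennreal_SUP_power2: "(SUP n. a n)\<^sup>2 = (SUP n::nat. (a n)\<^sup>2 :: ennreal)"
proof (rule antisym)
  have "(SUP n. a n)\<^sup>2 = (SUP n. a n * (SUP m. a m))"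
    by (simp add: power2_eq_square SUP_mult_right_ennreal)
  also have "\<dots> = (SUP n. SUP m. a n * a m)"
    by (simp add: SUP_mult_left_ennreal)
  also have "\<dots> \<le> (SUP n. (a n)\<^sup>2)"
  proof (intro SUP_least)
    fix n m
    have "a n * a m \<le> (a (if a n \<le> a m then m else n))\<^sup>2"
      by (auto simp: power2_eq_square intro!: mult_mono)
    also have "\<dots> \<le> (SUP n. (a n)\<^sup>2)" by (rule SUP_upper) simp
    finally show "a n * a m \<le> (SUP n. (a n)\<^sup>2)" .
  qed
  finally show "(SUP n. a n)\<^sup>2 \<le> (SUP n. (a n)\<^sup>2)" .
  show "(SUP n. (a n)\<^sup>2) \<le> (SUP n. a n)\<^sup>2"
    by (intro SUP_least power_mono SUP_upper) auto
qed

definition maxop :: "(real \<Rightarrow> real \<Rightarrow> complex) \<Rightarrow> (real \<Rightarrow> complex) \<Rightarrow> real \<Rightarrow> ennreal" where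
  "maxop \<kappa> f x = (SUP n. ennreal (norm (LINT z|lborel. \<kappa> (posrat n) (x - z) * f z)))"

lemma maxop_measurable:
  assumes \<kappa>: "(\<lambda>(r, y). \<kappa> r y) \<in> borel_measurable (lborel \<Otimes>\<^sub>M lborel)"
    and f [measurable]: "f \<in> borel_measurable lborel"
  shows "maxop \<kappa> f \<in> borel_measurable lborel"
proof -
  have [measurable (raw)]: "(\<lambda>p. \<kappa> (a p) (b p)) \<in> borel_measurable M"
    if [measurable]: "a \<in> borel_measurable M" "b \<in> borel_measurable M" for a b and M :: "'x measure"
    using measurable_compose[OF measurable_Pair[of a M lborel b lborel] \<kappa>] that by simp
  show ?thesis unfolding maxop_def by measurable
qed

lemma maxop_bound:
  assumes "(\<lambda>(r, y). \<kappa> r y) \<in> borel_measurable (lborel \<Otimes>\<^sub>M lborel)"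
    and "\<And>r. 0 < r \<Longrightarrow> (\<integral>\<^sup>+y. ennreal ((norm (\<kappa> r y))\<^sup>2) \<partial>lborel) < \<infinity>"
    and "0 < \<tau>" and "0 \<le> c"
    and "\<And>r r' x x'. 0 < r \<Longrightarrow> 0 < r' \<Longrightarrow>
      norm (LINT z|lborel. \<kappa> r (x - z) * cnj (\<kappa> r' (x' - z)))
      \<le> c * (poisson r (x - x') + poisson (\<tau> * r) (x - x')) + c * (poisson r' (x - x') + poisson (\<tau> * r') (x - x'))"
    and "f \<in> borel_measurable lborel" and "(\<integral>\<^sup>+x. ennreal ((norm (f x))\<^sup>2) \<partial>lborel) < \<infinity>"
  shows "(\<integral>\<^sup>+x. (maxop \<kappa> f x)\<^sup>2 \<partial>lborel) \<le> ennreal (108 * c) * (\<integral>\<^sup>+x. ennreal ((norm (f x))\<^sup>2) \<partial>lborel)"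
  using maximal_bound[OF assms, where rs=posrat] posrat_pos
  by (simp add: maxop_def ennreal_SUP_power2 ennreal_power)

definition poisson_maxop :: "(real \<Rightarrow> complex) \<Rightarrow> real \<Rightarrow> ennreal" where
  "poisson_maxop = maxop (\<lambda>r y. complex_of_real (poisson r y))"

definition conj_poisson_maxop :: "(real \<Rightarrow> complex) \<Rightarrow> real \<Rightarrow> ennreal" where
  "conj_poisson_maxop = maxop (\<lambda>r y. complex_of_real (conj_poisson r y))"

text \<open>The bound 4 pi (P_r + P_r') in the shape that \<open>maxop_bound\<close> asks for. With
  \<tau> = 1 its two Poisson terms coincide, so each carries 2 pi.\<close>

lemma poisson_product_le:
  assumes "0 < r" "0 < r'"
  shows "\<bar>LINT z|lborel. poisson r (x - z) * poisson r' (x' - z)\<bar>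
    \<le> 2 * pi * (poisson r (x - x') + poisson (1 * r) (x - x')) + 2 * pi * (poisson r' (x - x') + poisson (1 * r') (x - x'))"
proof -
  have "0 \<le> (LINT z|lborel. poisson r (x - z) * poisson r' (x' - z))"
    using assms by (intro Bochner_Integration.integral_nonneg) auto
  then show ?thesis
    using poisson_mult_integrable(2)[OF assms, of x x'] by (simp add: algebra_simps)
qed

lemma poisson_maxop_measurable:
  assumes "f \<in> borel_measurable lborel"
  shows "poisson_maxop f \<in> borel_measurable lborel"
  unfolding poisson_maxop_def by (rule maxop_measurable[OF _ assms]) measurable

lemma conj_poisson_maxop_measurable:
  assumes "f \<in> borel_measurable lborel"
  shows "conj_poisson_maxop f \<in> borel_measurable lborel"
  unfolding conj_poisson_maxop_def by (rule maxop_measurable[OF _ assms]) measurable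

lemma poisson_maxop_bound:
  assumes f: "f \<in> borel_measurable lborel" "(\<integral>\<^sup>+x. ennreal ((norm (f x))\<^sup>2) \<partial>lborel) < \<infinity>"
  shows "(\<integral>\<^sup>+x. (poisson_maxop f x)\<^sup>2 \<partial>lborel) \<le> ennreal (108 * (2 * pi)) * (\<integral>\<^sup>+x. ennreal ((norm (f x))\<^sup>2) \<partial>lborel)"
  unfolding poisson_maxop_def
proof (rule maxop_bound[where \<tau>=1, OF _ _ _ _ _ f])
  show "(\<lambda>(r, y). complex_of_real (poisson r y)) \<in> borel_measurable (lborel \<Otimes>\<^sub>M lborel)" by measurable
  show "(\<integral>\<^sup>+y. ennreal ((norm (complex_of_real (poisson r y)))\<^sup>2) \<partial>lborel) < \<infinity>" if "0 < r" for r
    using nn_integral_poisson_square[OF that, of 0] by (auto intro: le_less_trans)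
  fix r r' x x' :: real assume r: "0 < r" "0 < r'"
  have "(LINT z|lborel. complex_of_real (poisson r (x - z)) * cnj (complex_of_real (poisson r' (x' - z))))
      = complex_of_real (LINT z|lborel. poisson r (x - z) * poisson r' (x' - z))"
    by (simp flip: integral_complex_of_real)
  then show "norm (LINT z|lborel. complex_of_real (poisson r (x - z)) * cnj (complex_of_real (poisson r' (x' - z))))
    \<le> 2 * pi * (poisson r (x - x') + poisson (1 * r) (x - x')) + 2 * pi * (poisson r' (x - x') + poisson (1 * r') (x - x'))"
    using poisson_product_le[OF r] by simp
qed auto

lemma conj_poisson_maxop_bound:
  assumes f: "f \<in> borel_measurable lborel" "(\<integral>\<^sup>+x. ennreal ((norm (f x))\<^sup>2) \<partial>lborel) < \<infinity>"
  shows "(\<integral>\<^sup>+x. (conj_poisson_maxop f x)\<^sup>2 \<partial>lborel) \<le> ennreal (108 * (2 * pi)) * (\<integral>\<^sup>+x. ennreal ((norm (f x))\<^sup>2) \<partial>lborel)"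
  unfolding conj_poisson_maxop_def
proof (rule maxop_bound[where \<tau>=1, OF _ _ _ _ _ f])
  show "(\<lambda>(r, y). complex_of_real (conj_poisson r y)) \<in> borel_measurable (lborel \<Otimes>\<^sub>M lborel)" by measurable
  show "(\<integral>\<^sup>+y. ennreal ((norm (complex_of_real (conj_poisson r y)))\<^sup>2) \<partial>lborel) < \<infinity>" if "0 < r" for r
  proof -
    have "(\<integral>\<^sup>+y. ennreal ((norm (complex_of_real (conj_poisson r y)))\<^sup>2) \<partial>lborel)
      \<le> (\<integral>\<^sup>+y. ennreal (1 / r) * ennreal (poisson r (y - 0)) \<partial>lborel)"
    proof (intro nn_integral_mono)
      fix y
      have "0 < r\<^sup>2 + y\<^sup>2" using that by (simp add: add_pos_nonneg)
      then have "y\<^sup>2 / (r\<^sup>2 + y\<^sup>2)\<^sup>2 \<le> (r\<^sup>2 + y\<^sup>2) / (r\<^sup>2 + y\<^sup>2)\<^sup>2" by (intro divide_right_mono) auto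
      also have "\<dots> = 1 / r * poisson r y"
        using that \<open>0 < r\<^sup>2 + y\<^sup>2\<close> by (simp add: poisson_def power2_eq_square[of "r\<^sup>2 + y\<^sup>2"])
      finally show "ennreal ((norm (complex_of_real (conj_poisson r y)))\<^sup>2) \<le> ennreal (1 / r) * ennreal (poisson r (y - 0))"
        using that unfolding norm_of_real power2_abs conj_poisson_def power_divide by (simp flip: ennreal_mult)
    qed
    also have "\<dots> = ennreal (1 / r) * ennreal pi"
      using nn_integral_poisson'[OF that, of 0] by (subst nn_integral_cmult) simp_all
    finally show ?thesis by (auto intro: le_less_trans simp: ennreal_mult_less_top)
  qed
  fix r r' x x' :: real assume r: "0 < r" "0 < r'"
  have "(LINT z|lborel. complex_of_real (conj_poisson r (x - z)) * cnj (complex_of_real (conj_poisson r' (x' - z))))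
      = complex_of_real (LINT z|lborel. conj_poisson r (x - z) * conj_poisson r' (x' - z))"
    by (simp flip: integral_complex_of_real)
  then show "norm (LINT z|lborel. complex_of_real (conj_poisson r (x - z)) * cnj (complex_of_real (conj_poisson r' (x' - z))))
    \<le> 2 * pi * (poisson r (x - x') + poisson (1 * r) (x - x')) + 2 * pi * (poisson r' (x - x') + poisson (1 * r') (x - x'))"
    using poisson_product_le[OF r] by (simp add: conj_poisson_mult[OF r])
qed auto

text \<open>\<open>osc_kernel\<close> at a positive scale lives on the positive half-line; s = 1 or
  s = -1 selects the half-line on which the dilated kernel acts.\<close>

definition osc_maxop :: "real \<Rightarrow> real \<Rightarrow> real \<Rightarrow> (real \<Rightarrow> complex) \<Rightarrow> real \<Rightarrow> ennreal" where
  "osc_maxop \<epsilon> N s = maxop (\<lambda>r y. osc_kernel \<epsilon> N r (s * y))"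

lemma osc_maxop_measurable:
  assumes "f \<in> borel_measurable lborel"
  shows "osc_maxop \<epsilon> N s f \<in> borel_measurable lborel"
  unfolding osc_maxop_def by (rule maxop_measurable[OF _ assms]) measurable

lemma norm_osc_kernel_le:
  assumes "0 < r"
  shows "norm (osc_kernel \<epsilon> N r y) \<le> 1 / r * indicator {r..2 powr (1 / \<bar>\<epsilon>\<bar>) * r} y"
proof -
  have "1 / y \<le> 1 / r" if "r < y" using that assms by (intro divide_left_mono) auto
  then show ?thesis using assms
    by (auto simp: osc_kernel_def norm_divide split: split_indicator)
qed

lemma osc_maxop_bound:
  assumes \<delta>: "0 < \<delta>" "\<delta> < 1" and \<epsilon>: "\<delta> < \<bar>\<epsilon>\<bar>" "\<delta> < \<bar>\<epsilon> - 1\<bar>" and s: "s = 1 \<or> s = -1"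
    and \<tau>: "0 < \<tau>" "\<tau> \<le> 1" "\<tau> ^ 4 * \<bar>N\<bar> = 1"
    and f: "f \<in> borel_measurable lborel" "(\<integral>\<^sup>+x. ennreal ((norm (f x))\<^sup>2) \<partial>lborel) < \<infinity>"
  shows "(\<integral>\<^sup>+x. (osc_maxop \<epsilon> N s f x)\<^sup>2 \<partial>lborel)
    \<le> ennreal (108 * (32 * (2 powr (1 / \<delta>)) ^ 4 / \<delta> * \<tau>)) * (\<integral>\<^sup>+x. ennreal ((norm (f x))\<^sup>2) \<partial>lborel)"
  unfolding osc_maxop_def
proof (rule maxop_bound[where \<tau>=\<tau>, OF _ _ \<tau>(1) _ _ f])
  let ?C = "32 * (2 powr (1 / \<delta>)) ^ 4 / \<delta> * \<tau>"
  show "(\<lambda>(r, y). osc_kernel \<epsilon> N r (s * y)) \<in> borel_measurable (lborel \<Otimes>\<^sub>M lborel)" by measurable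
  show C: "0 \<le> ?C" using \<delta> \<tau> by simp
  show "(\<integral>\<^sup>+y. ennreal ((norm (osc_kernel \<epsilon> N r (s * y)))\<^sup>2) \<partial>lborel) < \<infinity>" if "0 < r" for r
  proof -
    define q where "q = 2 powr (1 / \<bar>\<epsilon>\<bar>)"
    have "(\<integral>\<^sup>+y. ennreal ((norm (osc_kernel \<epsilon> N r (s * y)))\<^sup>2) \<partial>lborel)
      \<le> (\<integral>\<^sup>+y. ennreal ((1 / r)\<^sup>2) * indicator {- (q * r)..q * r} y \<partial>lborel)"
    proof (intro nn_integral_mono)
      fix y
      have "(norm (osc_kernel \<epsilon> N r (s * y)))\<^sup>2 \<le> (1 / r * indicator {r..q * r} (s * y))\<^sup>2"
        unfolding q_def by (intro power_mono norm_osc_kernel_le that) auto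
      then show "ennreal ((norm (osc_kernel \<epsilon> N r (s * y)))\<^sup>2) \<le> ennreal ((1 / r)\<^sup>2) * indicator {- (q * r)..q * r} y"
        using s that by (auto split: split_indicator_asm split_indicator simp: ennreal_leI)
    qed
    also have "\<dots> < \<infinity>" by (simp add: nn_integral_cmult_indicator ennreal_mult_less_top emeasure_lborel_Icc_eq)
    finally show ?thesis .
  qed
  \<comment> \<open>The substitution z = x - s y, with s^2 = 1; the displacement becomes d = s (x -
    x').\<close>
  have sub: "(LINT z|lborel. osc_kernel \<epsilon> N r (s * (x - z)) * cnj (osc_kernel \<epsilon> N r' (s * (x' - z))))
      = (LINT y|lborel. osc_kernel \<epsilon> N r y * cnj (osc_kernel \<epsilon> N r' (y - s * (x - x'))))" for r r' x x'
    using s by (subst lborel_integral_real_affine[of "- s" _ x]) (auto simp: algebra_simps)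
  have pos: "0 \<le> ?C * (poisson r d + poisson (\<tau> * r) d)" if "0 < r" for r d
    by (rule mult_nonneg_nonneg[OF C add_nonneg_nonneg]) (use that \<tau> in auto)
  have one: "norm (LINT z|lborel. osc_kernel \<epsilon> N r (s * (x - z)) * cnj (osc_kernel \<epsilon> N r' (s * (x' - z))))
      \<le> ?C * (poisson r (x - x') + poisson (\<tau> * r) (x - x'))" if "0 < r'" "r' \<le> r" for r r' x x'
    using osc_kernel_correlation[OF \<delta> \<epsilon> that \<tau>, of "s * (x - x')"] s
    unfolding sub by (auto simp: poisson_commute[of _ x' x])
  fix r r' x x' :: real assume r: "0 < r" "0 < r'"
  show "norm (LINT z|lborel. osc_kernel \<epsilon> N r (s * (x - z)) * cnj (osc_kernel \<epsilon> N r' (s * (x' - z))))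
    \<le> ?C * (poisson r (x - x') + poisson (\<tau> * r) (x - x')) + ?C * (poisson r' (x - x') + poisson (\<tau> * r') (x - x'))"
  proof (cases "r' \<le> r")
    case True
    from one[OF r(2) this, of x x'] pos[OF r(2), of "x - x'"] show ?thesis by linarith
  next
    \<comment> \<open>\<open>osc_kernel_correlation\<close> wants the larger scale first;
      conjugating the integral exchanges the two factors.\<close>
    case False
    have "(LINT z|lborel. osc_kernel \<epsilon> N r (s * (x - z)) * cnj (osc_kernel \<epsilon> N r' (s * (x' - z))))
       = (LINT z|lborel. cnj (osc_kernel \<epsilon> N r' (s * (x' - z)) * cnj (osc_kernel \<epsilon> N r (s * (x - z)))))"
      by (simp add: mult.commute)
    also have "\<dots> = cnj (LINT z|lborel. osc_kernel \<epsilon> N r' (s * (x' - z)) * cnj (osc_kernel \<epsilon> N r (s * (x - z))))"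
      by (rule Bochner_Integration.integral_cnj)
    finally have "norm (LINT z|lborel. osc_kernel \<epsilon> N r (s * (x - z)) * cnj (osc_kernel \<epsilon> N r' (s * (x' - z))))
      \<le> ?C * (poisson r' (x' - x) + poisson (\<tau> * r') (x' - x))"
      using one[of r r' x' x] False r by (simp del: complex_cnj_mult)
    then show ?thesis using pos[OF r(1), of "x - x'"] by (simp add: poisson_commute[of _ x' x])
  qed
qed

section \<open>Pointwise domination\<close>

lemma LINT_convolution_swap:
  fixes \<kappa> f :: "real \<Rightarrow> complex"
  shows "(LINT z|lborel. \<kappa> (x - z) * f z) = (LINT y|lborel. \<kappa> y * f (x - y))"
  by (subst lborel_integral_real_affine[of "-1" _ x]) auto

context lipschitz_L1
begin

definition abs_poisson_maxop :: "real \<Rightarrow> ennreal" where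
  "abs_poisson_maxop = poisson_maxop (\<lambda>z. complex_of_real (norm (f z)))"

lemma poisson_abs_integrable:
  assumes "0 < r"
  shows "integrable lborel (\<lambda>y. poisson r y * norm (f (x - y)))"
proof (rule Bochner_Integration.integrable_bound)
  show "integrable lborel (\<lambda>y. 1 / r * norm (f (x - y)))" using f_shift_int by simp
  show "AE y in lborel. norm (poisson r y * norm (f (x - y))) \<le> norm (1 / r * norm (f (x - y)))"
    using assms mult_right_mono[OF poisson_le_inverse[OF assms] norm_ge_zero] by (intro AE_I2) (simp add: abs_mult)
qed measurable

lemma poisson_average_le_maxop:
  "ennreal (LINT y|lborel. poisson (posrat n) y * norm (f (x - y))) \<le> abs_poisson_maxop x"
proof -
  have "(LINT z|lborel. complex_of_real (poisson (posrat n) (x - z)) * complex_of_real (norm (f z)))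
      = complex_of_real (LINT y|lborel. poisson (posrat n) y * norm (f (x - y)))"
    by (subst LINT_convolution_swap) (simp flip: integral_complex_of_real)
  then have "ennreal (LINT y|lborel. poisson (posrat n) y * norm (f (x - y)))
    = ennreal (norm (LINT z|lborel. complex_of_real (poisson (posrat n) (x - z)) * complex_of_real (norm (f z))))"
    using posrat_pos[of n] by (simp add: Bochner_Integration.integral_nonneg less_imp_le)
  also have "\<dots> \<le> abs_poisson_maxop x"
    unfolding abs_poisson_maxop_def poisson_maxop_def maxop_def by (rule SUP_upper) simp
  finally show ?thesis .
qed

text \<open>A rational \<rho> between r and 2 r satisfies \<rho>^2 + y^2 <= 4 (r^2 + y^2), hence P_r
  <= 4 P_\<rho>. Positivity lets this comparison replace a limit over rational scales.\<close>

lemma poisson_average_le_maxop':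
  assumes "0 < r"
  shows "ennreal (LINT y|lborel. poisson r y * norm (f (x - y))) \<le> 4 * abs_poisson_maxop x"
proof -
  obtain n where n: "r < posrat n" "posrat n < 2 * r"
    using posrat_between[of r "2 * r"] assms by auto
  let ?\<rho> = "posrat n"
  have le: "poisson r y \<le> 4 * poisson ?\<rho> y" for y
  proof -
    have "?\<rho>\<^sup>2 \<le> (2 * r)\<^sup>2" using n assms by (intro power_mono) auto
    then have "?\<rho>\<^sup>2 + y\<^sup>2 \<le> 4 * (r\<^sup>2 + y\<^sup>2)" by (simp add: power_mult_distrib) (use zero_le_power2[of y] in linarith)
    then have "r * (?\<rho>\<^sup>2 + y\<^sup>2) \<le> ?\<rho> * (4 * (r\<^sup>2 + y\<^sup>2))" using n assms by (intro mult_mono) auto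
    moreover have "0 < r\<^sup>2 + y\<^sup>2" "0 < ?\<rho>\<^sup>2 + y\<^sup>2" using n assms by (auto simp: add_pos_nonneg)
    ultimately show ?thesis by (simp add: poisson_def field_simps)
  qed
  have "(LINT y|lborel. poisson r y * norm (f (x - y))) \<le> (LINT y|lborel. 4 * (poisson ?\<rho> y * norm (f (x - y))))"
    using assms posrat_pos[of n] le
    by (intro integral_mono poisson_abs_integrable integrable_mult_right) (auto simp: mult.assoc[symmetric] intro!: mult_right_mono)
  then have "ennreal (LINT y|lborel. poisson r y * norm (f (x - y))) \<le> ennreal (4 * (LINT y|lborel. poisson ?\<rho> y * norm (f (x - y))))"
    by (intro ennreal_leI) simp
  also have "\<dots> = 4 * ennreal (LINT y|lborel. poisson ?\<rho> y * norm (f (x - y)))"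
    by (subst ennreal_mult) (auto simp: posrat_pos less_imp_le intro!: Bochner_Integration.integral_nonneg)
  also have "\<dots> \<le> 4 * abs_poisson_maxop x" by (intro mult_left_mono poisson_average_le_maxop) auto
  finally show ?thesis .
qed

text \<open>For A = 0 the phase is 1. The truncated kernel differs from the conjugate Poisson kernel
  of a rational scale \<rho> in (b, 2 b) by at most twice the Poisson kernel: for |y| > b the
  difference is \<rho>^2 / (y (\<rho>^2 + y^2)) with \<rho> < 2 |y|, and for |y| <= b it is the
  conjugate kernel alone, with |y| < \<rho>.\<close>

lemma truncated_hilbert_le:
  assumes "0 < b"
  shows "ennreal (norm (truncated \<theta> \<epsilon> 0 x b)) \<le> conj_poisson_maxop f x + 2 * abs_poisson_maxop x"
proof -
  obtain n where n: "b < posrat n" "posrat n < 2 * b"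
    using posrat_between[of b "2 * b"] assms by auto
  let ?\<rho> = "posrat n"
  have \<rho>: "0 < ?\<rho>" by (rule posrat_pos)
  define k where "k y = indicator {y. b < \<bar>y\<bar>} y / y" for y :: real
  have k_le: "\<bar>k y - conj_poisson ?\<rho> y\<bar> \<le> 2 * poisson ?\<rho> y" for y
  proof -
    have D: "0 < ?\<rho>\<^sup>2 + y\<^sup>2" using \<rho> by (simp add: add_pos_nonneg)
    show ?thesis
    proof (cases "b < \<bar>y\<bar>")
      case True
      then have y: "y \<noteq> 0" "?\<rho> \<le> 2 * \<bar>y\<bar>" using assms n by auto
      have "k y - conj_poisson ?\<rho> y = 1 / y - y / (?\<rho>\<^sup>2 + y\<^sup>2)" using True by (simp add: k_def conj_poisson_def)
      also have "\<dots> = ?\<rho>\<^sup>2 / (y * (?\<rho>\<^sup>2 + y\<^sup>2))"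
        using y D by (simp add: field_simps power2_eq_square)
      finally have "\<bar>k y - conj_poisson ?\<rho> y\<bar> = (?\<rho> / \<bar>y\<bar>) * poisson ?\<rho> y"
        using D \<rho> by (simp add: poisson_def abs_mult power2_eq_square[of ?\<rho>])
      also have "\<dots> \<le> 2 * poisson ?\<rho> y"
        using y \<rho> by (intro mult_right_mono) (auto simp: divide_le_eq)
      finally show ?thesis .
    next
      case False
      have "\<bar>y\<bar> / (?\<rho>\<^sup>2 + y\<^sup>2) \<le> 2 * ?\<rho> / (?\<rho>\<^sup>2 + y\<^sup>2)"
        using False n \<rho> D by (intro divide_right_mono) auto
      then show ?thesis using False D \<rho> by (simp add: k_def conj_poisson_def poisson_def abs_mult)
    qed
  qed
  have [measurable]: "k \<in> borel_measurable borel" unfolding k_def by measurable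
  have tr: "truncated \<theta> \<epsilon> 0 x b = (LINT y|lborel. complex_of_real (k y) * f (x - y))"
    unfolding truncated_def set_lebesgue_integral_def
    by (intro Bochner_Integration.integral_cong) (auto simp: k_def integrand_def phase_factor_def split: split_indicator)
  have int_d: "integrable lborel (\<lambda>y. complex_of_real (k y - conj_poisson ?\<rho> y) * f (x - y))"
  proof (rule Bochner_Integration.integrable_bound)
    show "integrable lborel (\<lambda>y. 2 * (poisson ?\<rho> y * norm (f (x - y))))"
      using poisson_abs_integrable[OF \<rho>] by simp
    show "AE y in lborel. norm (complex_of_real (k y - conj_poisson ?\<rho> y) * f (x - y)) \<le> norm (2 * (poisson ?\<rho> y * norm (f (x - y))))"
      using mult_right_mono[OF k_le norm_ge_zero] \<rho> by (intro AE_I2) (simp add: norm_mult abs_mult mult.assoc del: of_real_diff)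
  qed measurable
  have int_k: "integrable lborel (\<lambda>y. complex_of_real (k y) * f (x - y))"
  proof -
    have "(\<lambda>y. complex_of_real (k y) * f (x - y)) = (\<lambda>y. indicator {y. b < \<bar>y\<bar>} y *\<^sub>R integrand \<theta> \<epsilon> 0 x y)"
      by (auto simp: k_def integrand_def phase_factor_def split: split_indicator)
    then show ?thesis using integrand_integrable[OF assms, of \<theta> \<epsilon> 0 x] by (simp add: set_integrable_def)
  qed
  have int_q: "integrable lborel (\<lambda>y. complex_of_real (conj_poisson ?\<rho> y) * f (x - y))"
    using Bochner_Integration.integrable_diff[OF int_k int_d] by (simp add: algebra_simps)
  have "truncated \<theta> \<epsilon> 0 x b = (LINT y|lborel. complex_of_real (conj_poisson ?\<rho> y) * f (x - y))
      + (LINT y|lborel. complex_of_real (k y - conj_poisson ?\<rho> y) * f (x - y))"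
    unfolding tr by (subst Bochner_Integration.integral_add[OF int_q int_d, symmetric]) (simp add: algebra_simps)
  then have "norm (truncated \<theta> \<epsilon> 0 x b) \<le> norm (LINT y|lborel. complex_of_real (conj_poisson ?\<rho> y) * f (x - y))
      + norm (LINT y|lborel. complex_of_real (k y - conj_poisson ?\<rho> y) * f (x - y))"
    by (simp only: norm_triangle_ineq)
  moreover have "norm (LINT y|lborel. complex_of_real (k y - conj_poisson ?\<rho> y) * f (x - y)) \<le> (LINT y|lborel. 2 * (poisson ?\<rho> y * norm (f (x - y))))"
    using int_d poisson_abs_integrable[OF \<rho>] mult_right_mono[OF k_le norm_ge_zero]
    by (intro Bochner_Integration.integral_norm_bound_integral) (auto simp: norm_mult mult.assoc simp del: of_real_diff)
  ultimately have "ennreal (norm (truncated \<theta> \<epsilon> 0 x b)) \<le> ennreal (norm (LINT y|lborel. complex_of_real (conj_poisson ?\<rho> y) * f (x - y))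
      + 2 * (LINT y|lborel. poisson ?\<rho> y * norm (f (x - y))))"
    by (intro ennreal_leI) simp
  also have "\<dots> = ennreal (norm (LINT y|lborel. complex_of_real (conj_poisson ?\<rho> y) * f (x - y))) + 2 * ennreal (LINT y|lborel. poisson ?\<rho> y * norm (f (x - y)))"
    using \<rho> by (subst ennreal_plus) (auto simp: ennreal_mult less_imp_le intro!: Bochner_Integration.integral_nonneg)
  also have "\<dots> \<le> conj_poisson_maxop f x + 2 * abs_poisson_maxop x"
  proof (intro add_mono mult_left_mono poisson_average_le_maxop)
    show "ennreal (norm (LINT y|lborel. complex_of_real (conj_poisson ?\<rho> y) * f (x - y))) \<le> conj_poisson_maxop f x"
      unfolding conj_poisson_maxop_def maxop_def
      by (subst LINT_convolution_swap[of "\<lambda>y. complex_of_real (conj_poisson ?\<rho> y)", symmetric]) (rule SUP_upper, simp)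
  qed simp
  finally show ?thesis .
qed

text \<open>On the annulus the phase factor differs from 1 by at most t, and 1/|y| is at most (1 +
  q^2) P_R(y) because R < |y| <= q R. Replacing the phase by 1 therefore costs a Poisson average of
  |f|.\<close>

lemma low_annulus_le:
  assumes R: "0 < R" "1 \<le> q" and t: "0 \<le> t" "\<And>y. R < \<bar>y\<bar> \<Longrightarrow> \<bar>y\<bar> \<le> q * R \<Longrightarrow> \<bar>A\<bar> * \<bar>y\<bar> powr \<epsilon> \<le> t"
    and \<theta>: "\<theta> = 1 \<or> \<theta> = -1"
  shows "ennreal (norm ((truncated \<theta> \<epsilon> A x R - truncated \<theta> \<epsilon> A x (q * R)) - (truncated \<theta> \<epsilon> 0 x R - truncated \<theta> \<epsilon> 0 x (q * R))))
    \<le> ennreal (t * (1 + q\<^sup>2)) * (4 * abs_poisson_maxop x)"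
proof -
  let ?S = "{y. R < \<bar>y\<bar> \<and> \<bar>y\<bar> \<le> q * R}"
  have qR: "R \<le> q * R" using R by simp
  note td = truncated_diff[OF R(1) qR]
  let ?d = "\<lambda>y. integrand \<theta> \<epsilon> A x y - integrand \<theta> \<epsilon> 0 x y"
  have d: "set_integrable lborel ?S ?d" by (intro set_integral_diff(1) td(2))
  have le: "norm (indicator ?S y *\<^sub>R ?d y) \<le> t * (1 + q\<^sup>2) * (poisson R y * norm (f (x - y)))" for y
  proof (cases "y \<in> ?S")
    case True
    then have y: "R < \<bar>y\<bar>" "\<bar>y\<bar> \<le> q * R" by auto
    have "norm (phase_factor \<theta> \<epsilon> A y - 1) \<le> \<bar>A * (if 0 < y then 1 else \<theta>) * \<bar>y\<bar> powr \<epsilon>\<bar>"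
      using norm_exp_i_diff_le[of "A * (if 0 < y then 1 else \<theta>) * \<bar>y\<bar> powr \<epsilon>" 0]
      by (simp only: phase_factor_def of_real_0 mult_zero_right exp_zero diff_zero)
    also have "\<dots> = \<bar>A\<bar> * \<bar>y\<bar> powr \<epsilon>" using \<theta> by (auto simp: abs_mult)
    also have "\<dots> \<le> t" by (rule t(2)[OF y])
    finally have ph: "norm (phase_factor \<theta> \<epsilon> A y - 1) \<le> t" .
    have inv: "1 / \<bar>y\<bar> \<le> (1 + q\<^sup>2) * poisson R y"
    proof -
      have "1 / \<bar>y\<bar> \<le> 1 / R" using y R by (intro divide_left_mono) auto
      also have "\<dots> = (1 + q\<^sup>2) * (R / ((1 + q\<^sup>2) * R\<^sup>2))"
      proof -
        have "0 < 1 + q\<^sup>2" by (simp add: add_pos_nonneg)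
        then show ?thesis using R by (simp add: power2_eq_square[of R])
      qed
      also have "\<dots> \<le> (1 + q\<^sup>2) * (R / (R\<^sup>2 + y\<^sup>2))"
      proof (intro mult_left_mono divide_left_mono)
        have "y\<^sup>2 \<le> (q * R)\<^sup>2" using y R by (intro abs_le_square_iff[THEN iffD1]) auto
        then show "R\<^sup>2 + y\<^sup>2 \<le> (1 + q\<^sup>2) * R\<^sup>2" by (simp add: algebra_simps power_mult_distrib)
      qed (use R in \<open>auto simp: add_pos_nonneg\<close>)
      finally show ?thesis by (simp add: poisson_def)
    qed
    have "?d y = (phase_factor \<theta> \<epsilon> A y - 1) * f (x - y) / complex_of_real y"
      by (simp add: integrand_def phase_factor_def left_diff_distrib diff_divide_distrib)
    then have "norm (?d y) = norm (phase_factor \<theta> \<epsilon> A y - 1) * (1 / \<bar>y\<bar>) * norm (f (x - y))"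
      by (simp add: norm_mult norm_divide)
    also have "\<dots> \<le> t * ((1 + q\<^sup>2) * poisson R y) * norm (f (x - y))"
      by (intro mult_right_mono mult_mono ph inv t) auto
    finally show ?thesis using True by (simp add: mult.assoc)
  next
    case False
    have "0 \<le> t * (1 + q\<^sup>2) * (poisson R y * norm (f (x - y)))"
      using t R by (intro mult_nonneg_nonneg) auto
    then show ?thesis using False by simp
  qed
  have "(truncated \<theta> \<epsilon> A x R - truncated \<theta> \<epsilon> A x (q * R)) - (truncated \<theta> \<epsilon> 0 x R - truncated \<theta> \<epsilon> 0 x (q * R))
      = (LINT y:?S|lborel. ?d y)"
    unfolding td(1) by (rule set_integral_diff(2)[symmetric]) (rule td(2))+
  moreover have "norm (LINT y:?S|lborel. ?d y) \<le> (LINT y|lborel. t * (1 + q\<^sup>2) * (poisson R y * norm (f (x - y))))"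
    unfolding set_lebesgue_integral_def
    using d poisson_abs_integrable[OF R(1)] le
    by (intro Bochner_Integration.integral_norm_bound_integral integrable_mult_right) (auto simp: set_integrable_def)
  ultimately have "ennreal (norm ((truncated \<theta> \<epsilon> A x R - truncated \<theta> \<epsilon> A x (q * R)) - (truncated \<theta> \<epsilon> 0 x R - truncated \<theta> \<epsilon> 0 x (q * R))))
      \<le> ennreal (t * (1 + q\<^sup>2) * (LINT y|lborel. poisson R y * norm (f (x - y))))"
    by (intro ennreal_leI) (simp only: integral_mult_right_zero)
  also have "\<dots> = ennreal (t * (1 + q\<^sup>2)) * ennreal (LINT y|lborel. poisson R y * norm (f (x - y)))"
    using t R by (subst ennreal_mult) (auto intro!: Bochner_Integration.integral_nonneg)
  also have "\<dots> \<le> ennreal (t * (1 + q\<^sup>2)) * (4 * abs_poisson_maxop x)"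
    by (intro mult_left_mono poisson_average_le_maxop' R) simp
  finally show ?thesis .
qed

lemma osc_average_le:
  assumes R: "0 < R" and s: "s = 1 \<or> s = -1"
  shows "ennreal (norm (LINT y|lborel. osc_kernel \<epsilon> N R (s * y) * f (x - y))) \<le> osc_maxop \<epsilon> N s f x"
proof -
  define J where "J r = (LINT t|lborel. osc_kernel \<epsilon> N 1 (s * t) * f (x - r * t))" for r
  define q where "q = 2 powr (1 / \<bar>\<epsilon>\<bar>)"
  have J: "(LINT y|lborel. osc_kernel \<epsilon> N r (s * y) * f (x - y)) = J r" if "0 < r" for r
  proof -
    have osc: "complex_of_real r * osc_kernel \<epsilon> N r (r * u) = osc_kernel \<epsilon> N 1 u" for u
      using that by (auto simp: osc_kernel_def mult.commute)
    have "(LINT y|lborel. osc_kernel \<epsilon> N r (s * y) * f (x - y)) = \<bar>r\<bar> *\<^sub>R (LINT t|lborel. osc_kernel \<epsilon> N r (s * (0 + r * t)) * f (x - (0 + r * t)))"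
      using that by (intro lborel_integral_real_affine) auto
    also have "\<dots> = (LINT t|lborel. (complex_of_real r * osc_kernel \<epsilon> N r (r * (s * t))) * f (x - r * t))"
      using that by (simp add: scaleR_conv_of_real mult.assoc mult.left_commute[of s])
    finally show ?thesis unfolding osc J_def .
  qed
  have lim: "(\<lambda>k. J (\<rho> k)) \<longlonglongrightarrow> J R" if \<rho>: "\<rho> \<longlonglongrightarrow> R" for \<rho>
    unfolding J_def
  proof (rule integral_dominated_convergence[where w="\<lambda>t. B * indicator {-q..q} t"])
    have "- q \<le> q" by (simp add: q_def)
    then show "integrable lborel (\<lambda>t. B * indicator {-q..q} t)" by simp
    show "AE t in lborel. (\<lambda>k. osc_kernel \<epsilon> N 1 (s * t) * f (x - \<rho> k * t)) \<longlonglongrightarrow> osc_kernel \<epsilon> N 1 (s * t) * f (x - R * t)"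
    proof (intro AE_I2 tendsto_mult tendsto_const)
      fix t
      have "isCont f (x - R * t)" using f_cont continuous_on_eq_continuous_at[OF open_UNIV] by blast
      moreover have "(\<lambda>k. x - \<rho> k * t) \<longlonglongrightarrow> x - R * t" by (intro tendsto_intros \<rho>)
      ultimately show "(\<lambda>k. f (x - \<rho> k * t)) \<longlonglongrightarrow> f (x - R * t)" by (rule isCont_tendsto_compose)
    qed
    fix k
    show "AE t in lborel. norm (osc_kernel \<epsilon> N 1 (s * t) * f (x - \<rho> k * t)) \<le> B * indicator {-q..q} t"
    proof (rule AE_I2)
      fix t
      have "norm (osc_kernel \<epsilon> N 1 (s * t)) \<le> indicator {1..q} (s * t)"
        using norm_osc_kernel_le[of 1 \<epsilon> N "s * t"] by (simp add: q_def)
      also have "\<dots> \<le> indicator {-q..q} t" using s by (auto split: split_indicator)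
      finally have "norm (f (x - \<rho> k * t)) * norm (osc_kernel \<epsilon> N 1 (s * t)) \<le> B * indicator {-q..q} t"
        by (intro mult_mono bound B_nonneg) auto
      then show "norm (osc_kernel \<epsilon> N 1 (s * t) * f (x - \<rho> k * t)) \<le> B * indicator {-q..q} t"
        by (simp add: norm_mult mult.commute)
    qed
  qed measurable
  have "\<exists>n. R < posrat n \<and> posrat n < R + 1 / real (Suc k)" for k
    using posrat_between[of R "R + 1 / real (Suc k)"] R by (metis less_add_same_cancel1 less_imp_le of_nat_0_less_iff zero_less_Suc zero_less_divide_1_iff)
  then obtain n where n: "\<And>k. R < posrat (n k)" "\<And>k. posrat (n k) < R + 1 / real (Suc k)" by metis
  have conv: "(\<lambda>k. posrat (n k)) \<longlonglongrightarrow> R"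
  proof (rule tendsto_sandwich[of "\<lambda>_. R" _ _ "\<lambda>k. R + 1 / real (Suc k)"])
    show "(\<lambda>k. R + 1 / real (Suc k)) \<longlonglongrightarrow> R"
      using tendsto_add[OF tendsto_const LIMSEQ_inverse_real_of_nat, of R] by (simp add: inverse_eq_divide del: of_nat_Suc)
  qed (use n in \<open>auto intro!: always_eventually less_imp_le simp del: of_nat_Suc\<close>)
  have "(\<lambda>k. ennreal (norm (J (posrat (n k))))) \<longlonglongrightarrow> ennreal (norm (J R))"
    by (intro tendsto_ennrealI tendsto_norm lim conv)
  then show ?thesis
    unfolding J[OF R]
  proof (rule LIMSEQ_le_const2, intro exI[of _ 0] allI impI)
    fix k
    show "ennreal (norm (J (posrat (n k)))) \<le> osc_maxop \<epsilon> N s f x"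
      unfolding J[OF posrat_pos, symmetric] osc_maxop_def maxop_def
      by (subst LINT_convolution_swap[of "\<lambda>y. osc_kernel \<epsilon> N (posrat (n k)) (s * y)", symmetric]) (rule SUP_upper, simp)
  qed
qed

text \<open>Since A y^\<epsilon> = (A R^\<epsilon>) (y/R)^\<epsilon>, the annulus starting at R
  carries the kernel of scale R and frequency A R^\<epsilon>. The reflected half-line has frequency
  A R^\<epsilon> \<theta> and, 1/y being odd, a minus sign that the norm absorbs.\<close>

lemma high_annulus_le:
  assumes R: "0 < R" and \<theta>: "\<theta> = 1 \<or> \<theta> = -1"
  shows "ennreal (norm (truncated \<theta> \<epsilon> A x R - truncated \<theta> \<epsilon> A x (2 powr (1 / \<bar>\<epsilon>\<bar>) * R)))
    \<le> osc_maxop \<epsilon> (A * R powr \<epsilon>) 1 f x + osc_maxop \<epsilon> (A * R powr \<epsilon> * \<theta>) (-1) f x"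
proof -
  define q where "q = 2 powr (1 / \<bar>\<epsilon>\<bar>)"
  have q: "1 \<le> q" unfolding q_def by (intro ge_one_powr_ge_zero) auto
  have qR: "R \<le> q * R" using R q by simp
  note td = truncated_diff[OF R(1) qR]
  have pw: "R powr \<epsilon> * (y / R) powr \<epsilon> = y powr \<epsilon>" if "0 < y" for y
    using R that by (simp add: powr_divide)
  have 1: "(LINT y:{R<..q * R}|lborel. integrand \<theta> \<epsilon> A x y) = (LINT y|lborel. osc_kernel \<epsilon> (A * R powr \<epsilon>) R (1 * y) * f (x - y))"
    unfolding set_lebesgue_integral_def
  proof (intro Bochner_Integration.integral_cong refl)
    fix y
    show "indicator {R<..q * R} y *\<^sub>R integrand \<theta> \<epsilon> A x y = osc_kernel \<epsilon> (A * R powr \<epsilon>) R (1 * y) * f (x - y)"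
    proof (cases "y \<in> {R<..q * R}")
      case True
      then have "0 < y" using R by auto
      then show ?thesis using True pw[of y]
        by (simp add: integrand_def osc_kernel_def phase_factor_def q_def mult.assoc flip: of_real_mult)
    qed (auto simp: osc_kernel_def q_def)
  qed
  have 2: "(LINT y:{R<..q * R}|lborel. integrand \<theta> \<epsilon> A x (- y)) = - (LINT y|lborel. osc_kernel \<epsilon> (A * R powr \<epsilon> * \<theta>) R ((-1) * y) * f (x - y))"
  proof -
    have "(LINT y:{R<..q * R}|lborel. integrand \<theta> \<epsilon> A x (- y)) = (LINT y|lborel. - (osc_kernel \<epsilon> (A * R powr \<epsilon> * \<theta>) R y * f (x + y)))"
      unfolding set_lebesgue_integral_def
    proof (intro Bochner_Integration.integral_cong refl)
      fix y
      show "indicator {R<..q * R} y *\<^sub>R integrand \<theta> \<epsilon> A x (- y) = - (osc_kernel \<epsilon> (A * R powr \<epsilon> * \<theta>) R y * f (x + y))"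
      proof (cases "y \<in> {R<..q * R}")
        case True
        then have "0 < y" using R by auto
        have eq: "A * R powr \<epsilon> * \<theta> * (y / R) powr \<epsilon> = A * \<theta> * y powr \<epsilon>"
          using pw[OF \<open>0 < y\<close>] by (metis mult.assoc mult.commute)
        show ?thesis using True \<open>0 < y\<close>
          by (simp only: osc_kernel_def eq) (simp add: integrand_def phase_factor_def q_def del: of_real_mult)
      qed (auto simp: osc_kernel_def q_def)
    qed
    also have "\<dots> = - (LINT y|lborel. osc_kernel \<epsilon> (A * R powr \<epsilon> * \<theta>) R y * f (x + y))" by simp
    also have "(LINT y|lborel. osc_kernel \<epsilon> (A * R powr \<epsilon> * \<theta>) R y * f (x + y)) = (LINT y|lborel. osc_kernel \<epsilon> (A * R powr \<epsilon> * \<theta>) R ((-1) * y) * f (x - y))"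
      by (subst lborel_integral_real_affine[of "-1" _ 0]) auto
    finally show ?thesis .
  qed
  have "truncated \<theta> \<epsilon> A x R - truncated \<theta> \<epsilon> A x (q * R)
      = (LINT y:{R<..q * R}|lborel. integrand \<theta> \<epsilon> A x y) + (LINT y:{R<..q * R}|lborel. integrand \<theta> \<epsilon> A x (- y))"
    unfolding td(1) using R by (intro set_integral_annulus td(2)) auto
  then have "norm (truncated \<theta> \<epsilon> A x R - truncated \<theta> \<epsilon> A x (q * R))
      \<le> norm (LINT y|lborel. osc_kernel \<epsilon> (A * R powr \<epsilon>) R (1 * y) * f (x - y)) + norm (LINT y|lborel. osc_kernel \<epsilon> (A * R powr \<epsilon> * \<theta>) R ((-1) * y) * f (x - y))"
    unfolding 1 2 by (simp only: add_uminus_conv_diff norm_triangle_ineq4)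
  then have "ennreal (norm (truncated \<theta> \<epsilon> A x R - truncated \<theta> \<epsilon> A x (q * R)))
      \<le> ennreal (norm (LINT y|lborel. osc_kernel \<epsilon> (A * R powr \<epsilon>) R (1 * y) * f (x - y))) + ennreal (norm (LINT y|lborel. osc_kernel \<epsilon> (A * R powr \<epsilon> * \<theta>) R ((-1) * y) * f (x - y)))"
    by (simp only: ennreal_leI norm_ge_zero flip: ennreal_plus)
  also have "\<dots> \<le> osc_maxop \<epsilon> (A * R powr \<epsilon>) 1 f x + osc_maxop \<epsilon> (A * R powr \<epsilon> * \<theta>) (-1) f x"
    using R by (intro add_mono osc_average_le) auto
  finally show ?thesis unfolding q_def .
qed

end

section \<open>Summation over the annuli\<close>

lemma ennreal_norm_sum_le:
  "ennreal (norm (\<Sum>n\<in>I. g n)) \<le> (\<Sum>n\<in>I. ennreal (norm (g n :: 'a :: real_normed_vector)))"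
proof -
  have "ennreal (norm (\<Sum>n\<in>I. g n)) \<le> ennreal (\<Sum>n\<in>I. norm (g n))"
    by (intro ennreal_leI norm_sum)
  also have "\<dots> = (\<Sum>n\<in>I. ennreal (norm (g n)))" by (simp add: sum_ennreal)
  finally show ?thesis .
qed

lemma ennreal_norm_add_le:
  "ennreal (norm (a + b :: 'a :: real_normed_vector)) \<le> ennreal (norm a) + ennreal (norm b)"
  by (simp add: ennreal_leI norm_triangle_ineq flip: ennreal_plus)

context lipschitz_L1
begin

text \<open>A has either sign, and on the negative half-line \<theta> may flip the sign of the
  frequency. Adding all four combinations of sign and half-line gives a bound that mentions neither
  A nor \<theta>.\<close>

definition osc_level :: "real \<Rightarrow> nat \<Rightarrow> real \<Rightarrow> ennreal" where
  "osc_level \<epsilon> n x = (osc_maxop \<epsilon> (2 ^ n) 1 f x + osc_maxop \<epsilon> (- (2 ^ n)) 1 f x)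
    + (osc_maxop \<epsilon> (2 ^ n) (-1) f x + osc_maxop \<epsilon> (- (2 ^ n)) (-1) f x)"

lemma high_annulus_le_osc_level:
  assumes R: "0 < R" and \<theta>: "\<theta> = 1 \<or> \<theta> = -1" and n: "\<bar>A\<bar> * R powr \<epsilon> = 2 ^ n"
  shows "ennreal (norm (truncated \<theta> \<epsilon> A x R - truncated \<theta> \<epsilon> A x (2 powr (1 / \<bar>\<epsilon>\<bar>) * R))) \<le> osc_level \<epsilon> n x"
proof -
  have N: "A * R powr \<epsilon> = 2 ^ n \<or> A * R powr \<epsilon> = - (2 ^ n)" using n by (auto simp: abs_if split: if_splits)
  have 1: "osc_maxop \<epsilon> (A * R powr \<epsilon>) 1 f x \<le> osc_maxop \<epsilon> (2 ^ n) 1 f x + osc_maxop \<epsilon> (- (2 ^ n)) 1 f x"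
    using N by (auto simp: add_increasing add_increasing2)
  have "A * R powr \<epsilon> * \<theta> = 2 ^ n \<or> A * R powr \<epsilon> * \<theta> = - (2 ^ n)" using N \<theta> by auto
  then have 2: "osc_maxop \<epsilon> (A * R powr \<epsilon> * \<theta>) (-1) f x \<le> osc_maxop \<epsilon> (2 ^ n) (-1) f x + osc_maxop \<epsilon> (- (2 ^ n)) (-1) f x"
    by (auto simp: add_increasing add_increasing2)
  show ?thesis
    unfolding osc_level_def by (rule order_trans[OF high_annulus_le[OF R \<theta>] add_mono[OF 1 2]])
qed

text \<open>Injectivity of m means that each level is used at most once, so the sum stays below the
  full series for every J.\<close>

lemma high_sum_le:
  fixes R :: "nat \<Rightarrow> real" and m :: "nat \<Rightarrow> nat"
  assumes R: "\<And>n. 0 < R n" and \<theta>: "\<theta> = 1 \<or> \<theta> = -1" and m: "inj m" "\<And>n. \<bar>A\<bar> * R n powr \<epsilon> = 2 ^ m n"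
  shows "ennreal (norm (\<Sum>n<J. truncated \<theta> \<epsilon> A x (R n) - truncated \<theta> \<epsilon> A x (2 powr (1 / \<bar>\<epsilon>\<bar>) * R n))) \<le> (\<Sum>n. osc_level \<epsilon> n x)"
proof -
  have "ennreal (norm (\<Sum>n<J. truncated \<theta> \<epsilon> A x (R n) - truncated \<theta> \<epsilon> A x (2 powr (1 / \<bar>\<epsilon>\<bar>) * R n)))
    \<le> (\<Sum>n<J. osc_level \<epsilon> (m n) x)"
    by (intro order_trans[OF ennreal_norm_sum_le] sum_mono high_annulus_le_osc_level R \<theta> m)
  also have "\<dots> = (\<Sum>n\<in>m ` {..<J}. osc_level \<epsilon> n x)"
    using m(1) by (subst sum.reindex) (auto intro: inj_on_subset)
  also have "\<dots> \<le> (\<Sum>n. osc_level \<epsilon> n x)" by (rule sum_le_suminf[OF summableI finite_imageI[OF finite_lessThan]]) auto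
  finally show ?thesis .
qed

text \<open>The phase deviations (1/2)^n sum to less than 2, and \<open>low_annulus_le\<close>
  contributes the 4 that makes 8.\<close>

lemma low_sum_le:
  fixes R :: "nat \<Rightarrow> real"
  assumes R: "\<And>n. 0 < R n" "1 \<le> q" and \<theta>: "\<theta> = 1 \<or> \<theta> = -1"
    and t: "\<And>n y. R n < \<bar>y\<bar> \<Longrightarrow> \<bar>y\<bar> \<le> q * R n \<Longrightarrow> \<bar>A\<bar> * \<bar>y\<bar> powr \<epsilon> \<le> (1 / 2) ^ n"
  shows "ennreal (norm (\<Sum>n<J. (truncated \<theta> \<epsilon> A x (R n) - truncated \<theta> \<epsilon> A x (q * R n))
      - (truncated \<theta> \<epsilon> 0 x (R n) - truncated \<theta> \<epsilon> 0 x (q * R n)))) \<le> ennreal (8 * (1 + q\<^sup>2)) * abs_poisson_maxop x"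
proof -
  have "ennreal (norm (\<Sum>n<J. (truncated \<theta> \<epsilon> A x (R n) - truncated \<theta> \<epsilon> A x (q * R n))
      - (truncated \<theta> \<epsilon> 0 x (R n) - truncated \<theta> \<epsilon> 0 x (q * R n)))) \<le> (\<Sum>n<J. ennreal ((1 / 2) ^ n * (1 + q\<^sup>2)) * (4 * abs_poisson_maxop x))"
    by (intro order_trans[OF ennreal_norm_sum_le] sum_mono low_annulus_le R \<theta> t) auto
  also have "\<dots> = ennreal (\<Sum>n<J. (1 / 2) ^ n * (1 + q\<^sup>2)) * (4 * abs_poisson_maxop x)"
  proof -
    have "(\<Sum>n<J. ennreal ((1 / 2) ^ n * (1 + q\<^sup>2))) = ennreal (\<Sum>n<J. (1 / 2) ^ n * (1 + q\<^sup>2))"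
      by (rule sum_ennreal) auto
    then show ?thesis by (simp only: sum_distrib_right[symmetric])
  qed
  also have "(\<Sum>n<J. (1 / 2) ^ n * (1 + q\<^sup>2)) = (2 - 2 * (1 / 2) ^ J) * (1 + q\<^sup>2)"
    by (simp add: sum_distrib_right[symmetric] sum_gp_strict)
  also have "ennreal ((2 - 2 * (1 / 2) ^ J) * (1 + q\<^sup>2)) * (4 * abs_poisson_maxop x) \<le> ennreal (2 * (1 + q\<^sup>2)) * (4 * abs_poisson_maxop x)"
    by (intro mult_right_mono ennreal_leI) auto
  also have "\<dots> = ennreal (8 * (1 + q\<^sup>2)) * abs_poisson_maxop x"
    using ennreal_mult[of 4 "2 * (1 + q\<^sup>2)"] by (simp add: mult_ac)
  finally show ?thesis .
qed

text \<open>Free of A and \<theta>, so a single estimate serves every A in both suprema.\<close>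

definition majorant :: "real \<Rightarrow> real \<Rightarrow> ennreal" where
  "majorant \<epsilon> x = (\<Sum>n. osc_level \<epsilon> n x) + (2 * conj_poisson_maxop f x
     + ennreal (4 + 8 * (1 + (2 powr (1 / \<bar>\<epsilon>\<bar>))\<^sup>2)) * abs_poisson_maxop x)"

lemma hilbert_part_le: 
  assumes "0 < a" "0 < b"
  shows "ennreal (norm (truncated \<theta> \<epsilon> 0 x a - truncated \<theta> \<epsilon> 0 x b)) \<le> 2 * conj_poisson_maxop f x + 4 * abs_poisson_maxop x"
proof -
  have "ennreal (norm (truncated \<theta> \<epsilon> 0 x a - truncated \<theta> \<epsilon> 0 x b)) \<le> ennreal (norm (truncated \<theta> \<epsilon> 0 x a)) + ennreal (norm (truncated \<theta> \<epsilon> 0 x b))"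
    using ennreal_norm_add_le[of "truncated \<theta> \<epsilon> 0 x a" "- truncated \<theta> \<epsilon> 0 x b"] by simp
  also have "\<dots> \<le> (conj_poisson_maxop f x + 2 * abs_poisson_maxop x) + (conj_poisson_maxop f x + 2 * abs_poisson_maxop x)"
    by (intro add_mono truncated_hilbert_le assms)
  also have "\<dots> = 2 * (conj_poisson_maxop f x + 2 * abs_poisson_maxop x)" by (simp only: mult_2)
  also have "\<dots> = 2 * conj_poisson_maxop f x + 4 * abs_poisson_maxop x"
    by (simp add: distrib_left mult.assoc[symmetric] flip: ennreal_numeral ennreal_mult)
  finally show ?thesis .
qed

text \<open>With the phase replaced by 1 the sum must be telescoped to two truncated Hilbert
  transforms, since bounds for the single annuli carry no decay. The annuli lie inside or outside
  the critical radius according to the sign of \<epsilon>; \<open>tel\<close> lets one argument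
  serve both cases.\<close>

lemma low_total_le:
  fixes R :: "nat \<Rightarrow> real"
  assumes R: "\<And>n. 0 < R n" "1 \<le> q" and \<theta>: "\<theta> = 1 \<or> \<theta> = -1"
    and t: "\<And>n y. R n < \<bar>y\<bar> \<Longrightarrow> \<bar>y\<bar> \<le> q * R n \<Longrightarrow> \<bar>A\<bar> * \<bar>y\<bar> powr \<epsilon> \<le> (1 / 2) ^ n"
    and tel: "(\<Sum>n<J. truncated \<theta> \<epsilon> 0 x (R n) - truncated \<theta> \<epsilon> 0 x (q * R n)) = truncated \<theta> \<epsilon> 0 x a - truncated \<theta> \<epsilon> 0 x b"
    and ab: "0 < a" "0 < b"
  shows "ennreal (norm (\<Sum>n<J. truncated \<theta> \<epsilon> A x (R n) - truncated \<theta> \<epsilon> A x (q * R n)))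
    \<le> 2 * conj_poisson_maxop f x + ennreal (4 + 8 * (1 + q\<^sup>2)) * abs_poisson_maxop x"
proof -
  let ?T = "\<lambda>A n. truncated \<theta> \<epsilon> A x (R n) - truncated \<theta> \<epsilon> A x (q * R n)"
  have "(\<Sum>n<J. ?T A n) = (\<Sum>n<J. ?T A n - ?T 0 n) + (\<Sum>n<J. ?T 0 n)"
    by (simp add: sum_subtractf)
  then have "ennreal (norm (\<Sum>n<J. ?T A n)) \<le> ennreal (norm (\<Sum>n<J. ?T A n - ?T 0 n)) + ennreal (norm (\<Sum>n<J. ?T 0 n))"
    by (simp only: ennreal_norm_add_le)
  also have "\<dots> \<le> ennreal (8 * (1 + q\<^sup>2)) * abs_poisson_maxop x + (2 * conj_poisson_maxop f x + 4 * abs_poisson_maxop x)"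
    unfolding tel by (intro add_mono low_sum_le hilbert_part_le assms)
  also have "\<dots> = 2 * conj_poisson_maxop f x + (4 * abs_poisson_maxop x + ennreal (8 * (1 + q\<^sup>2)) * abs_poisson_maxop x)"
    by (simp only: add_ac)
  also have "4 * abs_poisson_maxop x + ennreal (8 * (1 + q\<^sup>2)) * abs_poisson_maxop x = ennreal (4 + 8 * (1 + q\<^sup>2)) * abs_poisson_maxop x"
  proof -
    have "ennreal (4 + c) = 4 + ennreal c" if "0 \<le> c" for c
      using ennreal_plus[of 4 c] that by simp
    from this[of "8 * (1 + q\<^sup>2)"] have "ennreal (4 + 8 * (1 + q\<^sup>2)) = 4 + ennreal (8 * (1 + q\<^sup>2))" by simp
    then show ?thesis by (simp only: distrib_right)
  qed
  finally show ?thesis .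
qed

text \<open>At the radius r = |A|^(-1/\<epsilon>) the modulus of the phase is 1, and annuli of ratio
  q = 2^(1/|\<epsilon>|) on either side double or halve it. Whether q^\<epsilon> is 2 or 1/2 decides
  which side oscillates. The bound does not depend on J, so letting J grow gives the principal
  value, the outer truncation tending to 0.\<close>

lemma pv_le_majorant:
  assumes \<epsilon>: "\<epsilon> \<noteq> 0" and \<theta>: "\<theta> = 1 \<or> \<theta> = -1"
    and l: "(truncated \<theta> \<epsilon> A x \<longlongrightarrow> l) (at_right 0)"
  shows "ennreal (norm l) \<le> majorant \<epsilon> x"
proof (cases "A = 0")
  \<comment> \<open>For A = 0 no radius balances the phase; only truncated Hilbert transforms are
    left.\<close>
  case True
  have "(\<lambda>n. truncated \<theta> \<epsilon> A x (inverse (real (Suc n)))) \<longlonglongrightarrow> l"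
    by (rule filterlim_compose[OF l])
      (use LIMSEQ_inverse_real_of_nat in \<open>auto simp: filterlim_at simp del: of_nat_Suc\<close>)
  then have "(\<lambda>n. ennreal (norm (truncated \<theta> \<epsilon> A x (inverse (real (Suc n)))))) \<longlonglongrightarrow> ennreal (norm l)"
    by (intro tendsto_ennrealI tendsto_norm)
  then have "ennreal (norm l) \<le> conj_poisson_maxop f x + 2 * abs_poisson_maxop x"
    by (rule LIMSEQ_le_const2) (auto simp: True intro!: exI[of _ 0] truncated_hilbert_le)
  also have "\<dots> \<le> 0 + (2 * conj_poisson_maxop f x + ennreal (4 + 8 * (1 + (2 powr (1 / \<bar>\<epsilon>\<bar>))\<^sup>2)) * abs_poisson_maxop x)"
  proof -
    have "1 * conj_poisson_maxop f x \<le> 2 * conj_poisson_maxop f x" by (intro mult_right_mono) auto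
    moreover have "ennreal 2 * abs_poisson_maxop x \<le> ennreal (4 + 8 * (1 + (2 powr (1 / \<bar>\<epsilon>\<bar>))\<^sup>2)) * abs_poisson_maxop x"
      by (intro mult_right_mono ennreal_leI) (auto intro: order_trans[of _ 4])
    ultimately show ?thesis by (simp add: add_mono)
  qed
  also have "\<dots> \<le> majorant \<epsilon> x" unfolding majorant_def by (intro add_mono) auto
  finally show ?thesis .
next
  case A: False
  define q where "q = 2 powr (1 / \<bar>\<epsilon>\<bar>)"
  define r where "r = \<bar>A\<bar> powr (- 1 / \<epsilon>)"
  have r: "0 < r" using A by (simp add: r_def)
  have rA: "\<bar>A\<bar> * r powr \<epsilon> = 1"
  proof -
    have "r powr \<epsilon> = \<bar>A\<bar> powr (- 1)" using \<epsilon> by (simp only: r_def powr_powr) simp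
    then show ?thesis using A by (simp add: powr_neg_one)
  qed
  have q1: "1 < q" unfolding q_def using \<epsilon> by (intro gr_one_powr) auto
  let ?T = "truncated \<theta> \<epsilon> A x"
  let ?out = "\<lambda>n. r * q ^ n" and ?inn = "\<lambda>n. r / q ^ Suc n"
  have pos: "0 < ?out n" "0 < ?inn n" "0 < r / q ^ n" for n using r q1 by auto
  have out_tel: "(\<Sum>n<J. truncated \<theta> \<epsilon> C x (?out n) - truncated \<theta> \<epsilon> C x (q * ?out n)) = truncated \<theta> \<epsilon> C x r - truncated \<theta> \<epsilon> C x (r * q ^ J)" for C J
    using sum_lessThan_telescope'[of "\<lambda>n. truncated \<theta> \<epsilon> C x (r * q ^ n)" J] by (simp add: mult_ac)
  have inn_tel: "(\<Sum>n<J. truncated \<theta> \<epsilon> C x (?inn n) - truncated \<theta> \<epsilon> C x (q * ?inn n)) = truncated \<theta> \<epsilon> C x (r / q ^ J) - truncated \<theta> \<epsilon> C x r" for C J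
  proof -
    have "q * ?inn n = r / q ^ n" for n using q1 by simp
    then show ?thesis using sum_lessThan_telescope[of "\<lambda>n. truncated \<theta> \<epsilon> C x (r / q ^ n)" J] by simp
  qed
  have main: "ennreal (norm (?T (r / q ^ J) - ?T (r * q ^ J))) \<le> majorant \<epsilon> x" for J
  proof -
    have sum: "?T (r / q ^ J) - ?T (r * q ^ J) = (\<Sum>n<J. ?T (?inn n) - ?T (q * ?inn n)) + (\<Sum>n<J. ?T (?out n) - ?T (q * ?out n))"
      unfolding out_tel inn_tel by simp
    have qe: "q powr \<epsilon> = (if 0 < \<epsilon> then 2 else 1 / 2)"
      using \<epsilon> by (auto simp: q_def powr_powr powr_minus_divide)
    have outp: "\<bar>A\<bar> * ?out n powr \<epsilon> = (q powr \<epsilon>) ^ n" for n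
    proof -
      have "\<bar>A\<bar> * ?out n powr \<epsilon> = (\<bar>A\<bar> * r powr \<epsilon>) * (q ^ n) powr \<epsilon>"
        using r q1 by (simp add: powr_mult)
      also have "(q ^ n) powr \<epsilon> = (q powr \<epsilon>) ^ n"
        using q1 by (simp add: powr_realpow[symmetric] powr_powr mult.commute)
      finally show ?thesis by (simp add: rA)
    qed
    have innp: "\<bar>A\<bar> * ?inn n powr \<epsilon> = 1 / (q powr \<epsilon>) ^ Suc n" for n
    proof -
      have "\<bar>A\<bar> * ?inn n powr \<epsilon> = (\<bar>A\<bar> * r powr \<epsilon>) / (q ^ Suc n) powr \<epsilon>"
        using r q1 by (simp add: powr_divide del: power_Suc)
      also have "(q ^ Suc n) powr \<epsilon> = (q powr \<epsilon>) ^ Suc n"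
        using q1 by (simp add: powr_realpow[symmetric] powr_powr mult.commute del: power_Suc)
      finally show ?thesis by (simp add: rA)
    qed
    have "ennreal (norm (\<Sum>n<J. ?T (?inn n) - ?T (q * ?inn n))) + ennreal (norm (\<Sum>n<J. ?T (?out n) - ?T (q * ?out n))) \<le> majorant \<epsilon> x"
    proof (cases "0 < \<epsilon>")
      case True
      have "ennreal (norm (\<Sum>n<J. ?T (?out n) - ?T (q * ?out n))) \<le> (\<Sum>n. osc_level \<epsilon> n x)"
        by (rule high_sum_le[where m="\<lambda>n. n" and \<epsilon>=\<epsilon>, folded q_def, OF pos(1) \<theta>])
          (auto simp: outp qe True inj_def)
      moreover have "ennreal (norm (\<Sum>n<J. ?T (?inn n) - ?T (q * ?inn n))) \<le> 2 * conj_poisson_maxop f x + ennreal (4 + 8 * (1 + q\<^sup>2)) * abs_poisson_maxop x"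
      proof (rule low_total_le[OF pos(2) _ \<theta> _ inn_tel])
        fix n y assume y: "?inn n < \<bar>y\<bar>" "\<bar>y\<bar> \<le> q * ?inn n"
        \<comment> \<open>On a low annulus the phase is largest at the edge nearest to r: the outer
          edge here, the inner edge in the case of negative \<epsilon> below.\<close>
        have "\<bar>A\<bar> * \<bar>y\<bar> powr \<epsilon> \<le> \<bar>A\<bar> * (q * ?inn n) powr \<epsilon>"
          using y True by (intro mult_left_mono powr_mono2) auto
        also have "\<dots> = q powr \<epsilon> * (\<bar>A\<bar> * ?inn n powr \<epsilon>)"
          using q1 pos(2)[of n] by (simp only: powr_mult mult.left_commute)
        also have "\<dots> = (1 / 2) ^ n" unfolding innp qe using True by (simp add: power_divide)
        finally show "\<bar>A\<bar> * \<bar>y\<bar> powr \<epsilon> \<le> (1 / 2) ^ n" .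
      qed (use q1 r in auto)
      ultimately show ?thesis unfolding majorant_def q_def[symmetric]
        by (subst add.commute) (rule add_mono)
    next
      case False
      \<comment> \<open>For \<epsilon> < 0 the phase grows towards the origin. The annulus with
        index n starts at r / q^(n+1), where the phase has modulus 2^(n+1), so its level is
        \<open>Suc n\<close> and not n.\<close>
      have "ennreal (norm (\<Sum>n<J. ?T (?inn n) - ?T (q * ?inn n))) \<le> (\<Sum>n. osc_level \<epsilon> n x)"
        by (rule high_sum_le[where m=Suc and \<epsilon>=\<epsilon>, folded q_def, OF pos(2) \<theta>], simp, unfold innp qe)
          (use False in \<open>simp add: power_divide\<close>)
      moreover have "ennreal (norm (\<Sum>n<J. ?T (?out n) - ?T (q * ?out n))) \<le> 2 * conj_poisson_maxop f x + ennreal (4 + 8 * (1 + q\<^sup>2)) * abs_poisson_maxop x"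
      proof (rule low_total_le[OF pos(1) _ \<theta> _ out_tel])
        fix n y assume y: "?out n < \<bar>y\<bar>" "\<bar>y\<bar> \<le> q * ?out n"
        have "\<bar>A\<bar> * \<bar>y\<bar> powr \<epsilon> \<le> \<bar>A\<bar> * ?out n powr \<epsilon>"
          using y False pos(1)[of n] by (intro mult_left_mono powr_mono2') auto
        also have "\<dots> = (1 / 2) ^ n" unfolding outp qe using False by simp
        finally show "\<bar>A\<bar> * \<bar>y\<bar> powr \<epsilon> \<le> (1 / 2) ^ n" .
      qed (use q1 r in auto)
      ultimately show ?thesis unfolding majorant_def q_def[symmetric]
        by (rule add_mono)
    qed
    then show ?thesis unfolding sum by (rule order_trans[OF ennreal_norm_add_le])
  qed
  have "filterlim (\<lambda>J. r / q ^ J) (at_right 0) sequentially"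
  proof -
    have "(\<lambda>J. r * (1 / q) ^ J) \<longlonglongrightarrow> r * 0" using q1 by (intro tendsto_intros LIMSEQ_power_zero) auto
    then show ?thesis using r q1 by (auto simp: filterlim_at power_divide)
  qed
  then have 1: "(\<lambda>J. ?T (r / q ^ J)) \<longlonglongrightarrow> l" by (rule filterlim_compose[OF l])
  have "filterlim (\<lambda>J. r * q ^ J) at_top sequentially"
  proof (rule filterlim_tendsto_pos_mult_at_top[OF tendsto_const r])
    have "filterlim (\<lambda>J. norm (q ^ J)) at_top sequentially"
      using q1 by (intro filterlim_at_infinity_imp_norm_at_top filterlim_realpow_sequentially_gt1) auto
    then show "filterlim (\<lambda>J. q ^ J) at_top sequentially" using q1 by simp
  qed
  then have 2: "(\<lambda>J. ?T (r * q ^ J)) \<longlonglongrightarrow> 0" by (rule filterlim_compose[OF truncated_at_top])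
  have "(\<lambda>J. ennreal (norm (?T (r / q ^ J) - ?T (r * q ^ J)))) \<longlonglongrightarrow> ennreal (norm (l - 0))"
    by (intro tendsto_ennrealI tendsto_norm tendsto_diff 1 2)
  then have "ennreal (norm (l - 0)) \<le> majorant \<epsilon> x"
    by (rule LIMSEQ_le_const2) (use main in auto)
  then show ?thesis by simp
qed

lemma pv_integral_le_majorant:
  assumes "\<epsilon> \<noteq> 0" "\<theta> = 1 \<or> \<theta> = -1"
  shows "ennreal (norm (pv_integral (integrand \<theta> \<epsilon> A x))) \<le> majorant \<epsilon> x"
  using truncated_convergent[OF assms(2,1), of A x] pv_integral_eq pv_le_majorant[OF assms] by metis

lemma carleson_le_majorant:
  assumes "\<epsilon> \<noteq> 0"
  shows "carleson_even \<epsilon> f x \<le> majorant \<epsilon> x" "carleson_odd \<epsilon> f x \<le> majorant \<epsilon> x"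
proof -
  have "(\<lambda>y. exp (\<i> * complex_of_real (A * \<bar>y\<bar> powr \<epsilon>)) * f (x - y) / complex_of_real y) = integrand 1 \<epsilon> A x" for A
    by (auto simp: integrand_def phase_factor_def)
  then show "carleson_even \<epsilon> f x \<le> majorant \<epsilon> x"
    unfolding carleson_even_def using pv_integral_le_majorant[OF assms] by (auto intro!: SUP_least)
  have "(\<lambda>y. exp (\<i> * complex_of_real (A * sgn y * \<bar>y\<bar> powr \<epsilon>)) * f (x - y) / complex_of_real y) = integrand (-1) \<epsilon> A x" for A
    \<comment> \<open>At y = 0 the sign function is 0 while \<open>phase_factor\<close> assigns
      \<theta>; both integrands vanish there because division by 0 yields 0.\<close>
    by (rule ext, rename_tac y, case_tac "y = 0") (auto simp: integrand_def phase_factor_def sgn_if)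
  then show "carleson_odd \<epsilon> f x \<le> majorant \<epsilon> x"
    unfolding carleson_odd_def using pv_integral_le_majorant[OF assms] by (auto intro!: SUP_least)
qed

end

section \<open>The \<open>L\<^sup>2\<close> bound\<close>

lemma ennreal_add_power2_le: "(a + b)\<^sup>2 \<le> 2 * a\<^sup>2 + 2 * (b\<^sup>2 :: ennreal)"
proof (cases "a = \<infinity> \<or> b = \<infinity>")
  case False
  then obtain x y where [simp]: "a = ennreal x" "b = ennreal y" and "0 \<le> x" "0 \<le> y"
    by (metis ennreal_cases infinity_ennreal_def)
  have "(x + y)\<^sup>2 \<le> 2 * x\<^sup>2 + 2 * y\<^sup>2"
    using sum_squares_bound[of x y] by (simp add: power2_sum)
  then have "ennreal ((x + y)\<^sup>2) \<le> ennreal (2 * x\<^sup>2 + 2 * y\<^sup>2)" by (rule ennreal_leI)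
  also have "\<dots> = 2 * a\<^sup>2 + 2 * b\<^sup>2"
    using \<open>0 \<le> x\<close> \<open>0 \<le> y\<close> by (simp add: ennreal_power ennreal_mult ennreal_plus)
  also have "ennreal ((x + y)\<^sup>2) = (a + b)\<^sup>2"
    using \<open>0 \<le> x\<close> \<open>0 \<le> y\<close> by (simp add: ennreal_power flip: ennreal_plus)
  finally show ?thesis .
qed (auto simp: power2_eq_square ennreal_mult_top)

text \<open>Cauchy-Schwarz for the counting measure, with a(n) written as v^n times v^(-n) a(n). The
  squares on the right can be integrated term by term, which replaces Minkowski's inequality for
  infinitely many functions.\<close>

lemma ennreal_suminf_power2_le:
  fixes a :: "nat \<Rightarrow> ennreal" and v :: real
  assumes "0 < v"
  shows "(\<Sum>n. a n)\<^sup>2 \<le> (\<Sum>n. ennreal ((v\<^sup>2) ^ n)) * (\<Sum>n. ennreal ((1 / v\<^sup>2) ^ n) * (a n)\<^sup>2)"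
proof -
  have 1: "ennreal (v ^ n) * (ennreal ((1 / v) ^ n) * a n) = a n" for n
  proof -
    have "ennreal (v ^ n) * ennreal ((1 / v) ^ n) = 1"
      using assms by (simp add: power_divide flip: ennreal_mult)
    then show ?thesis by (simp add: mult.assoc[symmetric])
  qed
  have sq: "(w ^ n)\<^sup>2 = (w\<^sup>2) ^ n" for w :: real and n
    by (metis power_mult mult.commute)
  have 2: "(ennreal (v ^ n))\<^sup>2 = ennreal ((v\<^sup>2) ^ n)" for n
    using assms by (simp only: ennreal_power zero_le_power less_imp_le sq)
  have 3: "(ennreal ((1 / v) ^ n) * a n)\<^sup>2 = ennreal ((1 / v\<^sup>2) ^ n) * (a n)\<^sup>2" for n
  proof -
    have "(ennreal ((1 / v) ^ n))\<^sup>2 = ennreal (((1 / v)\<^sup>2) ^ n)"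
      using assms by (subst ennreal_power) (simp_all add: sq)
    then show ?thesis by (simp only: power_mult_distrib power_divide power_one)
  qed
  have "(\<integral>\<^sup>+n. ennreal (v ^ n) * (ennreal ((1 / v) ^ n) * a n) \<partial>count_space UNIV)\<^sup>2
    \<le> (\<integral>\<^sup>+n. (ennreal (v ^ n))\<^sup>2 \<partial>count_space UNIV) * (\<integral>\<^sup>+n. (ennreal ((1 / v) ^ n) * a n)\<^sup>2 \<partial>count_space UNIV)"
    by (rule Cauchy_Schwarz_nn_integral) simp_all
  then show ?thesis unfolding 1 2 3 nn_integral_count_space_nat .
qed

context lipschitz_L1
begin

lemma L2_finite: "(\<integral>\<^sup>+x. ennreal ((norm (f x))\<^sup>2) \<partial>lborel) < \<infinity>"
proof -
  have "(\<integral>\<^sup>+x. ennreal ((norm (f x))\<^sup>2) \<partial>lborel) \<le> (\<integral>\<^sup>+x. ennreal B * ennreal (norm (f x)) \<partial>lborel)"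
    using bound B_nonneg
    by (intro nn_integral_mono) (auto simp: power2_eq_square intro!: mult_right_mono simp flip: ennreal_mult)
  also have "\<dots> = ennreal B * (\<integral>\<^sup>+x. ennreal (norm (f x)) \<partial>lborel)" by (simp add: nn_integral_cmult)
  also have "\<dots> < \<infinity>" using int by (simp add: integrable_iff_bounded ennreal_mult_less_top)
  finally show ?thesis .
qed

text \<open>For |N| = 2^n the \<tau> of \<open>osc_maxop_bound\<close> is (u^2)^n = 2^(-n/4),
  because u^8 = 1/2. The factor 16 is the number of operators, four, times the 4 in the inequality
  for the square of a sum of four terms.\<close>

lemma osc_level_bound:
  assumes \<delta>: "0 < \<delta>" "\<delta> < 1" and \<epsilon>: "\<delta> < \<bar>\<epsilon>\<bar>" "\<delta> < \<bar>\<epsilon> - 1\<bar>" and u: "0 < u" "u < 1" "u ^ 8 = 1 / 2"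
  shows "(\<integral>\<^sup>+x. (osc_level \<epsilon> n x)\<^sup>2 \<partial>lborel)
    \<le> ennreal (16 * (108 * (32 * (2 powr (1 / \<delta>)) ^ 4 / \<delta> * (u\<^sup>2) ^ n))) * (\<integral>\<^sup>+x. ennreal ((norm (f x))\<^sup>2) \<partial>lborel)"
proof -
  let ?\<phi> = "\<integral>\<^sup>+x. ennreal ((norm (f x))\<^sup>2) \<partial>lborel"
  let ?c = "108 * (32 * (2 powr (1 / \<delta>)) ^ 4 / \<delta> * (u\<^sup>2) ^ n)"
  have [measurable]: "osc_maxop \<epsilon> N s f \<in> borel_measurable lborel" for N s
    by (rule osc_maxop_measurable) simp
  have b: "(\<integral>\<^sup>+x. (osc_maxop \<epsilon> N s f x)\<^sup>2 \<partial>lborel) \<le> ennreal ?c * ?\<phi>"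
    if "\<bar>N\<bar> = 2 ^ n" "s = 1 \<or> s = -1" for N s
  proof (rule osc_maxop_bound[OF \<delta> \<epsilon> that(2) _ _ _ _ L2_finite])
    show "((u\<^sup>2) ^ n) ^ 4 * \<bar>N\<bar> = 1"
    proof -
      have "((u\<^sup>2) ^ n) ^ 4 = (u ^ 8) ^ n" by (simp flip: power_mult add: mult_ac)
      then show ?thesis using that(1) u(3) by (simp add: power_divide)
    qed
    have "u\<^sup>2 \<le> 1" using u by (simp add: power_le_one)
    then show "(u\<^sup>2) ^ n \<le> 1" by (rule power_le_one[OF zero_le_power2])
  qed (use u in auto)
  have "(\<integral>\<^sup>+x. (osc_level \<epsilon> n x)\<^sup>2 \<partial>lborel) \<le> (\<integral>\<^sup>+x. 4 * ((osc_maxop \<epsilon> (2 ^ n) 1 f x)\<^sup>2 + (osc_maxop \<epsilon> (- (2 ^ n)) 1 f x)\<^sup>2)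
    + 4 * ((osc_maxop \<epsilon> (2 ^ n) (-1) f x)\<^sup>2 + (osc_maxop \<epsilon> (- (2 ^ n)) (-1) f x)\<^sup>2) \<partial>lborel)"
  proof (intro nn_integral_mono)
    fix x
    have four: "((a + b) + (c + d))\<^sup>2 \<le> 4 * (a\<^sup>2 + b\<^sup>2) + 4 * (c\<^sup>2 + d\<^sup>2)" for a b c d :: ennreal
    proof -
      have "((a + b) + (c + d))\<^sup>2 \<le> 2 * (a + b)\<^sup>2 + 2 * (c + d)\<^sup>2" by (rule ennreal_add_power2_le)
      also have "\<dots> \<le> 2 * (2 * a\<^sup>2 + 2 * b\<^sup>2) + 2 * (2 * c\<^sup>2 + 2 * d\<^sup>2)"
        by (intro add_mono mult_left_mono ennreal_add_power2_le) auto
      also have "\<dots> = 4 * (a\<^sup>2 + b\<^sup>2) + 4 * (c\<^sup>2 + d\<^sup>2)"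
        by (simp add: distrib_left mult.assoc[symmetric] flip: ennreal_numeral ennreal_mult)
      finally show ?thesis .
    qed
    show "(osc_level \<epsilon> n x)\<^sup>2 \<le> 4 * ((osc_maxop \<epsilon> (2 ^ n) 1 f x)\<^sup>2 + (osc_maxop \<epsilon> (- (2 ^ n)) 1 f x)\<^sup>2)
      + 4 * ((osc_maxop \<epsilon> (2 ^ n) (-1) f x)\<^sup>2 + (osc_maxop \<epsilon> (- (2 ^ n)) (-1) f x)\<^sup>2)"
      unfolding osc_level_def by (rule four)
  qed
  also have "\<dots> = 4 * ((\<integral>\<^sup>+x. (osc_maxop \<epsilon> (2 ^ n) 1 f x)\<^sup>2 \<partial>lborel) + (\<integral>\<^sup>+x. (osc_maxop \<epsilon> (- (2 ^ n)) 1 f x)\<^sup>2 \<partial>lborel))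
    + 4 * ((\<integral>\<^sup>+x. (osc_maxop \<epsilon> (2 ^ n) (-1) f x)\<^sup>2 \<partial>lborel) + (\<integral>\<^sup>+x. (osc_maxop \<epsilon> (- (2 ^ n)) (-1) f x)\<^sup>2 \<partial>lborel))"
    by (simp add: nn_integral_add nn_integral_cmult)
  also have "\<dots> \<le> 4 * (ennreal ?c * ?\<phi> + ennreal ?c * ?\<phi>) + 4 * (ennreal ?c * ?\<phi> + ennreal ?c * ?\<phi>)"
    by (intro add_mono mult_left_mono b) auto
  also have "\<dots> = 16 * (ennreal ?c * ?\<phi>)"
    by (simp only: mult_2[symmetric] mult.assoc[symmetric]) simp
  also have "\<dots> = ennreal (16 * ?c) * ?\<phi>"
    using \<delta> u by (subst ennreal_mult) (auto simp: mult.assoc)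
  finally show ?thesis .
qed

text \<open>The levels have squared norms at most c1 u^(2n) times that of f. Cauchy-Schwarz with
  weights u^n spends half of this decay and leaves a convergent series; each of the two geometric
  sums contributes 1/(1 - u).\<close>

lemma majorant_bound:
  assumes \<delta>: "0 < \<delta>" "\<delta> < 1" and \<epsilon>: "\<delta> < \<bar>\<epsilon>\<bar>" "\<delta> < \<bar>\<epsilon> - 1\<bar>" and u: "0 < u" "u < 1" "u ^ 8 = 1 / 2"
  defines "Q \<equiv> 2 powr (1 / \<delta>)"
  defines "c1 \<equiv> 16 * (108 * (32 * Q ^ 4 / \<delta>))" and "c2 \<equiv> 108 * (2 * pi)" and "K \<equiv> 4 + 8 * (1 + Q\<^sup>2)"
  shows "(\<integral>\<^sup>+x. (majorant \<epsilon> x)\<^sup>2 \<partial>lborel)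
    \<le> ennreal (2 * (c1 / (1 - u)\<^sup>2) + (16 * c2 + 4 * K\<^sup>2 * c2)) * (\<integral>\<^sup>+x. ennreal ((norm (f x))\<^sup>2) \<partial>lborel)"
proof -
  let ?\<phi> = "\<integral>\<^sup>+x. ennreal ((norm (f x))\<^sup>2) \<partial>lborel"
  have c0: "0 \<le> c1" "0 \<le> c2" "0 \<le> K" using \<delta> by (auto simp: c1_def c2_def K_def Q_def)
  have osc_level_meas [measurable]: "osc_level \<epsilon> n \<in> borel_measurable lborel" for n
  proof -
    have [measurable]: "osc_maxop \<epsilon> N s f \<in> borel_measurable lborel" for N s
      by (rule osc_maxop_measurable) simp
    show ?thesis unfolding osc_level_def by measurable
  qed
  have abs_poisson_meas [measurable]: "abs_poisson_maxop \<in> borel_measurable lborel"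
    unfolding abs_poisson_maxop_def by (rule poisson_maxop_measurable) simp
  have conj_poisson_meas [measurable]: "conj_poisson_maxop f \<in> borel_measurable lborel"
    by (rule conj_poisson_maxop_measurable) simp
  have abs_poisson_bound: "(\<integral>\<^sup>+x. (abs_poisson_maxop x)\<^sup>2 \<partial>lborel) \<le> ennreal c2 * ?\<phi>"
    unfolding abs_poisson_maxop_def c2_def using poisson_maxop_bound[of "\<lambda>z. complex_of_real (norm (f z))"] L2_finite by simp
  have conj_poisson_bound: "(\<integral>\<^sup>+x. (conj_poisson_maxop f x)\<^sup>2 \<partial>lborel) \<le> ennreal c2 * ?\<phi>"
    unfolding c2_def by (rule conj_poisson_maxop_bound) (use L2_finite in auto)
  have geo: "(\<Sum>n. ennreal (u ^ n)) = ennreal (1 / (1 - u))"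
    using u by (subst suminf_ennreal2) (auto simp: suminf_geometric summable_geometric)
  obtain v where v: "0 < v" "v\<^sup>2 = u" using u(1) by (metis real_sqrt_gt_zero real_sqrt_pow2 less_imp_le)
  have S: "(\<integral>\<^sup>+x. (\<Sum>n. osc_level \<epsilon> n x)\<^sup>2 \<partial>lborel) \<le> ennreal (c1 / (1 - u)\<^sup>2) * ?\<phi>"
  proof -
    have "(\<integral>\<^sup>+x. (\<Sum>n. osc_level \<epsilon> n x)\<^sup>2 \<partial>lborel)
      \<le> (\<integral>\<^sup>+x. ennreal (1 / (1 - u)) * (\<Sum>n. ennreal ((1 / u) ^ n) * (osc_level \<epsilon> n x)\<^sup>2) \<partial>lborel)"
      using ennreal_suminf_power2_le[OF v(1)] by (intro nn_integral_mono) (simp add: v(2) geo)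
    also have "\<dots> = ennreal (1 / (1 - u)) * (\<Sum>n. ennreal ((1 / u) ^ n) * (\<integral>\<^sup>+x. (osc_level \<epsilon> n x)\<^sup>2 \<partial>lborel))"
      by (simp add: nn_integral_cmult nn_integral_suminf)
    also have "\<dots> \<le> ennreal (1 / (1 - u)) * (\<Sum>n. ennreal (u ^ n) * (ennreal c1 * ?\<phi>))"
    proof (intro mult_left_mono suminf_le summableI)
      fix n
      have "ennreal ((1 / u) ^ n) * (\<integral>\<^sup>+x. (osc_level \<epsilon> n x)\<^sup>2 \<partial>lborel) \<le> ennreal ((1 / u) ^ n) * (ennreal (c1 * (u\<^sup>2) ^ n) * ?\<phi>)"
        using osc_level_bound[OF \<delta> \<epsilon> u, of n] by (intro mult_left_mono) (auto simp: c1_def Q_def mult_ac)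
      also have "\<dots> = ennreal ((1 / u) ^ n * (c1 * (u\<^sup>2) ^ n)) * ?\<phi>"
        using u c0 by (subst ennreal_mult) (auto simp: mult.assoc)
      also have "(1 / u) ^ n * (c1 * (u\<^sup>2) ^ n) = u ^ n * c1"
        using u by (simp add: power_divide power2_eq_square power_mult_distrib)
      also have "ennreal (u ^ n * c1) * ?\<phi> = ennreal (u ^ n) * (ennreal c1 * ?\<phi>)"
        using u c0 by (subst ennreal_mult) (auto simp: mult.assoc)
      finally show "ennreal ((1 / u) ^ n) * (\<integral>\<^sup>+x. (osc_level \<epsilon> n x)\<^sup>2 \<partial>lborel) \<le> ennreal (u ^ n) * (ennreal c1 * ?\<phi>)" .
    qed simp
    also have "\<dots> = ennreal (1 / (1 - u)) * (ennreal (1 / (1 - u)) * (ennreal c1 * ?\<phi>))"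
      by (simp only: ennreal_suminf_multc geo)
    also have "\<dots> = ennreal (1 / (1 - u) * (1 / (1 - u) * c1)) * ?\<phi>"
      using u c0 by (simp only: ennreal_mult mult.assoc zero_le_divide_1_iff diff_ge_0_iff_ge mult_nonneg_nonneg less_imp_le)
    also have "1 / (1 - u) * (1 / (1 - u) * c1) = c1 / (1 - u)\<^sup>2" by (simp add: power2_eq_square)
    finally show ?thesis .
  qed
  \<comment> \<open>The ratio of the annuli depends on \<epsilon>; its replacement by
    \<open>Q\<close> makes the constant uniform for |\<epsilon>| > \<delta>.\<close>
  have K: "4 + 8 * (1 + (2 powr (1 / \<bar>\<epsilon>\<bar>))\<^sup>2) \<le> K"
  proof -
    have "2 powr (1 / \<bar>\<epsilon>\<bar>) \<le> Q" unfolding Q_def using \<delta> \<epsilon> by (intro powr_mono) (auto simp: frac_le)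
    then have "(2 powr (1 / \<bar>\<epsilon>\<bar>))\<^sup>2 \<le> Q\<^sup>2" by (intro power_mono) auto
    then show ?thesis by (simp add: K_def)
  qed
  \<comment> \<open>With S the series, c the conjugate Poisson term and p the Poisson term, two uses
    of \<open>ennreal_add_power2_le\<close> turn (S + (2 c + K p))^2 into 2 S^2 + 16 c^2 + 4 K^2
    p^2.\<close>
  have "(\<integral>\<^sup>+x. (majorant \<epsilon> x)\<^sup>2 \<partial>lborel)
    \<le> (\<integral>\<^sup>+x. 2 * (\<Sum>n. osc_level \<epsilon> n x)\<^sup>2 + (16 * (conj_poisson_maxop f x)\<^sup>2 + ennreal (4 * K\<^sup>2) * (abs_poisson_maxop x)\<^sup>2) \<partial>lborel)"
  proof (intro nn_integral_mono)
    fix x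
    let ?S = "\<Sum>n. osc_level \<epsilon> n x" and ?c = "conj_poisson_maxop f x"
    have "majorant \<epsilon> x \<le> ?S + (2 * ?c + ennreal K * abs_poisson_maxop x)"
      unfolding majorant_def using K by (intro add_left_mono mult_right_mono ennreal_leI) auto
    then have "(majorant \<epsilon> x)\<^sup>2 \<le> (?S + (2 * ?c + ennreal K * abs_poisson_maxop x))\<^sup>2" by (rule power_mono) simp
    also have "\<dots> \<le> 2 * ?S\<^sup>2 + 2 * (2 * ?c + ennreal K * abs_poisson_maxop x)\<^sup>2" by (rule ennreal_add_power2_le)
    also have "\<dots> \<le> 2 * ?S\<^sup>2 + 2 * (2 * (2 * ?c)\<^sup>2 + 2 * (ennreal K * abs_poisson_maxop x)\<^sup>2)"
      by (intro add_left_mono mult_left_mono ennreal_add_power2_le) simp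
    also have "2 * (2 * (2 * ?c)\<^sup>2 + 2 * (ennreal K * abs_poisson_maxop x)\<^sup>2) = 16 * ?c\<^sup>2 + ennreal (4 * K\<^sup>2) * (abs_poisson_maxop x)\<^sup>2"
    proof -
      have "2 * (2 * (2 * ?c)\<^sup>2) = 16 * ?c\<^sup>2" by (simp add: power_mult_distrib mult.assoc[symmetric])
      moreover have "2 * (2 * (ennreal K * abs_poisson_maxop x)\<^sup>2) = ennreal (4 * K\<^sup>2) * (abs_poisson_maxop x)\<^sup>2"
        using c0 ennreal_mult[of 4 "K\<^sup>2"] by (simp add: power_mult_distrib mult.assoc[symmetric] ennreal_power)
      ultimately show ?thesis by (simp only: distrib_left)
    qed
    finally show "(majorant \<epsilon> x)\<^sup>2 \<le> 2 * ?S\<^sup>2 + (16 * ?c\<^sup>2 + ennreal (4 * K\<^sup>2) * (abs_poisson_maxop x)\<^sup>2)" .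
  qed
  also have "\<dots> = 2 * (\<integral>\<^sup>+x. (\<Sum>n. osc_level \<epsilon> n x)\<^sup>2 \<partial>lborel) + (16 * (\<integral>\<^sup>+x. (conj_poisson_maxop f x)\<^sup>2 \<partial>lborel) + ennreal (4 * K\<^sup>2) * (\<integral>\<^sup>+x. (abs_poisson_maxop x)\<^sup>2 \<partial>lborel))"
    by (simp add: nn_integral_add nn_integral_cmult)
  also have "\<dots> \<le> ennreal 2 * (ennreal (c1 / (1 - u)\<^sup>2) * ?\<phi>) + (ennreal 16 * (ennreal c2 * ?\<phi>) + ennreal (4 * K\<^sup>2) * (ennreal c2 * ?\<phi>))"
    by (simp only: ennreal_numeral) (intro add_mono mult_left_mono S conj_poisson_bound abs_poisson_bound, auto)
  also have "\<dots> = (ennreal (2 * (c1 / (1 - u)\<^sup>2)) + (ennreal (16 * c2) + ennreal (4 * K\<^sup>2 * c2))) * ?\<phi>"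
  proof -
    have e: "ennreal a * (ennreal b * c) = ennreal (a * b) * c" if "0 \<le> a" "0 \<le> b" for a b c
      using that by (simp add: ennreal_mult mult.assoc)
    have "0 \<le> c1 / (1 - u)\<^sup>2" "0 \<le> 4 * K\<^sup>2" using c0 by auto
    then show ?thesis using c0 by (simp only: e distrib_right zero_le_numeral)
  qed
  also have "\<dots> = ennreal (2 * (c1 / (1 - u)\<^sup>2) + (16 * c2 + 4 * K\<^sup>2 * c2)) * ?\<phi>"
  proof -
    have "0 \<le> 2 * (c1 / (1 - u)\<^sup>2)" "0 \<le> 16 * c2" "0 \<le> 4 * K\<^sup>2 * c2" using c0 by auto
    then show ?thesis by (simp only: ennreal_plus add_nonneg_nonneg)
  qed
  finally show ?thesis .
qed

end

section \<open>From squared norms to the statement for Schwartz functions\<close>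

lemma L2_norm_le:
  assumes "(\<integral>\<^sup>+x. (g x)\<^sup>2 \<partial>lborel) \<le> ennreal (C\<^sup>2) * (\<integral>\<^sup>+x. (h x)\<^sup>2 \<partial>lborel)"
    and "(\<integral>\<^sup>+x. (h x)\<^sup>2 \<partial>lborel) < \<infinity>" and "0 \<le> C"
  shows "L2_norm g \<le> ennreal C * L2_norm h"
proof -
  let ?g = "\<integral>\<^sup>+x. (g x)\<^sup>2 \<partial>lborel" and ?h = "\<integral>\<^sup>+x. (h x)\<^sup>2 \<partial>lborel"
  \<comment> \<open>\<open>enn2real\<close> sends infinity to 0, so both integrals must be known to
    be finite before their real roots are compared.\<close>
  have fin: "ennreal (C\<^sup>2) * ?h < \<infinity>" using assms(2) by (simp add: ennreal_mult_less_top)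
  then have "?g < \<infinity>" using assms(1) by (rule le_less_trans[rotated])
  have "enn2real ?g \<le> enn2real (ennreal (C\<^sup>2) * ?h)"
    using assms(1) fin by (intro enn2real_mono) auto
  also have "\<dots> = C\<^sup>2 * enn2real ?h" by (simp add: enn2real_mult)
  finally have "sqrt (enn2real ?g) \<le> C * sqrt (enn2real ?h)"
    using assms(3) real_sqrt_le_mono by (fastforce simp: real_sqrt_mult)
  then have "ennreal (sqrt (enn2real ?g)) \<le> ennreal C * ennreal (sqrt (enn2real ?h))"
    using assms(3) by (simp add: ennreal_leI flip: ennreal_mult)
  then show ?thesis
    using less_imp_neq[OF \<open>?g < \<infinity>\<close>] less_imp_neq[OF assms(2)] by (simp add: L2_norm_def ennreal_sqrt_def)
qed

text \<open>Three bounds suffice: for f, for x^2 f and for the derivative. The first two give |f| <=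
  (B + B2)/(1 + x^2), a multiple of \<open>poisson 1\<close>, which is integrable; the third gives
  the Lipschitz constant by the mean value inequality.\<close>

lemma schwartz_lipschitz_L1:
  assumes "schwartz f"
  shows "\<exists>B L. lipschitz_L1 f B L"
proof -
  have n0: "nth_deriv 0 f = f" "nth_deriv 1 f = (\<lambda>x. vector_derivative f (at x))"
    by (simp_all add: nth_deriv_def)
  have diff: "f differentiable (at x)" for x using assms n0(1) unfolding schwartz_def by metis
  have bdd: "bounded (range (\<lambda>x. x ^ m *\<^sub>R nth_deriv n f x))" for m n
    using assms by (simp add: schwartz_def)
  obtain B where B: "\<And>x. norm (f x) \<le> B" using bdd[of 0 0] by (auto simp: bounded_iff n0)
  obtain B2 where B2: "\<And>x. norm (x\<^sup>2 *\<^sub>R f x) \<le> B2" using bdd[of 2 0] by (auto simp: bounded_iff n0)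
  obtain L where L: "\<And>x. norm (vector_derivative f (at x)) \<le> L" using bdd[of 0 1] by (auto simp: bounded_iff n0(2)[unfolded One_nat_def])
  have "continuous_on UNIV f"
    using diff by (intro continuous_at_imp_continuous_on) (auto intro: differentiable_imp_continuous_within)
  then have [measurable]: "f \<in> borel_measurable borel" by (rule borel_measurable_continuous_onI)
  have lip: "norm (f x - f y) \<le> L * \<bar>x - y\<bar>" for x y
  proof -
    have "norm (f x - f y) \<le> L * norm (x - y)"
    proof (rule differentiable_bound[where S=UNIV and f'="\<lambda>x h. h *\<^sub>R vector_derivative f (at x)"])
      fix x
      show "(f has_derivative (\<lambda>h. h *\<^sub>R vector_derivative f (at x))) (at x within UNIV)"
        using diff[of x] by (simp add: vector_derivative_works has_vector_derivative_def)
      show "onorm (\<lambda>h. h *\<^sub>R vector_derivative f (at x)) \<le> L"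
        by (intro onorm_le) (simp add: mult.commute[of L] mult_left_mono L)
    qed auto
    then show ?thesis by simp
  qed
  have int: "integrable lborel f"
  proof (rule integrableI_bounded)
    have "(\<integral>\<^sup>+x. ennreal (norm (f x)) \<partial>lborel) \<le> (\<integral>\<^sup>+x. ennreal (B + B2) * ennreal (poisson 1 (x - 0)) \<partial>lborel)"
    proof (intro nn_integral_mono)
      fix x
      have "norm (f x) * (1 + x\<^sup>2) \<le> B + B2" using B[of x] B2[of x] by (simp add: distrib_left mult.commute)
      moreover have "0 < 1 + x\<^sup>2" by (simp add: add_pos_nonneg)
      ultimately have "norm (f x) \<le> (B + B2) * poisson 1 (x - 0)"
        by (simp add: poisson_def pos_le_divide_eq)
      moreover have "0 \<le> B + B2" using order_trans[OF norm_ge_zero B[of 0]] order_trans[OF norm_ge_zero B2[of 0]] by simp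
      ultimately show "ennreal (norm (f x)) \<le> ennreal (B + B2) * ennreal (poisson 1 (x - 0))"
        by (simp add: ennreal_leI flip: ennreal_mult)
    qed
    also have "\<dots> = ennreal (B + B2) * ennreal pi"
      using nn_integral_poisson'[of 1 0] by (subst nn_integral_cmult) simp_all
    also have "\<dots> < \<infinity>" by (simp add: ennreal_mult_less_top)
    finally show "(\<integral>\<^sup>+x. ennreal (norm (f x)) \<partial>lborel) < \<infinity>" .
  qed simp
  show ?thesis using B lip int by (auto simp: lipschitz_L1_def)
qed

theorem theorem1p3:
  fixes \<delta> :: real
  assumes "0 < \<delta>" and "\<delta> < 1"
  shows "\<exists>C::real. 0 \<le> C \<and>
    (\<forall>(\<epsilon>::real) (f :: real \<Rightarrow> complex).
       \<bar>\<epsilon>\<bar> > \<delta> \<longrightarrow> \<bar>\<epsilon> - 1\<bar> > \<delta> \<longrightarrow> schwartz f \<longrightarrow>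
         L2_norm (carleson_even \<epsilon> f) \<le> ennreal C * L2_norm (\<lambda>x. ennreal (norm (f x))) \<and>
         L2_norm (carleson_odd \<epsilon> f) \<le> ennreal C * L2_norm (\<lambda>x. ennreal (norm (f x))))"
proof -
  \<comment> \<open>The levels decay like u^(2n) = 2^(-n/4) in squared norm, and the weights of the
    summation use up u^n of this.\<close>
  define u :: real where "u = (1 / 2) powr (1 / 8)"
  have u0: "0 < u" by (simp add: u_def)
  have "u ^ 8 = u powr real 8" by (rule powr_realpow[OF u0, symmetric])
  also have "\<dots> = 1 / 2" unfolding u_def powr_powr by simp
  finally have u8: "u ^ 8 = 1 / 2" .
  have "u < 1"
  proof (rule ccontr)
    assume "\<not> u < 1"
    then have "1 \<le> u ^ 8" by (intro one_le_power) auto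
    with u8 show False by simp
  qed
  note u = u0 this u8
  define Q where "Q = 2 powr (1 / \<delta>)"
  \<comment> \<open>The constant of \<open>majorant_bound\<close> written out. It refers to squared
    norms, so the final C is its root, and it depends on \<delta> alone.\<close>
  define M where "M = 2 * (16 * (108 * (32 * Q ^ 4 / \<delta>)) / (1 - u)\<^sup>2) + (16 * (108 * (2 * pi)) + 4 * (4 + 8 * (1 + Q\<^sup>2))\<^sup>2 * (108 * (2 * pi)))"
  have "0 \<le> M" using assms by (simp add: M_def Q_def)
  show ?thesis
  proof (intro exI[of _ "sqrt M"] conjI allI impI)
    show "0 \<le> sqrt M" using \<open>0 \<le> M\<close> by simp
    fix \<epsilon> :: real and f :: "real \<Rightarrow> complex"
    assume \<epsilon>: "\<bar>\<epsilon>\<bar> > \<delta>" "\<bar>\<epsilon> - 1\<bar> > \<delta>" and f: "schwartz f"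
    obtain B L where "lipschitz_L1 f B L" using schwartz_lipschitz_L1[OF f] by blast
    then interpret lipschitz_L1 f B L .
    have M: "(\<integral>\<^sup>+x. (majorant \<epsilon> x)\<^sup>2 \<partial>lborel) \<le> ennreal ((sqrt M)\<^sup>2) * (\<integral>\<^sup>+x. (ennreal (norm (f x)))\<^sup>2 \<partial>lborel)"
      using majorant_bound[OF assms \<epsilon> u] \<open>0 \<le> M\<close> by (simp add: M_def Q_def ennreal_power)
    have fin: "(\<integral>\<^sup>+x. (ennreal (norm (f x)))\<^sup>2 \<partial>lborel) < \<infinity>" using L2_finite by (simp add: ennreal_power)
    have *: "L2_norm g \<le> ennreal (sqrt M) * L2_norm (\<lambda>x. ennreal (norm (f x)))" if "\<And>x. g x \<le> majorant \<epsilon> x" for g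
    proof (rule L2_norm_le[OF order_trans[OF _ M] fin])
      show "(\<integral>\<^sup>+x. (g x)\<^sup>2 \<partial>lborel) \<le> (\<integral>\<^sup>+x. (majorant \<epsilon> x)\<^sup>2 \<partial>lborel)"
        using that by (intro nn_integral_mono power_mono) auto
    qed (use \<open>0 \<le> M\<close> in simp)
    have "\<epsilon> \<noteq> 0" using \<epsilon> assms by auto
    then show "L2_norm (carleson_even \<epsilon> f) \<le> ennreal (sqrt M) * L2_norm (\<lambda>x. ennreal (norm (f x)))"
      "L2_norm (carleson_odd \<epsilon> f) \<le> ennreal (sqrt M) * L2_norm (\<lambda>x. ennreal (norm (f x)))"
      by (intro * carleson_le_majorant; assumption)+
  qed
qed

end
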